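(* The assignment $\mathcal{G}$ of open systems to boxes and wiring diagrams, together with the coherence maps $\mu$ (both defined in the context), is a lax monoidal functor $(\mathcal{G},\mu)\colon(\mathbf{W},\oplus,0)\to(\mathbf{Set},\times,\star)$; that is, $\mathcal{G}$ is a $\mathbf{W}$-algebra.
   Context: $\mathbf{Man}$ denotes a small category equivalent to the category of second-countable smooth manifolds and smooth maps. $(\mathbf{Set},\times,\star)$ is sets with cartesian product and one-point set $\star$. For a symmetric monoidal category $\mathcal{C}$, a $\mathcal{C}$-algebra is a lax monoidal functor $\mathcal{C}\to\mathbf{Set}$. **Typed finite sets.** $\mathbf{TFS}$ is the category whose objects are pairs $(A,\tau)$ with $A$ a finite set and $\tau\colon A\to \mathrm{Ob}\,\mathbf{Man}$, and whose morphisms $(A,\tau)\to(A',\tau')$ (typed functions) are functions $q\colon A\to A'$ with $\tau'\circ q=\tau$. It has finite coproducts $+$ (disjoint union); $\nabla$ is the codiagonal and $\mathbb{1}$ denotes identities. The dependent product of $(A,\tau)$ is $\overline{A}:=\prod_{a\in A}\tau(a)\in\mathbf{Man}$; a typed function $q\colon A\to A'$ induces $\overline{q}\colon\overline{A'}\to\overline{A}$, $(x_{a'})_{a'\in A'}\mapsto(x_{q(a)})_{a\in A}$. This is a functor $\mathbf{TFS}^{\mathrm{op}}\to\mathbf{Man}$, and canonically $\overline{A+B}\cong\overline{A}\times\overline{B}$. **The symmetric monoidal category $\mathbf{W}$.** Objects (boxes) are ordered pairs $X=(X^{\mathrm{in}},X^{\mathrm{out}})$ of typed finite sets. A morphism (wiring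 diagram) $\Phi\colon X\to Y$ is a triple $(X,Y,\varphi)$ with $\varphi\colon X^{\mathrm{in}}+Y^{\mathrm{out}}\xrightarrow{\cong}X^{\mathrm{out}}+Y^{\mathrm{in}}$ a typed bijection such that $\varphi(Y^{\mathrm{out}})\subseteq X^{\mathrm{out}}$; equivalently $\varphi$ is given by its restrictions $\varphi^{\mathrm{in}}\colon X^{\mathrm{in}}\to X^{\mathrm{out}}+Y^{\mathrm{in}}$ and $\varphi^{\mathrm{out}}\colon Y^{\mathrm{out}}\to X^{\mathrm{out}}$. The identity of $X$ is the identity map of $X^{\mathrm{in}}+X^{\mathrm{out}}$. The composite of $\Phi=(X,Y,\varphi)$ and $\Psi=(Y,Z,\psi)$ is $(X,Z,\omega)$ with $\omega^{\mathrm{out}}=\varphi^{\mathrm{out}}\circ\psi^{\mathrm{out}}$ and $$\omega^{\mathrm{in}}=(\nabla+\mathbb{1}_{Z^{\mathrm{in}}})\circ(\mathbb{1}_{X^{\mathrm{out}}}+\varphi^{\mathrm{out}}+\mathbb{1}_{Z^{\mathrm{in}}})\circ(\mathbb{1}_{X^{\mathrm{out}}}+\psi^{\mathrm{in}})\circ\varphi^{\mathrm{in}}.$$ The monoidal product is $X_1\oplus X_2=(X_1^{\mathrm{in}}+X_2^{\mathrm{in}},X_1^{\mathrm{out}}+X_2^{\mathrm{out}})$ on boxes and $\varphi_1+\varphi_2$ on wiring diagrams; the unit is $0=(\varnothing,\varnothing)$. Applying dependent products to a wiring diagram gives smooth maps $\overline{\varphi^{\mathrm{in}}}\colon\overline{X^{\mathrm{out}}}\times\overline{Y^{\mathrm{in}}}\to\overline{X^{\mathrm{in}}}$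 and $\overline{\varphi^{\mathrm{out}}}\colon\overline{X^{\mathrm{out}}}\to\overline{Y^{\mathrm{out}}}$. **Open systems.** An open (dynamical) system is a tuple $(M,U^{\mathrm{in}},U^{\mathrm{out}},f)$ with $M,U^{\mathrm{in}},U^{\mathrm{out}}\in\mathbf{Man}$ and $f=(f^{\mathrm{in}},f^{\mathrm{out}})$ a pair of smooth maps $f^{\mathrm{in}}\colon M\times U^{\mathrm{in}}\to TM$, $f^{\mathrm{out}}\colon M\to U^{\mathrm{out}}$, with $f^{\mathrm{in}}(m,u)\in T_mM$ for all $(m,u)$. The product of open systems $f_1,f_2$ is $f_1\times f_2$ with state, input and output spaces the products, $(f_1\times f_2)^{\mathrm{in}}((m_1,m_2),(u_1,u_2))=(f_1^{\mathrm{in}}(m_1,u_1),f_2^{\mathrm{in}}(m_2,u_2))\in TM_1\times TM_2\cong T(M_1\times M_2)$ and $(f_1\times f_2)^{\mathrm{out}}=f_1^{\mathrm{out}}\times f_2^{\mathrm{out}}$. **Definition of $(\mathcal{G},\mu)$.** For a box $X$, $$\mathcal{G}(X)=\{(S,f)\mid S\in\mathrm{Ob}\,\mathbf{TFS},\ (\overline{S},\overline{X^{\mathrm{in}}},\overline{X^{\mathrm{out}}},f)\text{ is an open system}\}.$$ For a wiring diagram $\Phi=(X,Y,\varphi)$, $\mathcal{G}(\Phi)\colon\mathcal{G}(X)\to\mathcal{G}(Y)$ sends $(S,f)$ to $(S,g)$, where for $s\in\overline{S}$, $y\in\overline{Y^{\mathrm{in}}}$, $$g^{\mathrm{in}}(s,y)=f^{\mathrm{in}}\bigl(s,\overline{\varphi^{\mathrm{in}}}(f^{\mathrm{out}}(s),y)\bigr),\qquad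 g^{\mathrm{out}}(s)=\overline{\varphi^{\mathrm{out}}}(f^{\mathrm{out}}(s)).$$ The coherence map $\mu_{X,X'}\colon\mathcal{G}(X)\times\mathcal{G}(X')\to\mathcal{G}(X\oplus X')$ is $((S,f),(S',f'))\mapsto(S+S',f\times f')$; the unit map $\star\to\mathcal{G}(0)$ picks out the trivial system with $S=\varnothing$. Convention: size issues are ignored, and the canonical associativity, unit and symmetry isomorphisms of finite coproducts of typed finite sets (and of the corresponding products of manifolds) are treated as equalities. *)

theory Defs
  imports "HOL-Analysis.Analysis"
begin

section \<open>Symmetric monoidal categories and lax monoidal functors to sets\<close>

record ('o, 'm) moncat =
  obs :: "'o set"
  hom :: "'o \<Rightarrow> 'o \<Rightarrow> 'm set"
  ident :: "'o \<Rightarrow> 'm"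
  cmp :: "'m \<Rightarrow> 'm \<Rightarrow> 'm"  (* cmp g f is g after f *)
  tens :: "'o \<Rightarrow> 'o \<Rightarrow> 'o"
  tensm :: "'m \<Rightarrow> 'm \<Rightarrow> 'm"
  tunit :: "'o"
  assoc :: "'o \<Rightarrow> 'o \<Rightarrow> 'o \<Rightarrow> 'm"
  lunit :: "'o \<Rightarrow> 'm"
  runit :: "'o \<Rightarrow> 'm"
  braid :: "'o \<Rightarrow> 'o \<Rightarrow> 'm"

locale cat =
  fixes C :: "('o, 'm) moncat"
  assumes ident_hom: "X \<in> obs C \<Longrightarrow> ident C X \<in> hom C X X"
    and cmp_hom: "\<lbrakk>X \<in> obs C; Y \<in> obs C; Z \<in> obs C; f \<in> hom C X Y; g \<in> hom C Y Z\<rbrakk>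
        \<Longrightarrow> cmp C g f \<in> hom C X Z"
    and cmp_ident_left: "\<lbrakk>X \<in> obs C; Y \<in> obs C; f \<in> hom C X Y\<rbrakk> \<Longrightarrow> cmp C (ident C Y) f = f"
    and cmp_ident_right: "\<lbrakk>X \<in> obs C; Y \<in> obs C; f \<in> hom C X Y\<rbrakk> \<Longrightarrow> cmp C f (ident C X) = f"
    and cmp_assoc: "\<lbrakk>W \<in> obs C; X \<in> obs C; Y \<in> obs C; Z \<in> obs C;
          f \<in> hom C W X; g \<in> hom C X Y; h \<in> hom C Y Z\<rbrakk>
        \<Longrightarrow> cmp C h (cmp C g f) = cmp C (cmp C h g) f"

definition is_iso :: "('o, 'm) moncat \<Rightarrow> 'o \<Rightarrow> 'o \<Rightarrow> 'm \<Rightarrow> bool" where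
  "is_iso C X Y f \<longleftrightarrow> f \<in> hom C X Y \<and>
     (\<exists>g \<in> hom C Y X. cmp C g f = ident C X \<and> cmp C f g = ident C Y)"

locale monoidal_cat = cat C for C :: "('o, 'm) moncat" +
  assumes tunit_ob: "tunit C \<in> obs C"
    and tens_ob: "\<lbrakk>X \<in> obs C; Y \<in> obs C\<rbrakk> \<Longrightarrow> tens C X Y \<in> obs C"
    and tensm_hom: "\<lbrakk>X \<in> obs C; X' \<in> obs C; Y \<in> obs C; Y' \<in> obs C;
          f \<in> hom C X X'; g \<in> hom C Y Y'\<rbrakk>
        \<Longrightarrow> tensm C f g \<in> hom C (tens C X Y) (tens C X' Y')"
    and tensm_ident: "\<lbrakk>X \<in> obs C; Y \<in> obs C\<rbrakk>
        \<Longrightarrow> tensm C (ident C X) (ident C Y) = ident C (tens C X Y)"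
    and tensm_cmp: "\<lbrakk>X \<in> obs C; X' \<in> obs C; X'' \<in> obs C; Y \<in> obs C; Y' \<in> obs C; Y'' \<in> obs C;
          f \<in> hom C X X'; f' \<in> hom C X' X''; g \<in> hom C Y Y'; g' \<in> hom C Y' Y''\<rbrakk>
        \<Longrightarrow> tensm C (cmp C f' f) (cmp C g' g) = cmp C (tensm C f' g') (tensm C f g)"
    and assoc_iso: "\<lbrakk>X \<in> obs C; Y \<in> obs C; Z \<in> obs C\<rbrakk>
        \<Longrightarrow> is_iso C (tens C (tens C X Y) Z) (tens C X (tens C Y Z)) (assoc C X Y Z)"
    and lunit_iso: "X \<in> obs C \<Longrightarrow> is_iso C (tens C (tunit C) X) X (lunit C X)"
    and runit_iso: "X \<in> obs C \<Longrightarrow> is_iso C (tens C X (tunit C)) X (runit C X)"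
    and assoc_natural: "\<lbrakk>X \<in> obs C; X' \<in> obs C; Y \<in> obs C; Y' \<in> obs C; Z \<in> obs C; Z' \<in> obs C;
          f \<in> hom C X X'; g \<in> hom C Y Y'; h \<in> hom C Z Z'\<rbrakk>
        \<Longrightarrow> cmp C (assoc C X' Y' Z') (tensm C (tensm C f g) h) =
            cmp C (tensm C f (tensm C g h)) (assoc C X Y Z)"
    and lunit_natural: "\<lbrakk>X \<in> obs C; Y \<in> obs C; f \<in> hom C X Y\<rbrakk>
        \<Longrightarrow> cmp C (lunit C Y) (tensm C (ident C (tunit C)) f) = cmp C f (lunit C X)"
    and runit_natural: "\<lbrakk>X \<in> obs C; Y \<in> obs C; f \<in> hom C X Y\<rbrakk>
        \<Longrightarrow> cmp C (runit C Y) (tensm C f (ident C (tunit C))) = cmp C f (runit C X)"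
    and pentagon: "\<lbrakk>W \<in> obs C; X \<in> obs C; Y \<in> obs C; Z \<in> obs C\<rbrakk>
        \<Longrightarrow> cmp C (assoc C W X (tens C Y Z)) (assoc C (tens C W X) Y Z) =
            cmp C (tensm C (ident C W) (assoc C X Y Z))
              (cmp C (assoc C W (tens C X Y) Z) (tensm C (assoc C W X Y) (ident C Z)))"
    and triangle: "\<lbrakk>X \<in> obs C; Y \<in> obs C\<rbrakk>
        \<Longrightarrow> cmp C (tensm C (ident C X) (lunit C Y)) (assoc C X (tunit C) Y) =
            tensm C (runit C X) (ident C Y)"

locale symmetric_monoidal_cat = monoidal_cat C for C :: "('o, 'm) moncat" +
  assumes braid_hom: "\<lbrakk>X \<in> obs C; Y \<in> obs C\<rbrakk>
        \<Longrightarrow> braid C X Y \<in> hom C (tens C X Y) (tens C Y X)"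
    and braid_braid: "\<lbrakk>X \<in> obs C; Y \<in> obs C\<rbrakk>
        \<Longrightarrow> cmp C (braid C Y X) (braid C X Y) = ident C (tens C X Y)"
    and braid_natural: "\<lbrakk>X \<in> obs C; X' \<in> obs C; Y \<in> obs C; Y' \<in> obs C;
          f \<in> hom C X X'; g \<in> hom C Y Y'\<rbrakk>
        \<Longrightarrow> cmp C (braid C X' Y') (tensm C f g) = cmp C (tensm C g f) (braid C X Y)"
    and hexagon: "\<lbrakk>X \<in> obs C; Y \<in> obs C; Z \<in> obs C\<rbrakk>
        \<Longrightarrow> cmp C (assoc C Y Z X) (cmp C (braid C X (tens C Y Z)) (assoc C X Y Z)) =
            cmp C (tensm C (ident C Y) (braid C X Z))
              (cmp C (assoc C Y X Z) (tensm C (braid C X Y) (ident C Z)))"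

text \<open>A lax monoidal functor \<open>(F, \<mu>, \<epsilon>)\<close> from \<open>C\<close> to sets with cartesian product and one-point set.
  A map of sets is a function considered on its carrier, so equations between maps are
  stated pointwise there.\<close>

locale lax_monoidal_functor = monoidal_cat C for C :: "('o, 'm) moncat" +
  fixes F :: "'o \<Rightarrow> 'a set"
    and Fm :: "'m \<Rightarrow> 'a \<Rightarrow> 'a"
    and \<mu> :: "'o \<Rightarrow> 'o \<Rightarrow> 'a \<times> 'a \<Rightarrow> 'a"
    and \<epsilon> :: "unit \<Rightarrow> 'a"
  assumes map_into: "\<lbrakk>X \<in> obs C; Y \<in> obs C; f \<in> hom C X Y\<rbrakk> \<Longrightarrow> Fm f \<in> F X \<rightarrow> F Y"
    and map_ident: "\<lbrakk>X \<in> obs C; a \<in> F X\<rbrakk> \<Longrightarrow> Fm (ident C X) a = a"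
    and map_cmp: "\<lbrakk>X \<in> obs C; Y \<in> obs C; Z \<in> obs C; f \<in> hom C X Y; g \<in> hom C Y Z; a \<in> F X\<rbrakk>
        \<Longrightarrow> Fm (cmp C g f) a = Fm g (Fm f a)"
    and mu_into: "\<lbrakk>X \<in> obs C; Y \<in> obs C\<rbrakk> \<Longrightarrow> \<mu> X Y \<in> F X \<times> F Y \<rightarrow> F (tens C X Y)"
    and eps_into: "\<epsilon> \<in> UNIV \<rightarrow> F (tunit C)"
    and mu_natural: "\<lbrakk>X \<in> obs C; X' \<in> obs C; Y \<in> obs C; Y' \<in> obs C;
          f \<in> hom C X X'; g \<in> hom C Y Y'; a \<in> F X; b \<in> F Y\<rbrakk>
        \<Longrightarrow> Fm (tensm C f g) (\<mu> X Y (a, b)) = \<mu> X' Y' (Fm f a, Fm g b)"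
    and mu_assoc: "\<lbrakk>X \<in> obs C; Y \<in> obs C; Z \<in> obs C; a \<in> F X; b \<in> F Y; c \<in> F Z\<rbrakk>
        \<Longrightarrow> Fm (assoc C X Y Z) (\<mu> (tens C X Y) Z (\<mu> X Y (a, b), c)) =
            \<mu> X (tens C Y Z) (a, \<mu> Y Z (b, c))"
    and mu_lunit: "\<lbrakk>X \<in> obs C; a \<in> F X\<rbrakk> \<Longrightarrow> Fm (lunit C X) (\<mu> (tunit C) X (\<epsilon> (), a)) = a"
    and mu_runit: "\<lbrakk>X \<in> obs C; a \<in> F X\<rbrakk> \<Longrightarrow> Fm (runit C X) (\<mu> X (tunit C) (a, \<epsilon> ())) = a"

locale set_algebra = symmetric_monoidal_cat C + lax_monoidal_functor C F Fm \<mu> \<epsilon>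
  for C :: "('o, 'm) moncat" and F :: "'o \<Rightarrow> 'a set" and Fm :: "'m \<Rightarrow> 'a \<Rightarrow> 'a"
    and \<mu> :: "'o \<Rightarrow> 'o \<Rightarrow> 'a \<times> 'a \<Rightarrow> 'a" and \<epsilon> :: "unit \<Rightarrow> 'a"


section \<open>Smooth manifolds\<close>

text \<open>Since the dimension of a manifold is a value and not a type, Euclidean spaces are the spaces
  of real functions on a finite index set \<open>I\<close>, represented by functions that are
  \<open>undefined\<close> outside \<open>I\<close>. With \<open>I = {..<n}\<close> this is n-dimensional Euclidean space; allowing any
  finite \<open>I\<close> makes products of charts canonical.\<close>

definition Rsp :: "'i set \<Rightarrow> ('i \<Rightarrow> real) topology" where
  "Rsp I = product_topology (\<lambda>_. euclideanreal) I"

definition pd :: "'i \<Rightarrow> (('i \<Rightarrow> real) \<Rightarrow> real) \<Rightarrow> ('i \<Rightarrow> real) \<Rightarrow> real" where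
  "pd i f x = deriv (\<lambda>t. f (x(i := t))) (x i)"

primrec pds :: "'i list \<Rightarrow> (('i \<Rightarrow> real) \<Rightarrow> real) \<Rightarrow> ('i \<Rightarrow> real) \<Rightarrow> real" where
  "pds [] f = f"
| "pds (i # is) f = pd i (pds is f)"

text \<open>Smoothness on an open subset \<open>U\<close> of \<open>Rsp I\<close>: all iterated partial derivatives exist
  and are continuous on \<open>U\<close>.\<close>

definition smooth_fun :: "'i set \<Rightarrow> ('i \<Rightarrow> real) set \<Rightarrow> (('i \<Rightarrow> real) \<Rightarrow> real) \<Rightarrow> bool" where
  "smooth_fun I U f \<longleftrightarrow>
     (\<forall>is. set is \<subseteq> I \<longrightarrow>
        continuous_map (subtopology (Rsp I) U) euclideanreal (pds is f) \<and>
        (\<forall>i\<in>I. \<forall>x\<in>U. (\<lambda>t. pds is f (x(i := t))) field_differentiable at (x i)))"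

text \<open>A manifold is given by its space and an atlas, indexed by \<open>charts\<close>, of coordinate maps
  \<open>cmap k\<close> on \<open>cdom k\<close>. The atlas need not be maximal: two atlases defining the same
  smooth structure give isomorphic (though different) manifolds.\<close>

record ('p, 'k, 'i) manifold =
  mtop :: "'p topology"
  mindex :: "'i set"
  charts :: "'k set"
  cdom :: "'k \<Rightarrow> 'p set"
  cmap :: "'k \<Rightarrow> 'p \<Rightarrow> 'i \<Rightarrow> real"

abbreviation points :: "('p, 'k, 'i) manifold \<Rightarrow> 'p set" where
  "points M \<equiv> topspace (mtop M)"

definition cinv :: "('p, 'k, 'i) manifold \<Rightarrow> 'k \<Rightarrow> ('i \<Rightarrow> real) \<Rightarrow> 'p" where
  "cinv M k = inv_into (cdom M k) (cmap M k)"

definition is_manifold :: "('p, 'k, 'i) manifold \<Rightarrow> bool" where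
  "is_manifold M \<longleftrightarrow>
     finite (mindex M) \<and> Hausdorff_space (mtop M) \<and> second_countable (mtop M) \<and>
     points M = (\<Union>k\<in>charts M. cdom M k) \<and>
     (\<forall>k\<in>charts M.
        openin (mtop M) (cdom M k) \<and>
        openin (Rsp (mindex M)) (cmap M k ` cdom M k) \<and>
        homeomorphic_map (subtopology (mtop M) (cdom M k))
          (subtopology (Rsp (mindex M)) (cmap M k ` cdom M k)) (cmap M k)) \<and>
     (\<forall>k\<in>charts M. \<forall>l\<in>charts M. \<forall>j\<in>mindex M.
        smooth_fun (mindex M) (cmap M k ` (cdom M k \<inter> cdom M l)) (\<lambda>x. cmap M l (cinv M k x) j))"

definition smooth_map ::
  "('p, 'k, 'i) manifold \<Rightarrow> ('q, 'l, 'j) manifold \<Rightarrow> ('p \<Rightarrow> 'q) \<Rightarrow> bool" where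
  "smooth_map M N F \<longleftrightarrow>
     continuous_map (mtop M) (mtop N) F \<and>
     (\<forall>k\<in>charts M. \<forall>l\<in>charts N. \<forall>j\<in>mindex N.
        smooth_fun (mindex M) (cmap M k ` {m \<in> cdom M k. F m \<in> cdom N l})
          (\<lambda>x. cmap N l (F (cinv M k x)) j))"

definition charts_at :: "('p, 'k, 'i) manifold \<Rightarrow> 'p \<Rightarrow> 'k set" where
  "charts_at M m = {k \<in> charts M. m \<in> cdom M k}"

text \<open>A tangent vector at \<open>m\<close> is a family of coordinate vectors, one for each chart around \<open>m\<close>,
  related by the Jacobians of the coordinate changes.\<close>

definition tangent_space :: "('p, 'k, 'i) manifold \<Rightarrow> 'p \<Rightarrow> ('k \<Rightarrow> 'i \<Rightarrow> real) set" where
  "tangent_space M m =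
     {v \<in> charts_at M m \<rightarrow>\<^sub>E (mindex M \<rightarrow>\<^sub>E UNIV).
        \<forall>k\<in>charts_at M m. \<forall>l\<in>charts_at M m. \<forall>j\<in>mindex M.
          v l j = (\<Sum>i\<in>mindex M. pd i (\<lambda>x. cmap M l (cinv M k x) j) (cmap M k m) * v k i)}"

definition tcdom :: "('p, 'k, 'i) manifold \<Rightarrow> 'k \<Rightarrow> ('p \<times> ('k \<Rightarrow> 'i \<Rightarrow> real)) set" where
  "tcdom M k = Sigma (cdom M k) (tangent_space M)"

definition tcmap ::
  "('p, 'k, 'i) manifold \<Rightarrow> 'k \<Rightarrow> 'p \<times> ('k \<Rightarrow> 'i \<Rightarrow> real) \<Rightarrow> 'i + 'i \<Rightarrow> real" where
  "tcmap M k = (\<lambda>(m, v). \<lambda>i\<in>mindex M <+> mindex M. case_sum (cmap M k m) (v k) i)"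

text \<open>The topology is the one making all the charts \<open>tcmap M k\<close> homeomorphisms onto open sets.\<close>

definition tangent_bundle ::
  "('p, 'k, 'i) manifold \<Rightarrow> ('p \<times> ('k \<Rightarrow> 'i \<Rightarrow> real), 'k, 'i + 'i) manifold" where
  "tangent_bundle M =
     \<lparr> mtop = topology_generated_by
         {{z \<in> tcdom M k. tcmap M k z \<in> V} |k V. k \<in> charts M \<and> openin (Rsp (mindex M <+> mindex M)) V},
       mindex = mindex M <+> mindex M, charts = charts M, cdom = tcdom M, cmap = tcmap M \<rparr>"

definition mprod ::
  "('p, 'k, 'i) manifold \<Rightarrow> ('q, 'l, 'j) manifold \<Rightarrow> ('p \<times> 'q, 'k \<times> 'l, 'i + 'j) manifold" where
  "mprod M N =
     \<lparr> mtop = prod_topology (mtop M) (mtop N),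
       mindex = mindex M <+> mindex N,
       charts = charts M \<times> charts N,
       cdom = (\<lambda>(k, l). cdom M k \<times> cdom N l),
       cmap = (\<lambda>(k, l) (m, n). \<lambda>i\<in>mindex M <+> mindex N. case_sum (cmap M k m) (cmap N l n) i) \<rparr>"


section \<open>Open systems\<close>

text \<open>Maps between manifolds are functions that are \<open>undefined\<close> outside the set of points, so that
  equality of systems is equality of functions.\<close>

definition open_system ::
  "('p, 'k, 'i) manifold \<Rightarrow> ('q, 'l, 'j) manifold \<Rightarrow> ('r, 'h, 'g) manifold \<Rightarrow>
   ('p \<times> 'q \<Rightarrow> 'p \<times> ('k \<Rightarrow> 'i \<Rightarrow> real)) \<times> ('p \<Rightarrow> 'r) \<Rightarrow> bool" where
  "open_system M Uin Uout = (\<lambda>(fin, fout).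
     is_manifold M \<and> is_manifold Uin \<and> is_manifold Uout \<and>
     fin \<in> extensional (points M \<times> points Uin) \<and> fout \<in> extensional (points M) \<and>
     smooth_map (mprod M Uin) (tangent_bundle M) fin \<and> smooth_map M Uout fout \<and>
     (\<forall>m\<in>points M. \<forall>u\<in>points Uin. fin (m, u) \<in> {m} \<times> tangent_space M m))"

text \<open>The identification of \<open>TM \<times> TN\<close> with \<open>T(M \<times> N)\<close>.\<close>

definition tangent_pair ::
  "('p, 'k, 'i) manifold \<Rightarrow> ('q, 'l, 'j) manifold \<Rightarrow>
   'p \<times> ('k \<Rightarrow> 'i \<Rightarrow> real) \<Rightarrow> 'q \<times> ('l \<Rightarrow> 'j \<Rightarrow> real) \<Rightarrow> ('p \<times> 'q) \<times> ('k \<times> 'l \<Rightarrow> 'i + 'j \<Rightarrow> real)" where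
  "tangent_pair M N = (\<lambda>(m, v) (n, w).
     ((m, n), \<lambda>(k, l)\<in>charts_at (mprod M N) (m, n).
                \<lambda>i\<in>mindex M <+> mindex N. case_sum (v k) (w l) i))"

definition system_prod where
  "system_prod M U f M' U' f' =
     ((\<lambda>((m, m'), (u, u'))\<in>(points M \<times> points M') \<times> (points U \<times> points U').
         tangent_pair M M' (fst f (m, u)) (fst f' (m', u'))),
      (\<lambda>(m, m')\<in>points M \<times> points M'. (snd f m, snd f' m')))"


section \<open>Typed finite sets\<close>

text \<open>A second-countable manifold has at most continuum many points and a countable atlas, so every
  one is diffeomorphic to one whose points are real numbers and whose atlas and coordinates
  are indexed by natural numbers; these form the small category of manifolds.\<close>

type_synonym man = "(real, nat, nat) manifold"

definition Man :: "man set" where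
  "Man = {M. is_manifold M}"

text \<open>Finite sets are finite sets of natural numbers, and the disjoint union of \<open>A\<close> and \<open>B\<close> consists
  of \<open>A\<close> followed by a copy of \<open>B\<close> shifted by the strict upper bound \<open>ub A\<close> of \<open>A\<close>. This coproduct
  is strictly associative and strictly unital, so that the canonical associativity
  and unit isomorphisms are indeed identities; the symmetry isomorphisms are
  not, and are written out.\<close>

definition ub :: "nat set \<Rightarrow> nat" where
  "ub A = (if A = {} then 0 else Suc (Max A))"

definition inl :: "nat \<Rightarrow> nat" where
  "inl a = a"

definition inr :: "nat set \<Rightarrow> nat \<Rightarrow> nat" where
  "inr A b = ub A + b"

definition dsum :: "nat set \<Rightarrow> nat set \<Rightarrow> nat set" where
  "dsum A B = inl ` A \<union> inr A ` B"

definition copair :: "nat set \<Rightarrow> nat set \<Rightarrow> (nat \<Rightarrow> 'b) \<Rightarrow> (nat \<Rightarrow> 'b) \<Rightarrow> nat \<Rightarrow> 'b" where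
  "copair A B f g = (\<lambda>x\<in>dsum A B. if x \<in> A then f x else g (x - ub A))"

text \<open>\<open>fsum A B A' f g\<close> is the sum of \<open>f : A \<rightarrow> A'\<close> and \<open>g : B \<rightarrow> B'\<close>.\<close>

definition fsum :: "nat set \<Rightarrow> nat set \<Rightarrow> nat set \<Rightarrow> (nat \<Rightarrow> nat) \<Rightarrow> (nat \<Rightarrow> nat) \<Rightarrow> nat \<Rightarrow> nat" where
  "fsum A B A' f g = copair A B (inl \<circ> f) (inr A' \<circ> g)"

definition nabla :: "nat set \<Rightarrow> nat \<Rightarrow> nat" where
  "nabla A = copair A A id id"

definition swap :: "nat set \<Rightarrow> nat set \<Rightarrow> nat \<Rightarrow> nat" where
  "swap A B = copair A B (inr B) inl"

text \<open>The canonical isomorphism \<open>(A + B) + (C + D) \<rightarrow> (A + C) + (B + D)\<close>.\<close>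

definition interchange :: "nat set \<Rightarrow> nat set \<Rightarrow> nat set \<Rightarrow> nat set \<Rightarrow> nat \<Rightarrow> nat" where
  "interchange A B C D =
     copair (dsum A B) (dsum C D) (fsum A B (dsum A C) inl inl) (fsum C D (dsum A C) (inr A) (inr B))"

type_synonym tfs = "nat set \<times> (nat \<Rightarrow> man)"

definition TFS :: "tfs set" where
  "TFS = {(A, \<tau>). finite A \<and> \<tau> \<in> A \<rightarrow>\<^sub>E Man}"

definition typed_fun :: "tfs \<Rightarrow> tfs \<Rightarrow> (nat \<Rightarrow> nat) set" where
  "typed_fun S T = {q \<in> fst S \<rightarrow>\<^sub>E fst T. \<forall>a\<in>fst S. snd T (q a) = snd S a}"

definition tsum :: "tfs \<Rightarrow> tfs \<Rightarrow> tfs" where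
  "tsum S T = (dsum (fst S) (fst T), copair (fst S) (fst T) (snd S) (snd T))"

definition tempty :: tfs where
  "tempty = ({}, \<lambda>_. undefined)"

definition dprod :: "tfs \<Rightarrow> (nat \<Rightarrow> real, nat \<Rightarrow> nat, nat \<times> nat) manifold" where
  "dprod = (\<lambda>(A, \<tau>).
     \<lparr> mtop = product_topology (\<lambda>a. mtop (\<tau> a)) A,
       mindex = (SIGMA a:A. mindex (\<tau> a)),
       charts = (\<Pi>\<^sub>E a\<in>A. charts (\<tau> a)),
       cdom = (\<lambda>k. \<Pi>\<^sub>E a\<in>A. cdom (\<tau> a) (k a)),
       cmap = (\<lambda>k x. \<lambda>(a, i)\<in>(SIGMA a:A. mindex (\<tau> a)). cmap (\<tau> a) (k a) (x a) i) \<rparr>)"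

text \<open>\<open>dmap A q\<close> is the map of dependent products induced by \<open>q : A \<rightarrow> A'\<close>.\<close>

definition dmap :: "nat set \<Rightarrow> (nat \<Rightarrow> nat) \<Rightarrow> (nat \<Rightarrow> 'b) \<Rightarrow> nat \<Rightarrow> 'b" where
  "dmap A q x = (\<lambda>a\<in>A. x (q a))"

text \<open>The identification of the dependent product of a sum with the product of the dependent
  products is \<open>split\<close> in one direction and \<open>copair\<close> in the other; it acts in this
  way on points as well as on chart indices.\<close>

definition split :: "nat set \<Rightarrow> nat set \<Rightarrow> (nat \<Rightarrow> 'b) \<Rightarrow> (nat \<Rightarrow> 'b) \<times> (nat \<Rightarrow> 'b)" where
  "split A B x = (dmap A inl x, dmap B (inr A) x)"

text \<open>The same identification on tangent bundles.\<close>

definition tangent_join ::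
  "tfs \<Rightarrow> tfs \<Rightarrow>
   ((nat \<Rightarrow> real) \<times> (nat \<Rightarrow> real)) \<times>
     ((nat \<Rightarrow> nat) \<times> (nat \<Rightarrow> nat) \<Rightarrow> (nat \<times> nat) + (nat \<times> nat) \<Rightarrow> real) \<Rightarrow>
   (nat \<Rightarrow> real) \<times> ((nat \<Rightarrow> nat) \<Rightarrow> nat \<times> nat \<Rightarrow> real)" where
  "tangent_join S T = (\<lambda>((s, t), w).
     let x = copair (fst S) (fst T) s t in
     (x, \<lambda>k\<in>charts_at (dprod (tsum S T)) x. \<lambda>(a, i)\<in>mindex (dprod (tsum S T)).
           w (split (fst S) (fst T) k)
             (if a \<in> fst S then Inl (a, i) else Inr (a - ub (fst S), i))))"


section \<open>Wiring diagrams\<close>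

type_synonym box = "tfs \<times> tfs"
type_synonym wiring = "box \<times> box \<times> (nat \<Rightarrow> nat)"

abbreviation box_in :: "box \<Rightarrow> tfs" where "box_in X \<equiv> fst X"
abbreviation box_out :: "box \<Rightarrow> tfs" where "box_out X \<equiv> snd X"
abbreviation lin :: "box \<Rightarrow> nat set" where "lin X \<equiv> fst (box_in X)"
abbreviation lout :: "box \<Rightarrow> nat set" where "lout X \<equiv> fst (box_out X)"

definition wirings :: "box \<Rightarrow> box \<Rightarrow> wiring set" where
  "wirings X Y =
     {(X, Y, \<phi>) |\<phi>.
        \<phi> \<in> typed_fun (tsum (box_in X) (box_out Y)) (tsum (box_out X) (box_in Y)) \<and>
        bij_betw \<phi> (dsum (lin X) (lout Y)) (dsum (lout X) (lin Y)) \<and>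
        \<phi> ` inr (lin X) ` lout Y \<subseteq> inl ` lout X}"

definition wire_in :: "wiring \<Rightarrow> nat \<Rightarrow> nat" where
  "wire_in = (\<lambda>(X, Y, \<phi>). \<lambda>a\<in>lin X. \<phi> (inl a))"

text \<open>The values lie in \<open>inl ` lout X\<close>, which is \<open>lout X\<close> as \<open>inl\<close> is an inclusion.\<close>

definition wire_out :: "wiring \<Rightarrow> nat \<Rightarrow> nat" where
  "wire_out = (\<lambda>(X, Y, \<phi>). \<lambda>b\<in>lout Y. \<phi> (inr (lin X) b))"

text \<open>The wiring diagram with restrictions \<open>\<alpha> : lin X \<rightarrow> lout X + lin Y\<close> and
  \<open>\<beta> : lout Y \<rightarrow> lout X\<close>.\<close>

definition mk_wiring :: "box \<Rightarrow> box \<Rightarrow> (nat \<Rightarrow> nat) \<Rightarrow> (nat \<Rightarrow> nat) \<Rightarrow> wiring" where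
  "mk_wiring X Y \<alpha> \<beta> = (X, Y, copair (lin X) (lout Y) \<alpha> (inl \<circ> \<beta>))"

text \<open>The identity map of \<open>lin X + lout X\<close>, seen as a map to \<open>lout X + lin X\<close>.\<close>

definition wiring_id :: "box \<Rightarrow> wiring" where
  "wiring_id X = (X, X, swap (lin X) (lout X))"

definition wiring_cmp :: "wiring \<Rightarrow> wiring \<Rightarrow> wiring" where
  "wiring_cmp \<Psi> \<Phi> =
     (let X = fst \<Phi>; Y = fst \<Psi>; Z = fst (snd \<Psi>) in
      mk_wiring X Z
        (fsum (dsum (lout X) (lout X)) (lin Z) (lout X) (nabla (lout X)) id
          \<circ> fsum (lout X) (dsum (lout Y) (lin Z)) (lout X) id
              (fsum (lout Y) (lin Z) (lout X) (wire_out \<Phi>) id)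
          \<circ> fsum (lout X) (lin Y) (lout X) id (wire_in \<Psi>)
          \<circ> wire_in \<Phi>)
        (wire_out \<Phi> \<circ> wire_out \<Psi>))"

definition box_sum :: "box \<Rightarrow> box \<Rightarrow> box" where
  "box_sum X Y = (tsum (box_in X) (box_in Y), tsum (box_out X) (box_out Y))"

text \<open>The sum of two wiring diagrams, conjugated by the canonical isomorphisms
  \<open>(lin X + lin X') + (lout Y + lout Y') \<cong> (lin X + lout Y) + (lin X' + lout Y')\<close> and
  \<open>(lout X + lin Y) + (lout X' + lin Y') \<cong> (lout X + lout X') + (lin Y + lin Y')\<close>.\<close>

definition wiring_sum :: "wiring \<Rightarrow> wiring \<Rightarrow> wiring" where
  "wiring_sum = (\<lambda>(X, Y, \<phi>) (X', Y', \<phi>').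
     (box_sum X X', box_sum Y Y',
      \<lambda>x\<in>dsum (dsum (lin X) (lin X')) (dsum (lout Y) (lout Y')).
        interchange (lout X) (lin Y) (lout X') (lin Y')
          (fsum (dsum (lin X) (lout Y)) (dsum (lin X') (lout Y')) (dsum (lout X) (lin Y)) \<phi> \<phi>'
            (interchange (lin X) (lin X') (lout Y) (lout Y') x))))"

definition wiring_braid :: "box \<Rightarrow> box \<Rightarrow> wiring" where
  "wiring_braid X Y =
     mk_wiring (box_sum X Y) (box_sum Y X)
       (inr (lout (box_sum X Y)) \<circ> swap (lin X) (lin Y)) (swap (lout Y) (lout X))"

definition WD :: "(box, wiring) moncat" where
  "WD = \<lparr> obs = TFS \<times> TFS, hom = wirings, ident = wiring_id, cmp = wiring_cmp,
     tens = box_sum, tensm = wiring_sum, tunit = (tempty, tempty),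
     assoc = (\<lambda>X Y Z. wiring_id (box_sum (box_sum X Y) Z)),
     lunit = wiring_id, runit = wiring_id, braid = wiring_braid \<rparr>"


section \<open>The algebra of open systems\<close>

type_synonym system =
  "tfs \<times> (((nat \<Rightarrow> real) \<times> (nat \<Rightarrow> real) \<Rightarrow>
            (nat \<Rightarrow> real) \<times> ((nat \<Rightarrow> nat) \<Rightarrow> nat \<times> nat \<Rightarrow> real)) \<times>
          ((nat \<Rightarrow> real) \<Rightarrow> nat \<Rightarrow> real))"

definition G_ob :: "box \<Rightarrow> system set" where
  "G_ob X = {(S, f). S \<in> TFS \<and> open_system (dprod S) (dprod (box_in X)) (dprod (box_out X)) f}"

definition G_map :: "wiring \<Rightarrow> system \<Rightarrow> system" where
  "G_map \<Phi> = (\<lambda>(S, fin, fout).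
     let X = fst \<Phi>; Y = fst (snd \<Phi>) in
     (S,
      \<lambda>(s, y)\<in>points (dprod S) \<times> points (dprod (box_in Y)).
        fin (s, dmap (lin X) (wire_in \<Phi>) (copair (lout X) (lin Y) (fout s) y)),
      \<lambda>s\<in>points (dprod S). dmap (lout Y) (wire_out \<Phi>) (fout s)))"

text \<open>The product of the two systems, transported along the identifications of the dependent
  product of a sum with the product of the dependent products.\<close>

definition G_mu :: "box \<Rightarrow> box \<Rightarrow> system \<times> system \<Rightarrow> system" where
  "G_mu X X' = (\<lambda>((S, f), (S', f')).
     let g = system_prod (dprod S) (dprod (box_in X)) f (dprod S') (dprod (box_in X')) f' in
     (tsum S S',
      \<lambda>(s, u)\<in>points (dprod (tsum S S')) \<times> points (dprod (tsum (box_in X) (box_in X'))).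
        tangent_join S S'
          (fst g (split (fst S) (fst S') s, split (lin X) (lin X') u)),
      \<lambda>s\<in>points (dprod (tsum S S')).
        case_prod (copair (lout X) (lout X')) (snd g (split (fst S) (fst S') s))))"

text \<open>The state space of the trivial system is a point, and its vector field is zero.\<close>

definition G_unit :: "unit \<Rightarrow> system" where
  "G_unit _ =
     (tempty,
      \<lambda>(s, u)\<in>points (dprod tempty) \<times> points (dprod tempty).
        (s, \<lambda>k\<in>charts_at (dprod tempty) s. \<lambda>i\<in>mindex (dprod tempty). 0),
      \<lambda>s\<in>points (dprod tempty). \<lambda>_. undefined)"

end

theory Submission
  imports Defs
begin

text \<open>
  A wiring diagram \<open>X \<rightarrow> Y\<close> is a pair of maps \<open>lin X \<rightarrow> lout X + lin Y\<close> and \<open>lout Y \<rightarrow> lout X\<close>. Written with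
  sum types, composition and sums of such pairs are given by case distinctions, and the laws of a
  symmetric monoidal category follow by following each wire. That a composite is again a bijection
  is a count: it is onto, and the numbers of wires agree.

  On systems, a wiring diagram acts by rerouting coordinates, so functoriality and the coherence
  equations are again checked wire by wire. What remains is that the rerouted and combined maps are
  smooth. In the coordinatewise definition of smoothness this rests on the chain rule; given that
  smooth maps compose, a map into a product is smooth as soon as its coordinates are, and a map into a
  tangent bundle is smooth as soon as its base point and the coordinates of its vector are. The
  Jacobians of a product manifold are block diagonal, so that tangent vectors of the factors
  combine to a tangent vector of the product.
\<close>

section \<open>Smooth functions on coordinate spaces\<close>

text \<open>Partial derivatives are formed with the total operator \<open>deriv\<close>, which is
  informative only where the function is differentiable along the coordinate line and which depends
  on the values nearby. Hence equations between functions are differentiated on open sets only, and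
  charts enter through their open images. The tangent bundle appears only as the target of a smooth
  map. Composition asks of a target just open chart domains, so its chart changes, which contain the
  Jacobians of the base, are never examined. Since the disjoint union is strictly associative and
  unital, all structural isomorphisms other than the symmetry are identity diagrams. Pentagon,
  triangle and the coherence equations of \<open>G_mu\<close> then compare objects over literally
  the same sets. What remains there is the handling of cut-offs: maps, charts and vectors are
  \<open>undefined\<close> off their domains, and most auxiliary memberships serve to show that a
  cut-off function is evaluated inside its domain.\<close>

lemma topspace_Rsp [simp]: "topspace (Rsp I) = extensional I"
  by (simp add: Rsp_def PiE_def)

section \<open>Neighbourhoods in coordinate spaces\<close>

lemma openin_Rsp_extensional: "openin (Rsp I) U \<Longrightarrow> x \<in> U \<Longrightarrow> x \<in> extensional I"
  using openin_subset by fastforce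

text \<open>A basic open box bounds each coordinate separately. As there are finitely many
  coordinates, the minimum of their radii serves for all of them. This gives coordinate spaces a
  usable epsilon-delta form without a norm.\<close>

lemma openin_Rsp_box:
  assumes "finite I" "openin (Rsp I) U" "x \<in> U"
  obtains d :: real where "d > 0" "\<And>y. y \<in> extensional I \<Longrightarrow> (\<And>i. i \<in> I \<Longrightarrow> \<bar>y i - x i\<bar> < d) \<Longrightarrow> y \<in> U"
proof -
  obtain V where V: "\<forall>i\<in>I. openin euclideanreal (V i)" "x \<in> Pi\<^sub>E I V" "Pi\<^sub>E I V \<subseteq> U"
    using bspec[OF assms(2)[unfolded Rsp_def openin_product_topology_alt] assms(3)] by iprover
  have "\<exists>e. \<forall>i\<in>I. e i > 0 \<and> (\<forall>t. \<bar>t - x i\<bar> < e i \<longrightarrow> t \<in> V i)"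
  proof (rule bchoice, rule ballI)
    fix i assume "i \<in> I"
    then have "open (V i)" "x i \<in> V i" using V by auto
    then show "\<exists>e. e > 0 \<and> (\<forall>t. \<bar>t - x i\<bar> < e \<longrightarrow> t \<in> V i)"
      unfolding open_dist by (auto simp: dist_real_def)
  qed
  then obtain e where e: "\<And>i. i \<in> I \<Longrightarrow> e i > 0" "\<And>i t. i \<in> I \<Longrightarrow> \<bar>t - x i\<bar> < e i \<Longrightarrow> t \<in> V i"
    by blast
  \<comment> \<open>The 1 keeps the minimum meaningful when \<open>I\<close> is empty.\<close>
  define d where "d = Min (insert 1 (e ` I))"
  have pos: "d > 0" unfolding d_def using assms(1) e(1) by (subst Min_gr_iff) auto
  have box: "y \<in> U" if "y \<in> extensional I" "\<And>i. i \<in> I \<Longrightarrow> \<bar>y i - x i\<bar> < d" for y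
  proof -
    have "d \<le> e i" if "i \<in> I" for i
      unfolding d_def using assms(1) that by (intro Min_le) auto
    with that(2) have "y i \<in> V i" if "i \<in> I" for i
      using e(2)[OF that] less_le_trans that by blast
    with that(1) have "y \<in> Pi\<^sub>E I V" by (simp add: PiE_iff)
    then show ?thesis using V(3) by blast
  qed
  show thesis using pos box by (rule that)
qed

lemma openin_preimage_real_ball:
  assumes "openin X U" "continuous_map (subtopology X U) euclideanreal f"
  shows "openin X {y \<in> U. \<bar>f y - c\<bar> < e}"
proof -
  have "open {r. \<bar>r - c\<bar> < e}"
    by (intro open_Collect_less continuous_intros)
  then have "openin (subtopology X U) {y \<in> topspace (subtopology X U). f y \<in> {r. \<bar>r - c\<bar> < e}}"
    using assms(2) by (intro openin_continuous_map_preimage) auto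
  moreover have "topspace (subtopology X U) = U"
    using assms(1) openin_subset by fastforce
  moreover have "{y \<in> topspace (subtopology X U). f y \<in> {r. \<bar>r - c\<bar> < e}} = {y \<in> U. \<bar>f y - c\<bar> < e}"
    using \<open>topspace (subtopology X U) = U\<close> by blast
  ultimately show ?thesis using assms(1) by (simp only: openin_open_subtopology)
qed

text \<open>A small move of one coordinate stays in an open set. This is why \<open>pd\<close> and
  \<open>pdiff\<close> at a point are determined by the values on any open set around it.\<close>

lemma eventually_fun_upd_mem:
  assumes "finite I" "openin (Rsp I) U" "x \<in> U" "i \<in> I"
  shows "eventually (\<lambda>t. x(i := t) \<in> U) (nhds (x i))"
proof -
  obtain d where d: "d > 0" "\<And>y. y \<in> extensional I \<Longrightarrow> (\<And>i. i \<in> I \<Longrightarrow> \<bar>y i - x i\<bar> < d) \<Longrightarrow> y \<in> U"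
    using openin_Rsp_box[OF assms(1-3)] by blast
  have "eventually (\<lambda>t. dist t (x i) < d) (nhds (x i))"
    using d(1) eventually_nhds_metric by blast
  then show ?thesis
  proof (rule eventually_mono)
    fix t assume "dist t (x i) < d"
    then show "x(i := t) \<in> U"
      using d(1) openin_Rsp_extensional[OF assms(2,3)] assms(4)
      by (intro d(2)) (auto simp: dist_real_def extensional_def)
  qed
qed

text \<open>Kept folded: the simplifier does not terminate on rewrite rules that mention
  \<open>x(i := t)\<close> and \<open>x i\<close> for a schematic \<open>x\<close>.\<close>

definition pdiff :: "'i \<Rightarrow> (('i \<Rightarrow> real) \<Rightarrow> real) \<Rightarrow> ('i \<Rightarrow> real) \<Rightarrow> bool" where
  "pdiff i f x \<longleftrightarrow> (\<lambda>t. f (x(i := t))) field_differentiable at (x i)"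

section \<open>Partial derivatives and the chain rule along a curve\<close>

lemma smooth_fun_alt:
  "smooth_fun I U f \<longleftrightarrow>
     (\<forall>is. set is \<subseteq> I \<longrightarrow>
        continuous_map (subtopology (Rsp I) U) euclideanreal (pds is f) \<and>
        (\<forall>i\<in>I. \<forall>x\<in>U. pdiff i (pds is f) x))"
  by (simp only: smooth_fun_def pdiff_def)

lemma has_pd:
  assumes "pdiff i f x"
  shows "((\<lambda>t. f (x(i := t))) has_field_derivative pd i f x) (at (x i))"
  using assms by (simp add: pdiff_def pd_def DERIV_deriv_iff_field_differentiable)

lemma pd_cong_open:
  assumes "finite I" "openin (Rsp I) U" "x \<in> U" "i \<in> I" "\<And>x. x \<in> U \<Longrightarrow> f x = g x"
  shows "pd i f x = pd i g x"
  unfolding pd_def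
  by (rule deriv_cong_ev)
     (auto intro: eventually_mono[OF eventually_fun_upd_mem[OF assms(1-4)]] assms(5))

lemma pdiff_cong_open:
  assumes "finite I" "openin (Rsp I) U" "x \<in> U" "i \<in> I" "\<And>x. x \<in> U \<Longrightarrow> f x = g x"
    and "pdiff i f x"
  shows "pdiff i g x"
proof -
  have "((\<lambda>t. f (x(i := t))) has_field_derivative pd i f x) (at (x i))"
    using assms(6) by (rule has_pd)
  then have "((\<lambda>t. g (x(i := t))) has_field_derivative pd i f x) (at (x i))"
    by (subst (asm) DERIV_cong_ev[OF refl _ refl])
       (auto intro: eventually_mono[OF eventually_fun_upd_mem[OF assms(1-4)]] assms(5))
  then show ?thesis unfolding pdiff_def field_differentiable_def by blast
qed

text \<open>By the mean value theorem the increment is \<open>h t - h t0\<close> times the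
  \<open>k\<close>-th partial derivative at an intermediate point, and continuity of that partial
  derivative controls the factor. Only the difference is differentiated, so the base point
  \<open>y t\<close> just has to converge to \<open>y t0\<close>.\<close>

lemma has_field_derivative_coord_increment:
  assumes J: "finite J" and V: "openin (Rsp J) V" and k: "k \<in> J"
    and cont: "continuous_map (subtopology (Rsp J) V) euclideanreal (pd k f)"
    and diff: "\<And>x. x \<in> V \<Longrightarrow> pdiff k f x"
    and y: "\<And>t. y t \<in> extensional J" "y t0 \<in> V" "\<And>t. y t k = y t0 k"
    and ylim: "\<And>j. j \<in> J \<Longrightarrow> ((\<lambda>t. y t j) \<longlongrightarrow> y t0 j) (at t0)"
    and h: "(h has_field_derivative h') (at t0)" "h t0 = y t0 k"
  shows "((\<lambda>t. f ((y t)(k := h t)) - f (y t)) has_field_derivative pd k f (y t0) * h') (at t0)"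
proof -
  define D where "D t = f ((y t)(k := h t)) - f (y t)" for t
  define p where "p = pd k f (y t0)"
  \<comment> \<open>The difference quotient of \<open>f\<close> in its \<open>k\<close>-th
    coordinate, with the expected limit filled in where \<open>h t = h t0\<close>. This happens
    possibly for \<open>t\<close> arbitrarily close to \<open>t0\<close>; there \<open>D t\<close>
    vanishes too, so \<open>D t = c t * (h t - h t0)\<close> holds for every
    \<open>t\<close>.\<close>
  define c where "c t = (if h t = h t0 then p else D t / (h t - h t0))" for t
  have upd: "(y t)(k := h t0) = y t" for t
    using y(3)[of t] h(2) by (auto simp: fun_eq_iff)
  have D: "D t = c t * (h t - h t0)" for t
    using upd[of t] by (auto simp: c_def D_def)
  have hlim: "(h \<longlongrightarrow> h t0) (at t0)"
    using h(1) DERIV_isCont isCont_def by blast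
  have "(c \<longlongrightarrow> p) (at t0)"
  proof (rule tendstoI)
    fix e :: real assume "e > 0"
    \<comment> \<open>A box inside \<open>?W\<close> contains \<open>y t\<close>, its
      \<open>k\<close>-th coordinate replaced by any value close to \<open>h t0\<close>, and so
      every intermediate point that the mean value theorem can return.\<close>
    let ?W = "{z \<in> V. \<bar>pd k f z - p\<bar> < e}"
    have "openin (Rsp J) ?W" by (rule openin_preimage_real_ball[OF V cont])
    moreover have "y t0 \<in> ?W" using \<open>e > 0\<close> y(2) by (simp add: p_def)
    ultimately obtain d where d: "d > 0"
      "\<And>z. z \<in> extensional J \<Longrightarrow> (\<And>i. i \<in> J \<Longrightarrow> \<bar>z i - y t0 i\<bar> < d) \<Longrightarrow> z \<in> ?W"
      using openin_Rsp_box[OF J] by blast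
    have "\<forall>j\<in>J. eventually (\<lambda>t. dist (y t j) (y t0 j) < d) (at t0)"
      using ylim d(1) by (auto intro: tendstoD)
    then have "eventually (\<lambda>t. \<forall>j\<in>J. dist (y t j) (y t0 j) < d) (at t0)"
      using J by (simp add: eventually_ball_finite)
    moreover have "eventually (\<lambda>t. dist (h t) (h t0) < d) (at t0)"
      using hlim d(1) by (rule tendstoD)
    ultimately show "eventually (\<lambda>t. dist (c t) p < e) (at t0)"
    proof eventually_elim
      case (elim t)
      show ?case
      proof (cases "h t = h t0")
        case True then show ?thesis using \<open>e > 0\<close> by (simp add: c_def)
      next
        case False
        let ?F = "\<lambda>s. f ((y t)(k := s))" and ?F' = "\<lambda>s. pd k f ((y t)(k := s))"
        have inW: "(y t)(k := s) \<in> ?W" if "\<bar>s - h t0\<bar> < d" for s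
          using that elim h(2) k y(1)[of t]
          by (intro d(2)) (auto simp: dist_real_def extensional_def)
        have der: "(?F has_field_derivative ?F' s) (at s)" if "\<bar>s - h t0\<bar> < d" for s
          using has_pd[of k f "(y t)(k := s)", OF diff] inW[OF that]
          by (simp only: fun_upd_upd fun_upd_same mem_Collect_eq)
        have ht: "\<bar>h t - h t0\<bar> < d" using elim by (simp add: dist_real_def)
        obtain s where s: "\<bar>s - h t0\<bar> < d" "?F (h t) - ?F (h t0) = (h t - h t0) * ?F' s"
        proof (cases "h t0 < h t")
          case True
          have "\<exists>z. z > h t0 \<and> z < h t \<and> ?F (h t) - ?F (h t0) = (h t - h t0) * ?F' z"
            using ht by (intro MVT2[OF True] der) auto
          then obtain z where "h t0 < z" "z < h t" "?F (h t) - ?F (h t0) = (h t - h t0) * ?F' z"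
            by blast
          then show thesis using ht by (intro that[of z]) auto
        next
          case False
          with \<open>h t \<noteq> h t0\<close> have lt: "h t < h t0" by simp
          have "\<exists>z. z > h t \<and> z < h t0 \<and> ?F (h t0) - ?F (h t) = (h t0 - h t) * ?F' z"
            using ht by (intro MVT2[OF lt] der) auto
          then obtain z where "z > h t" "z < h t0" "?F (h t0) - ?F (h t) = (h t0 - h t) * ?F' z"
            by blast
          then show thesis using ht by (intro that[of z]) (auto simp: algebra_simps)
        qed
        have "c t = ?F' s"
          using False s(2) upd[of t] by (simp add: c_def D_def)
        then show ?thesis using inW[OF s(1)] by (simp add: dist_real_def)
      qed
    qed
  qed
  moreover have "((\<lambda>t. (h t - h t0) / (t - t0)) \<longlongrightarrow> h') (at t0)"
    using h(1) by (simp add: has_field_derivative_iff)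
  ultimately have "((\<lambda>t. c t * ((h t - h t0) / (t - t0))) \<longlongrightarrow> p * h') (at t0)"
    by (rule tendsto_mult)
  then have "((\<lambda>t. (D t - D t0) / (t - t0)) \<longlongrightarrow> p * h') (at t0)"
    by (simp add: D)
  then show ?thesis by (simp add: has_field_derivative_iff D_def p_def)
qed

text \<open>The coordinates of the curve are released one at a time, so that each step is an increment
  in a single variable, to which the mean value theorem applies.\<close>

lemma has_field_derivative_along_curve:
  assumes J: "finite J" and V: "openin (Rsp J) V"
    and cont: "\<And>j. j \<in> J \<Longrightarrow> continuous_map (subtopology (Rsp J) V) euclideanreal (pd j f)"
    and diff: "\<And>j x. j \<in> J \<Longrightarrow> x \<in> V \<Longrightarrow> pdiff j f x"
    and g: "\<And>t. g t \<in> extensional J" "g t0 \<in> V"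
    and g': "\<And>j. j \<in> J \<Longrightarrow> ((\<lambda>t. g t j) has_field_derivative g' j) (at t0)"
  shows "((\<lambda>t. f (g t)) has_field_derivative (\<Sum>j\<in>J. pd j f (g t0) * g' j)) (at t0)"
proof -
  have "((\<lambda>t. f (override_on (g t0) (g t) K)) has_field_derivative
          (\<Sum>j\<in>K. pd j f (g t0) * g' j)) (at t0)" if "K \<subseteq> J" for K
    using finite_subset[OF that J] that
  proof (induction K rule: finite_induct)
    case empty
    then show ?case by simp
  next
    case (insert k K)
    let ?y = "\<lambda>t. override_on (g t0) (g t) K"
    have y0: "?y t0 = g t0" by (auto simp: override_on_def fun_eq_iff)
    have "((\<lambda>t. f ((?y t)(k := g t k)) - f (?y t)) has_field_derivative pd k f (?y t0) * g' k) (at t0)"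
    proof (rule has_field_derivative_coord_increment[OF J V])
      show "((\<lambda>t. ?y t j) \<longlongrightarrow> ?y t0 j) (at t0)" if "j \<in> J" for j
        using DERIV_isCont[OF g'[OF that]] by (cases "j \<in> K") (simp_all add: isCont_def)
    qed (use insert g cont diff g' y0 in \<open>auto simp: override_on_def extensional_def\<close>)
    then have "((\<lambda>t. f (?y t) + (f ((?y t)(k := g t k)) - f (?y t))) has_field_derivative
        (\<Sum>j\<in>K. pd j f (g t0) * g' j) + pd k f (g t0) * g' k) (at t0)"
      using insert by (intro DERIV_add) (auto simp: y0)
    moreover have "(?y t)(k := g t k) = override_on (g t0) (g t) (insert k K)" for t
      by (auto simp: override_on_def fun_eq_iff)
    ultimately show ?case using insert by (simp add: add.commute)
  qed
  from this[of J] have "((\<lambda>t. f (override_on (g t0) (g t) J)) has_field_derivative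
      (\<Sum>j\<in>J. pd j f (g t0) * g' j)) (at t0)" by simp
  moreover have "override_on (g t0) (g t) J = g t" for t
    using g(1)[of t] g(1)[of t0] by (auto simp: override_on_def fun_eq_iff extensional_def)
  ultimately show ?thesis by simp
qed

text \<open>A list in \<open>pds\<close> adds new derivatives on the outside, whereas
  \<open>Ck\<close> differentiates \<open>f\<close> itself first. With \<open>f\<close> varying,
  induction on the order then follows the product rule and the chain rule.\<close>

primrec Ck :: "nat \<Rightarrow> 'i set \<Rightarrow> ('i \<Rightarrow> real) set \<Rightarrow> (('i \<Rightarrow> real) \<Rightarrow> real) \<Rightarrow> bool" where
  "Ck 0 I U f \<longleftrightarrow> continuous_map (subtopology (Rsp I) U) euclideanreal f"
| "Ck (Suc n) I U f \<longleftrightarrow> continuous_map (subtopology (Rsp I) U) euclideanreal f \<and>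
     (\<forall>i\<in>I. \<forall>x\<in>U. pdiff i f x) \<and>
     (\<forall>i\<in>I. Ck n I U (pd i f))"

lemma Ck_imp_continuous: "Ck n I U f \<Longrightarrow> continuous_map (subtopology (Rsp I) U) euclideanreal f"
  by (cases n) auto

lemma Ck_SucD: "Ck (Suc n) I U f \<Longrightarrow> Ck n I U f"
  by (induction n arbitrary: f) auto

lemma pds_append: "pds (is @ js) f = pds is (pds js f)"
  by (induction "is") auto

lemma smooth_fun_pd: "smooth_fun I U f \<Longrightarrow> i \<in> I \<Longrightarrow> smooth_fun I U (pd i f)"
  unfolding smooth_fun_alt
  by (metis pds_append pds.simps set_append Un_subset_iff empty_set empty_subsetI insert_subset list.simps(15))

lemma smooth_fun_imp_continuous:
  "smooth_fun I U f \<Longrightarrow> continuous_map (subtopology (Rsp I) U) euclideanreal f"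
  unfolding smooth_fun_alt by (metis empty_set empty_subsetI pds.simps(1))

lemma smooth_fun_differentiable:
  "smooth_fun I U f \<Longrightarrow> i \<in> I \<Longrightarrow> x \<in> U \<Longrightarrow> pdiff i f x"
  unfolding smooth_fun_alt by (metis empty_set empty_subsetI pds.simps(1))

text \<open>The order must exceed the length of the list strictly, because differentiability of the
  last derivative formed costs one more order.\<close>

lemma Ck_pds:
  "Ck n I U f \<Longrightarrow> set is \<subseteq> I \<Longrightarrow> length is < n \<Longrightarrow>
     continuous_map (subtopology (Rsp I) U) euclideanreal (pds is f) \<and>
     (\<forall>i\<in>I. \<forall>x\<in>U. pdiff i (pds is f) x)"
proof (induction n arbitrary: f "is")
  case (Suc n)
  show ?case
  \<comment> \<open>The last entry of the list is the derivative taken first, which is the one that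
    \<open>Ck\<close> peels off.\<close>
  proof (cases "is" rule: rev_cases)
    case Nil
    then show ?thesis using Suc.prems(1) by (simp only: pds.simps Ck.simps) blast
  next
    case (snoc js i)
    have "i \<in> I" "set js \<subseteq> I" "length js < n" using Suc.prems(2,3) snoc by auto
    moreover have "Ck n I U (pd i f)" using Suc.prems(1) \<open>i \<in> I\<close> by simp
    ultimately show ?thesis
      using Suc.IH[of "pd i f" js] unfolding snoc pds_append pds.simps by blast
  qed
qed simp

lemma smooth_fun_iff_Ck: "smooth_fun I U f \<longleftrightarrow> (\<forall>n. Ck n I U f)"
proof
  show "\<forall>n. Ck n I U f" if "smooth_fun I U f"
  proof
    show "Ck n I U f" for n
      using that
    proof (induction n arbitrary: f)
      case 0 then show ?case by (simp add: smooth_fun_imp_continuous)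
    next
      case (Suc n)
      then show ?case
        by (auto simp: smooth_fun_imp_continuous smooth_fun_differentiable smooth_fun_pd)
    qed
  qed
next
  assume *: "\<forall>n. Ck n I U f"
  show "smooth_fun I U f"
    unfolding smooth_fun_alt
    using Ck_pds[OF *[rule_format]] lessI by blast
qed

lemma Ck_cong:
  assumes "finite I" "openin (Rsp I) U"
  shows "(\<And>x. x \<in> U \<Longrightarrow> f x = g x) \<Longrightarrow> Ck n I U f \<Longrightarrow> Ck n I U g"
proof (induction n arbitrary: f g)
  case 0
  then show ?case using continuous_map_eq[of "subtopology (Rsp I) U" euclideanreal f g] by simp
next
  case (Suc n)
  have "Ck n I U (pd i g)" if "i \<in> I" for i
  proof (rule Suc.IH)
    show "pd i f x = pd i g x" if "x \<in> U" for x
      by (rule pd_cong_open[OF assms that \<open>i \<in> I\<close> Suc.prems(1)])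
    show "Ck n I U (pd i f)" using Suc.prems(2) that by simp
  qed
  moreover have "pdiff i g x" if "x \<in> U" "i \<in> I" for x i
  proof (rule pdiff_cong_open[OF assms that, of f])
    show "pdiff i f x"
      using Suc.prems(2)[unfolded Ck.simps] that by blast
  qed (rule Suc.prems(1))
  moreover have "continuous_map (subtopology (Rsp I) U) euclideanreal g"
    by (rule continuous_map_eq[OF Ck_imp_continuous[OF Suc.prems(2)]]) (simp add: Suc.prems(1))
  ultimately show ?case by simp
qed

lemma smooth_fun_cong:
  assumes "finite I" "openin (Rsp I) U" "smooth_fun I U f" "\<And>x. x \<in> U \<Longrightarrow> f x = g x"
  shows "smooth_fun I U g"
  using assms Ck_cong[OF assms(1,2)] unfolding smooth_fun_iff_Ck by blast

lemma smooth_fun_subset: "smooth_fun I U f \<Longrightarrow> W \<subseteq> U \<Longrightarrow> smooth_fun I W f"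
  unfolding smooth_fun_alt using continuous_map_from_subtopology_mono by blast

text \<open>The functions \<open>pds is f\<close> do not mention the domain, so the pieces agree
  automatically. Differentiability is a pointwise condition, and only continuity has to be
  glued.\<close>

lemma smooth_fun_local:
  assumes "openin (Rsp I) U"
    and loc: "\<And>x. x \<in> U \<Longrightarrow> \<exists>W. openin (Rsp I) W \<and> x \<in> W \<and> W \<subseteq> U \<and> smooth_fun I W f"
  shows "smooth_fun I U f"
  unfolding smooth_fun_alt
proof (intro allI impI conjI ballI)
  fix "is" assume "is": "set is \<subseteq> I"
  have top: "topspace (subtopology (Rsp I) U) = U"
    using assms(1) openin_subset by fastforce
  define \<W> where "\<W> = {W. openin (Rsp I) W \<and> W \<subseteq> U \<and> smooth_fun I W f}"
  show "continuous_map (subtopology (Rsp I) U) euclideanreal (pds is f)"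
  proof (rule pasting_lemma[where I=\<W> and T="\<lambda>W. W" and f="\<lambda>_. pds is f"])
    fix W assume W: "W \<in> \<W>"
    then show "openin (subtopology (Rsp I) U) W"
      using assms(1) by (auto simp: \<W>_def openin_open_subtopology)
    have "continuous_map (subtopology (Rsp I) W) euclideanreal (pds is f)"
      using W "is" by (auto simp: \<W>_def smooth_fun_alt)
    then show "continuous_map (subtopology (subtopology (Rsp I) U) W) euclideanreal (pds is f)"
      using W by (auto simp: \<W>_def subtopology_subtopology Int_absorb1)
  next
    fix x assume "x \<in> topspace (subtopology (Rsp I) U)"
    then show "\<exists>W. W \<in> \<W> \<and> x \<in> W \<and> pds is f x = pds is f x"
      using loc[of x] top by (auto simp: \<W>_def)
  qed auto
  fix i x assume "i \<in> I" "x \<in> U"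
  then show "pdiff i (pds is f) x"
    using loc[of x] "is" unfolding smooth_fun_alt by blast
qed

section \<open>Closure of C^n functions under sums, products and composition\<close>

lemma Ck_const:
  fixes I :: "'i set"
  shows "Ck n I U (\<lambda>_. c)"
proof (induction n arbitrary: c)
  case (Suc n)
  have "pd i (\<lambda>_. c) = (\<lambda>_. 0)" for i :: 'i by (simp add: pd_def fun_eq_iff)
  moreover have "pdiff i (\<lambda>_. c) x" for i :: 'i and x by (simp add: pdiff_def)
  ultimately show ?case using Suc by simp
qed simp

lemma Ck_coord: "i \<in> I \<Longrightarrow> Ck n I U (\<lambda>x. x i)"
proof -
  assume i: "i \<in> I"
  have c: "continuous_map (subtopology (Rsp I) U) euclideanreal (\<lambda>x. x i)"
    unfolding Rsp_def using i
    by (intro continuous_map_from_subtopology continuous_map_product_projection)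
  show ?thesis
  proof (cases n)
    case (Suc m)
    have "pd j (\<lambda>x. x i) = (\<lambda>_. if j = i then 1 else 0)" for j
      by (simp add: pd_def fun_eq_iff)
    moreover have "pdiff j (\<lambda>x. x i) x" for x :: "'a \<Rightarrow> real" and j
      by (cases "j = i") (simp_all add: pdiff_def)
    ultimately show ?thesis using c Suc by (simp add: Ck_const)
  qed (use c in simp)
qed

lemma smooth_fun_coord: "i \<in> I \<Longrightarrow> smooth_fun I U (\<lambda>x. x i)"
  by (simp add: smooth_fun_iff_Ck Ck_coord)

lemma pdiff_add: "pdiff i f x \<Longrightarrow> pdiff i g x \<Longrightarrow> pdiff i (\<lambda>x. f x + g x) x"
  unfolding pdiff_def by (rule field_differentiable_add)

lemma pdiff_mult: "pdiff i f x \<Longrightarrow> pdiff i g x \<Longrightarrow> pdiff i (\<lambda>x. f x * g x) x"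
  unfolding pdiff_def by (rule field_differentiable_mult)

lemma Ck_add:
  assumes "finite I" "openin (Rsp I) U"
  shows "Ck n I U f \<Longrightarrow> Ck n I U g \<Longrightarrow> Ck n I U (\<lambda>x. f x + g x)"
proof (induction n arbitrary: f g)
  case 0
  then show ?case by (simp add: continuous_map_add)
next
  case (Suc n)
  have d: "pdiff i f x"
    "pdiff i g x" if "x \<in> U" "i \<in> I" for x i
    using Suc.prems that by auto
  have "Ck n I U (pd i (\<lambda>x. f x + g x))" if "i \<in> I" for i
  proof (rule Ck_cong[OF assms, of "\<lambda>x. pd i f x + pd i g x"])
    show "pd i f x + pd i g x = pd i (\<lambda>x. f x + g x) x" if "x \<in> U" for x
      using d[OF that \<open>i \<in> I\<close>] by (simp add: pd_def pdiff_def)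
    show "Ck n I U (\<lambda>x. pd i f x + pd i g x)"
      using Suc that by auto
  qed
  then show ?case using Suc.prems by (auto intro!: continuous_map_add pdiff_add)
qed

text \<open>The product rule leaves one factor of each term undifferentiated. That factor is lowered
  by one order, so that both factors match the induction hypothesis.\<close>

lemma Ck_mult:
  assumes "finite I" "openin (Rsp I) U"
  shows "Ck n I U f \<Longrightarrow> Ck n I U g \<Longrightarrow> Ck n I U (\<lambda>x. f x * g x)"
proof (induction n arbitrary: f g)
  case 0
  then show ?case by (simp add: continuous_map_real_mult)
next
  case (Suc n)
  have d: "pdiff i f x"
    "pdiff i g x" if "x \<in> U" "i \<in> I" for x i
    using Suc.prems that by auto
  have "Ck n I U (pd i (\<lambda>x. f x * g x))" if "i \<in> I" for i
  proof (rule Ck_cong[OF assms, of "\<lambda>x. f x * pd i g x + pd i f x * g x"])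
    show "f x * pd i g x + pd i f x * g x = pd i (\<lambda>x. f x * g x) x" if "x \<in> U" for x
      using d[OF that \<open>i \<in> I\<close>] by (simp add: pd_def pdiff_def)
    show "Ck n I U (\<lambda>x. f x * pd i g x + pd i f x * g x)"
      using Suc.prems that Ck_SucD[OF Suc.prems(1)] Ck_SucD[OF Suc.prems(2)]
      by (intro Ck_add assms Suc.IH) auto
  qed
  then show ?case
    using Suc.prems by (auto intro!: continuous_map_real_mult pdiff_mult)
qed

lemma Ck_sum:
  assumes "finite I" "openin (Rsp I) U" and J: "finite J" "\<And>j. j \<in> J \<Longrightarrow> Ck n I U (f j)"
  shows "Ck n I U (\<lambda>x. \<Sum>j\<in>J. f j x)"
  using J by (induction J rule: finite_induct) (auto simp: Ck_const intro!: Ck_add assms(1,2))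

lemma has_pd_compose:
  assumes I: "finite I" "openin (Rsp I) U" and J: "finite J" "openin (Rsp J) V"
    and G: "\<And>x. x \<in> U \<Longrightarrow> G x \<in> V" "\<And>j. j \<in> J \<Longrightarrow> smooth_fun I U (\<lambda>x. G x j)"
    and f: "smooth_fun J V f" and x: "x \<in> U" "i \<in> I"
  shows "((\<lambda>t. f (G (x(i := t)))) has_field_derivative
     (\<Sum>j\<in>J. pd j f (G x) * pd i (\<lambda>x. G x j) x)) (at (x i))"
proof -
  \<comment> \<open>The curve lemma wants extensional values at every parameter, but
    \<open>G\<close> is controlled only on \<open>U\<close>. Restricting to \<open>J\<close> repairs
    this and changes nothing for parameters near \<open>x i\<close>.\<close>
  have ext: "restrict (G y) J = G y" if "y \<in> U" for y
    using openin_Rsp_extensional[OF J(2) G(1)[OF that]] by (simp add: extensional_restrict)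
  have "((\<lambda>t. f (restrict (G (x(i := t))) J)) has_field_derivative
     (\<Sum>j\<in>J. pd j f (restrict (G (x(i := x i))) J) * pd i (\<lambda>x. G x j) x)) (at (x i))"
  proof (rule has_field_derivative_along_curve[OF J])
    show "((\<lambda>t. restrict (G (x(i := t))) J j) has_field_derivative pd i (\<lambda>x. G x j) x) (at (x i))"
      if "j \<in> J" for j
      using has_pd[of i "\<lambda>x. G x j" x] smooth_fun_differentiable[OF G(2)[OF that] x(2,1)] that by simp
    show "continuous_map (subtopology (Rsp J) V) euclideanreal (pd j f)" if "j \<in> J" for j
      by (rule smooth_fun_imp_continuous[OF smooth_fun_pd[OF f that]])
    show "pdiff j f y" if "j \<in> J" "y \<in> V" for j y
      by (rule smooth_fun_differentiable[OF f that])
    show "restrict (G (x(i := x i))) J \<in> V"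
      using ext[OF x(1)] G(1)[OF x(1)] by simp
  qed (rule restrict_extensional)
  then show ?thesis
    by (subst (asm) DERIV_cong_ev[OF refl _ refl])
       (auto simp: ext x intro: eventually_mono[OF eventually_fun_upd_mem[OF I x]])
qed

text \<open>Each term of the chain rule is a partial derivative of \<open>f\<close> after
  \<open>G\<close>, times a partial derivative of a coordinate of \<open>G\<close>. The first is
  again a smooth function after \<open>G\<close>, so the induction runs over \<open>f\<close> with
  \<open>G\<close> fixed.\<close>

lemma Ck_compose:
  assumes I: "finite I" "openin (Rsp I) U" and J: "finite J" "openin (Rsp J) V"
    and G: "\<And>x. x \<in> U \<Longrightarrow> G x \<in> V" "\<And>j. j \<in> J \<Longrightarrow> smooth_fun I U (\<lambda>x. G x j)"
  shows "smooth_fun J V f \<Longrightarrow> Ck n I U (\<lambda>x. f (G x))"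
proof (induction n arbitrary: f)
  have topU: "topspace (subtopology (Rsp I) U) = U"
    using I(2) openin_subset by fastforce
  have cG: "continuous_map (subtopology (Rsp I) U) (subtopology (Rsp J) V) G"
    unfolding continuous_map_in_subtopology Rsp_def continuous_map_componentwise
    using G(1) openin_Rsp_extensional[OF J(2) G(1)] smooth_fun_imp_continuous[OF G(2)] topU
    by (auto simp: Rsp_def)
  have cont: "continuous_map (subtopology (Rsp I) U) euclideanreal (\<lambda>x. f (G x))"
    if "smooth_fun J V f" for f
    using continuous_map_compose[OF cG smooth_fun_imp_continuous[OF that]] by (simp add: o_def)
  {
    case 0 then show ?case by (simp add: cont)
  next
    case (Suc n)
    have hp: "((\<lambda>t. f (G (x(i := t)))) has_field_derivative
        (\<Sum>j\<in>J. pd j f (G x) * pd i (\<lambda>x. G x j) x)) (at (x i))" if "x \<in> U" "i \<in> I" for x i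
      by (rule has_pd_compose[OF I J G Suc.prems that])
    have "Ck n I U (pd i (\<lambda>x. f (G x)))" if "i \<in> I" for i
    proof (rule Ck_cong[OF I, of "\<lambda>x. \<Sum>j\<in>J. pd j f (G x) * pd i (\<lambda>x. G x j) x"])
      show "(\<Sum>j\<in>J. pd j f (G x) * pd i (\<lambda>x. G x j) x) = pd i (\<lambda>x. f (G x)) x" if "x \<in> U" for x
        using hp[OF that \<open>i \<in> I\<close>] by (simp add: pd_def DERIV_imp_deriv)
      show "Ck n I U (\<lambda>x. \<Sum>j\<in>J. pd j f (G x) * pd i (\<lambda>x. G x j) x)"
      proof (intro Ck_sum Ck_mult I J)
        show "Ck n I U (\<lambda>x. pd j f (G x))" if "j \<in> J" for j
          by (rule Suc.IH[OF smooth_fun_pd[OF Suc.prems that]])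
        show "Ck n I U (pd i (\<lambda>x. G x j))" if "j \<in> J" for j
          using smooth_fun_pd[OF G(2)[OF that] \<open>i \<in> I\<close>] by (simp add: smooth_fun_iff_Ck)
      qed
    qed
    then show ?case
      using cont[OF Suc.prems] hp by (auto simp: pdiff_def field_differentiable_def)
  }
qed

lemma smooth_fun_compose:
  assumes "finite I" "openin (Rsp I) U" "finite J" "openin (Rsp J) V"
    and "\<And>x. x \<in> U \<Longrightarrow> G x \<in> V" "\<And>j. j \<in> J \<Longrightarrow> smooth_fun I U (\<lambda>x. G x j)"
    and "smooth_fun J V f"
  shows "smooth_fun I U (\<lambda>x. f (G x))"
  using Ck_compose[OF assms] unfolding smooth_fun_iff_Ck by blast

section \<open>Smooth maps between manifolds\<close>

text \<open>Composing smooth maps requires no compatibility between the charts of the spaces involved, so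
  that products of manifolds can serve as sources without a study of their coordinate changes.\<close>

definition charted :: "('p, 'k, 'i) manifold \<Rightarrow> bool" where
  "charted M \<longleftrightarrow> finite (mindex M) \<and> points M = (\<Union>k\<in>charts M. cdom M k) \<and>
     (\<forall>k\<in>charts M.
        openin (mtop M) (cdom M k) \<and>
        openin (Rsp (mindex M)) (cmap M k ` cdom M k) \<and>
        homeomorphic_map (subtopology (mtop M) (cdom M k))
          (subtopology (Rsp (mindex M)) (cmap M k ` cdom M k)) (cmap M k))"

section \<open>Charts and their inverses\<close>

lemma is_manifold_imp_charted: "is_manifold M \<Longrightarrow> charted M"
  unfolding is_manifold_def charted_def by blast

lemma charted_finite: "charted M \<Longrightarrow> finite (mindex M)"
  unfolding charted_def by blast

lemma charted_points: "charted M \<Longrightarrow> points M = (\<Union>k\<in>charts M. cdom M k)"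
  unfolding charted_def by blast

lemma charted_cdom_subset: "charted M \<Longrightarrow> k \<in> charts M \<Longrightarrow> cdom M k \<subseteq> points M"
  unfolding charted_def by blast

lemma charted_open: "charted M \<Longrightarrow> k \<in> charts M \<Longrightarrow> openin (mtop M) (cdom M k)"
  unfolding charted_def by blast

lemma charted_open_image: "charted M \<Longrightarrow> k \<in> charts M \<Longrightarrow> openin (Rsp (mindex M)) (cmap M k ` cdom M k)"
  unfolding charted_def by blast

lemma charted_homeo:
  "charted M \<Longrightarrow> k \<in> charts M \<Longrightarrow> homeomorphic_map (subtopology (mtop M) (cdom M k))
     (subtopology (Rsp (mindex M)) (cmap M k ` cdom M k)) (cmap M k)"
  unfolding charted_def by blast

lemma topspace_subtopology_open: "openin X U \<Longrightarrow> topspace (subtopology X U) = U"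
  by (simp add: Int_absorb1 openin_subset)

lemma charted_inj: "charted M \<Longrightarrow> k \<in> charts M \<Longrightarrow> inj_on (cmap M k) (cdom M k)"
  by (metis homeomorphic_imp_injective_map charted_homeo topspace_subtopology_open charted_open)

lemma cinv_cmap: "charted M \<Longrightarrow> k \<in> charts M \<Longrightarrow> m \<in> cdom M k \<Longrightarrow> cinv M k (cmap M k m) = m"
  unfolding cinv_def by (simp add: charted_inj)

lemma cinv_in: "x \<in> cmap M k ` cdom M k \<Longrightarrow> cinv M k x \<in> cdom M k"
  unfolding cinv_def by (rule inv_into_into)

lemma cmap_cinv: "x \<in> cmap M k ` cdom M k \<Longrightarrow> cmap M k (cinv M k x) = x"
  unfolding cinv_def by (rule f_inv_into_f)

lemma cmap_in_Rsp: "charted M \<Longrightarrow> k \<in> charts M \<Longrightarrow> m \<in> cdom M k \<Longrightarrow> cmap M k m \<in> extensional (mindex M)"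
  by (rule openin_Rsp_extensional[OF charted_open_image, of M k]) simp_all

lemma continuous_cmap:
  "charted M \<Longrightarrow> k \<in> charts M \<Longrightarrow>
     continuous_map (subtopology (mtop M) (cdom M k)) (Rsp (mindex M)) (cmap M k)"
  by (metis homeomorphic_imp_continuous_map charted_homeo continuous_map_in_subtopology)

lemma cmap_image_open:
  assumes "charted M" "k \<in> charts M" "openin (mtop M) W"
  shows "openin (Rsp (mindex M)) (cmap M k ` (cdom M k \<inter> W))"
proof -
  have "openin (subtopology (mtop M) (cdom M k)) (cdom M k \<inter> W)"
    using assms(3) by (simp add: openin_subtopology_Int2)
  then have "openin (subtopology (Rsp (mindex M)) (cmap M k ` cdom M k)) (cmap M k ` (cdom M k \<inter> W))"
    using charted_homeo[OF assms(1,2)] homeomorphic_imp_open_map open_map_def by blast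
  then show ?thesis
    using charted_open_image[OF assms(1,2)] openin_trans_full by blast
qed

lemma continuous_cinv:
  assumes "charted M" "k \<in> charts M"
  shows "continuous_map (subtopology (Rsp (mindex M)) (cmap M k ` cdom M k)) (mtop M) (cinv M k)"
proof -
  obtain g where g: "homeomorphic_maps (subtopology (mtop M) (cdom M k))
     (subtopology (Rsp (mindex M)) (cmap M k ` cdom M k)) (cmap M k) g"
    using charted_homeo[OF assms] homeomorphic_map_maps by blast
  have "continuous_map (subtopology (Rsp (mindex M)) (cmap M k ` cdom M k)) (mtop M) g"
    using g continuous_map_in_subtopology unfolding homeomorphic_maps_def by blast
  moreover have "g x = cinv M k x" if "x \<in> topspace (subtopology (Rsp (mindex M)) (cmap M k ` cdom M k))" for x
  proof -
    have "x \<in> cmap M k ` cdom M k" using that by simp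
    then obtain m where "m \<in> cdom M k" "x = cmap M k m" by blast
    then show ?thesis
      using g assms charted_cdom_subset[OF assms] unfolding homeomorphic_maps_def
      by (auto simp: cinv_cmap)
  qed
  ultimately show ?thesis by (rule continuous_map_eq)
qed

text \<open>Made for product charts, where an inverse \<open>d\<close> can be written down. The last
  conclusion identifies \<open>d\<close> with the \<open>inv_into\<close> that \<open>cinv\<close>
  is defined by.\<close>

lemma homeomorphic_map_intro:
  assumes "openin X A" "openin Y B"
    and "continuous_map (subtopology X A) Y c" "\<And>m. m \<in> A \<Longrightarrow> c m \<in> B \<and> d (c m) = m"
    and "continuous_map (subtopology Y B) X d" "\<And>x. x \<in> B \<Longrightarrow> d x \<in> A \<and> c (d x) = x"
  shows "c ` A = B" "homeomorphic_map (subtopology X A) (subtopology Y (c ` A)) c"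
    "\<And>x. x \<in> B \<Longrightarrow> inv_into A c x = d x"
proof -
  show im: "c ` A = B" using assms(4,6) by (force simp: image_iff)
  have "homeomorphic_maps (subtopology X A) (subtopology Y B) c d"
    unfolding homeomorphic_maps_def continuous_map_in_subtopology
    using assms by (auto simp: topspace_subtopology_open)
  then show "homeomorphic_map (subtopology X A) (subtopology Y (c ` A)) c"
    unfolding im homeomorphic_map_maps by blast
  have "inj_on c A" using assms(4) by (intro inj_on_inverseI[of _ d]) auto
  then show "inv_into A c x = d x" if "x \<in> B" for x
    using assms(6)[OF that] by (metis inv_into_f_f)
qed

text \<open>Smoothness of a real function in the charts of the source, so that target charts are
  dealt with one coordinate at a time. Only the part of \<open>W\<close> inside chart domains
  counts; hence preimages may be written as plain comprehensions that extend beyond the points of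
  \<open>M\<close>.\<close>

definition smooth_on :: "('p, 'k, 'i) manifold \<Rightarrow> 'p set \<Rightarrow> ('p \<Rightarrow> real) \<Rightarrow> bool" where
  "smooth_on M W h \<longleftrightarrow>
     (\<forall>k\<in>charts M. smooth_fun (mindex M) (cmap M k ` (cdom M k \<inter> W)) (\<lambda>x. h (cinv M k x)))"

section \<open>Smooth real functions and composition of smooth maps\<close>

lemma smooth_map_iff:
  "smooth_map M N F \<longleftrightarrow> continuous_map (mtop M) (mtop N) F \<and>
     (\<forall>l\<in>charts N. \<forall>j\<in>mindex N. smooth_on M {m. F m \<in> cdom N l} (\<lambda>m. cmap N l (F m) j))"
proof -
  have "{m \<in> A. F m \<in> B} = A \<inter> {m. F m \<in> B}" for A B by blast
  then show ?thesis unfolding smooth_map_def smooth_on_def by auto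
qed

lemma smooth_map_continuous: "smooth_map M N F \<Longrightarrow> continuous_map (mtop M) (mtop N) F"
  by (simp add: smooth_map_iff)

lemma smooth_on_subset: "smooth_on M W h \<Longrightarrow> W' \<inter> (\<Union>k\<in>charts M. cdom M k) \<subseteq> W \<Longrightarrow> smooth_on M W' h"
  unfolding smooth_on_def
  by (intro ballI, rule smooth_fun_subset[of _ "cmap M k ` (cdom M k \<inter> W)" for k]) blast+

lemma smooth_on_cong:
  assumes "charted M" "openin (mtop M) W" "smooth_on M W h" "\<And>m. m \<in> W \<Longrightarrow> h m = h' m"
  shows "smooth_on M W h'"
  unfolding smooth_on_def
proof
  fix k assume k: "k \<in> charts M"
  show "smooth_fun (mindex M) (cmap M k ` (cdom M k \<inter> W)) (\<lambda>x. h' (cinv M k x))"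
  proof (rule smooth_fun_cong[OF charted_finite[OF assms(1)] cmap_image_open[OF assms(1) k assms(2)]])
    show "smooth_fun (mindex M) (cmap M k ` (cdom M k \<inter> W)) (\<lambda>x. h (cinv M k x))"
      using assms(3) k unfolding smooth_on_def by blast
    show "h (cinv M k x) = h' (cinv M k x)" if "x \<in> cmap M k ` (cdom M k \<inter> W)" for x
      using that assms(1,4) k by (auto simp: cinv_cmap)
  qed
qed

text \<open>On a chart domain \<open>h\<close> is its coordinate expression after the chart, and the
  chart domains form an open cover. Needed for the tangent bundle, where continuity has to be
  derived from the coordinates of the vectors.\<close>

lemma smooth_on_continuous:
  assumes M: "charted M" and W: "openin (mtop M) W" and h: "smooth_on M W h"
  shows "continuous_map (subtopology (mtop M) W) euclideanreal h"
proof (rule pasting_lemma[where I="charts M" and T="\<lambda>k. cdom M k \<inter> W" and f="\<lambda>_. h"])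
  fix k assume k: "k \<in> charts M"
  show "openin (subtopology (mtop M) W) (cdom M k \<inter> W)"
    using charted_open[OF M k] by (simp add: openin_subtopology_Int)
  let ?B = "cmap M k ` (cdom M k \<inter> W)"
  have eq: "subtopology (subtopology (mtop M) W) (cdom M k \<inter> W) = subtopology (mtop M) (cdom M k \<inter> W)"
    by (simp add: subtopology_subtopology Int_left_commute Int_commute)
  have "continuous_map (subtopology (mtop M) (cdom M k \<inter> W)) (subtopology (Rsp (mindex M)) ?B) (cmap M k)"
    unfolding continuous_map_in_subtopology
    using continuous_map_from_subtopology_mono[OF continuous_cmap[OF M k], of "cdom M k \<inter> W"] by auto
  moreover have "continuous_map (subtopology (Rsp (mindex M)) ?B) euclideanreal (\<lambda>x. h (cinv M k x))"
    using h k smooth_fun_imp_continuous unfolding smooth_on_def by blast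
  ultimately have "continuous_map (subtopology (mtop M) (cdom M k \<inter> W)) euclideanreal
      ((\<lambda>x. h (cinv M k x)) \<circ> cmap M k)"
    by (rule continuous_map_compose)
  then show "continuous_map (subtopology (subtopology (mtop M) W) (cdom M k \<inter> W)) euclideanreal h"
    unfolding eq by (rule continuous_map_eq) (use M k in \<open>simp add: cinv_cmap\<close>)
next
  fix x assume "x \<in> topspace (subtopology (mtop M) W)"
  then show "\<exists>k. k \<in> charts M \<and> x \<in> cdom M k \<inter> W \<and> h x = h x"
    using charted_points[OF M] by auto
qed auto

text \<open>Around a point, take a chart \<open>p\<close> of \<open>P\<close> at its image. The
  composite factors there through \<open>cmap P p\<close>, which leaves a composition of functions
  between coordinate spaces; locality then removes the choice of \<open>p\<close>.\<close>

lemma smooth_on_compose: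
  assumes M: "charted M" and P: "charted P" and G: "smooth_map M P G"
    and W: "openin (mtop P) W" and h: "smooth_on P W h"
  shows "smooth_on M {m. G m \<in> W} (\<lambda>m. h (G m))"
  unfolding smooth_on_def
proof
  fix k assume k: "k \<in> charts M"
  let ?A = "\<lambda>W. cdom M k \<inter> {m. G m \<in> W}"
  have eq: "?A W = cdom M k \<inter> {m \<in> points M. G m \<in> W}" for W
    using charted_cdom_subset[OF M k] by blast
  have op: "openin (Rsp (mindex M)) (cmap M k ` ?A W)" if "openin (mtop P) W" for W
    unfolding eq using that
    by (intro cmap_image_open[OF M k] openin_continuous_map_preimage[OF smooth_map_continuous[OF G]])
  show "smooth_fun (mindex M) (cmap M k ` ?A W) (\<lambda>x. h (G (cinv M k x)))"
  proof (rule smooth_fun_local[OF op[OF W]])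
    fix x assume "x \<in> cmap M k ` ?A W"
    then obtain m where m: "m \<in> cdom M k" "G m \<in> W" "x = cmap M k m" by blast
    have "G m \<in> points P" using m(2) W openin_subset by blast
    then obtain p where p: "p \<in> charts P" "G m \<in> cdom P p" using charted_points[OF P] by blast
    let ?W = "cdom P p \<inter> W"
    have opW: "openin (mtop P) ?W" using charted_open[OF P p(1)] W by blast
    have "smooth_fun (mindex M) (cmap M k ` ?A ?W) (\<lambda>x. h (cinv P p (cmap P p (G (cinv M k x)))))"
    proof (rule smooth_fun_compose[where G="\<lambda>x. cmap P p (G (cinv M k x))" and f="\<lambda>y. h (cinv P p y)",
          OF charted_finite[OF M] op[OF opW] charted_finite[OF P] cmap_image_open[OF P p(1) W]])
      show "cmap P p (G (cinv M k x)) \<in> cmap P p ` ?W" if "x \<in> cmap M k ` ?A ?W" for x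
        using that M k by (auto simp: cinv_cmap)
      show "smooth_fun (mindex M) (cmap M k ` ?A ?W) (\<lambda>x. cmap P p (G (cinv M k x)) j)"
        if "j \<in> mindex P" for j
      proof (rule smooth_fun_subset)
        show "smooth_fun (mindex M) (cmap M k ` ?A (cdom P p)) (\<lambda>x. cmap P p (G (cinv M k x)) j)"
          using G k p(1) that unfolding smooth_map_iff smooth_on_def by blast
      qed blast
      show "smooth_fun (mindex P) (cmap P p ` ?W) (\<lambda>y. h (cinv P p y))"
        using h p(1) unfolding smooth_on_def by blast
    qed
    then have "smooth_fun (mindex M) (cmap M k ` ?A ?W) (\<lambda>x. h (G (cinv M k x)))"
      by (rule smooth_fun_cong[OF charted_finite[OF M] op[OF opW]])
         (use M k P p in \<open>auto simp: cinv_cmap\<close>)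
    then show "\<exists>U. openin (Rsp (mindex M)) U \<and> x \<in> U \<and> U \<subseteq> cmap M k ` ?A W \<and>
        smooth_fun (mindex M) U (\<lambda>x. h (G (cinv M k x)))"
      using m p op[OF opW] by (intro exI[of _ "cmap M k ` ?A ?W"]) auto
  qed
qed

lemma smooth_map_compose:
  assumes M: "charted M" and P: "charted P" and G: "smooth_map M P G" and F: "smooth_map P N F"
    and N: "\<And>l. l \<in> charts N \<Longrightarrow> openin (mtop N) (cdom N l)"
  shows "smooth_map M N (\<lambda>m. F (G m))"
  unfolding smooth_map_iff
proof (intro conjI ballI)
  show "continuous_map (mtop M) (mtop N) (\<lambda>m. F (G m))"
    using continuous_map_compose[OF smooth_map_continuous[OF G] smooth_map_continuous[OF F]]
    by (simp add: o_def)
  fix l j assume l: "l \<in> charts N" "j \<in> mindex N"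
  let ?W = "{p \<in> points P. F p \<in> cdom N l}"
  have "smooth_on M {m. G m \<in> ?W} (\<lambda>m. cmap N l (F (G m)) j)"
  proof (rule smooth_on_compose[OF M P G])
    show "openin (mtop P) ?W"
      using smooth_map_continuous[OF F] N[OF l(1)] by (rule openin_continuous_map_preimage)
    show "smooth_on P ?W (\<lambda>p. cmap N l (F p) j)"
      using F l unfolding smooth_map_iff by (blast intro: smooth_on_subset)
  qed
  then show "smooth_on M {m. F (G m) \<in> cdom N l} (\<lambda>m. cmap N l (F (G m)) j)"
    by (rule smooth_on_subset)
       (use continuous_map_image_subset_topspace[OF smooth_map_continuous[OF G]] charted_points[OF M] in auto)
qed

text \<open>Passes from a formula to its restriction to the points, the form in which the maps of a
  system are stored.\<close>

lemma smooth_map_cong: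
  assumes M: "charted M" and F: "smooth_map M N F"
    and N: "\<And>l. l \<in> charts N \<Longrightarrow> openin (mtop N) (cdom N l)"
    and eq: "\<And>m. m \<in> points M \<Longrightarrow> F m = F' m"
  shows "smooth_map M N F'"
  unfolding smooth_map_iff
proof (intro conjI ballI)
  show "continuous_map (mtop M) (mtop N) F'"
    using smooth_map_continuous[OF F] eq by (rule continuous_map_eq)
  fix l j assume l: "l \<in> charts N" "j \<in> mindex N"
  let ?W = "{m \<in> points M. F m \<in> cdom N l}"
  have "smooth_on M ?W (\<lambda>m. cmap N l (F m) j)"
    using F l unfolding smooth_map_iff by (blast intro: smooth_on_subset)
  then have "smooth_on M ?W (\<lambda>m. cmap N l (F' m) j)"
    by (rule smooth_on_cong[OF M openin_continuous_map_preimage[OF smooth_map_continuous[OF F] N[OF l(1)]]])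
       (simp add: eq)
  then show "smooth_on M {m. F' m \<in> cdom N l} (\<lambda>m. cmap N l (F' m) j)"
    by (rule smooth_on_subset) (use eq in \<open>auto simp flip: charted_points[OF M]\<close>)
qed

lemma smooth_on_chart:
  assumes "is_manifold M" "l \<in> charts M" "j \<in> mindex M"
  shows "smooth_on M (cdom M l) (\<lambda>m. cmap M l m j)"
  using assms unfolding is_manifold_def smooth_on_def by blast

text \<open>In the chart \<open>k\<close> belonging to \<open>p\<close>, the map merely selects the
  coordinates \<open>r\<close>. Any other chart \<open>l\<close> of \<open>M\<close> is reached by a
  chart change of \<open>M\<close>, which is smooth because \<open>M\<close> is a manifold.\<close>

lemma smooth_map_projection:
  assumes Q: "charted Q" and M: "is_manifold M" and cont: "continuous_map (mtop Q) (mtop M) \<pi>"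
    and coords: "\<And>p. p \<in> charts Q \<Longrightarrow> \<exists>k\<in>charts M. \<exists>r. r ` mindex M \<subseteq> mindex Q \<and>
      (\<forall>z\<in>cdom Q p. \<pi> z \<in> cdom M k \<and> (\<forall>i\<in>mindex M. cmap M k (\<pi> z) i = cmap Q p z (r i)))"
  shows "smooth_map Q M \<pi>"
  unfolding smooth_map_iff smooth_on_def
proof (intro conjI ballI)
  note M' = is_manifold_imp_charted[OF M]
  show "continuous_map (mtop Q) (mtop M) \<pi>" by (rule cont)
  fix l j p assume l: "l \<in> charts M" "j \<in> mindex M" and p: "p \<in> charts Q"
  obtain k r where k: "k \<in> charts M" and r: "r ` mindex M \<subseteq> mindex Q"
    and \<pi>: "\<And>z. z \<in> cdom Q p \<Longrightarrow> \<pi> z \<in> cdom M k"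
      "\<And>z i. z \<in> cdom Q p \<Longrightarrow> i \<in> mindex M \<Longrightarrow> cmap M k (\<pi> z) i = cmap Q p z (r i)"
    using coords[OF p] by blast
  let ?A = "cdom Q p \<inter> {z. \<pi> z \<in> cdom M l}"
  let ?U = "cmap Q p ` ?A" and ?r = "\<lambda>x. \<lambda>i\<in>mindex M. x (r i)"
  have "?A = cdom Q p \<inter> {z \<in> points Q. \<pi> z \<in> cdom M l}"
    using charted_cdom_subset[OF Q p] by auto
  then have opU: "openin (Rsp (mindex Q)) ?U"
    using cmap_image_open[OF Q p openin_continuous_map_preimage[OF cont charted_open[OF M' l(1)]]] by simp
  have r_cmap: "?r (cmap Q p z) = cmap M k (\<pi> z)" if "z \<in> ?A" for z
    using that \<pi> cmap_in_Rsp[OF M' k \<pi>(1)[of z]] by (auto simp: fun_eq_iff extensional_def)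
  have "smooth_fun (mindex Q) ?U (\<lambda>x. cmap M l (cinv M k (?r x)) j)"
  proof (rule smooth_fun_compose[where G="?r" and f="\<lambda>x. cmap M l (cinv M k x) j",
        OF charted_finite[OF Q] opU charted_finite[OF M']])
    show "openin (Rsp (mindex M)) (cmap M k ` (cdom M k \<inter> cdom M l))"
      by (rule cmap_image_open[OF M' k charted_open[OF M' l(1)]])
    show "smooth_fun (mindex M) (cmap M k ` (cdom M k \<inter> cdom M l)) (\<lambda>x. cmap M l (cinv M k x) j)"
      using smooth_on_chart[OF M l] k unfolding smooth_on_def by blast
    show "?r x \<in> cmap M k ` (cdom M k \<inter> cdom M l)" if x: "x \<in> ?U" for x
    proof -
      obtain z where "z \<in> ?A" "x = cmap Q p z" using x by blast
      then show ?thesis using r_cmap[of z] \<pi>(1)[of z] by blast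
    qed
    show "smooth_fun (mindex Q) ?U (\<lambda>x. ?r x i)" if "i \<in> mindex M" for i
      using that r by (simp add: smooth_fun_coord image_subset_iff)
  qed
  then show "smooth_fun (mindex Q) ?U (\<lambda>x. cmap M l (\<pi> (cinv Q p x)) j)"
  proof (rule smooth_fun_cong[OF charted_finite[OF Q] opU])
    fix x assume "x \<in> ?U"
    then obtain z where z: "z \<in> ?A" "x = cmap Q p z" by blast
    have "cinv Q p x = z"
      using z cinv_cmap[OF Q p, of z] by blast
    moreover have "?r x = cmap M k (\<pi> z)" using r_cmap z by blast
    moreover have "cinv M k (cmap M k (\<pi> z)) = \<pi> z"
      using cinv_cmap[OF M' k] z \<pi>(1) by blast
    ultimately show "cmap M l (cinv M k (?r x)) j = cmap M l (\<pi> (cinv Q p x)) j"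
      by (simp only:)
  qed
qed

subsection \<open>Binary products\<close>

lemma mprod_simps [simp]:
  "mtop (mprod M N) = prod_topology (mtop M) (mtop N)"
  "mindex (mprod M N) = mindex M <+> mindex N"
  "charts (mprod M N) = charts M \<times> charts N"
  "cdom (mprod M N) p = cdom M (fst p) \<times> cdom N (snd p)"
  "cmap (mprod M N) p z =
     (\<lambda>i\<in>mindex M <+> mindex N. case_sum (cmap M (fst p) (fst z)) (cmap N (snd p) (snd z)) i)"
  by (cases p; cases z; simp add: mprod_def)+

lemma continuous_map_Rsp_reindex:
  assumes "\<And>i. i \<in> I \<Longrightarrow> r i \<in> J"
  shows "continuous_map (Rsp J) (Rsp I) (\<lambda>x. \<lambda>i\<in>I. x (r i))"
  unfolding Rsp_def continuous_map_componentwise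
  using assms by (auto intro: continuous_map_product_projection)

text \<open>\<open>B\<close> describes the image of a product chart by its two blocks of
  coordinates. In this form it is an intersection of preimages of open sets, and the inverse chart
  is the pair of inverse charts applied to the blocks.\<close>

lemma mprod_chart:
  assumes M: "charted M" and N: "charted N" and k: "k \<in> charts M" and l: "l \<in> charts N"
  defines "B \<equiv> {x \<in> extensional (mindex M <+> mindex N). (\<lambda>i\<in>mindex M. x (Inl i)) \<in> cmap M k ` cdom M k \<and>
      (\<lambda>i\<in>mindex N. x (Inr i)) \<in> cmap N l ` cdom N l}"
  shows "openin (Rsp (mindex M <+> mindex N)) B"
    "cmap (mprod M N) (k, l) ` cdom (mprod M N) (k, l) = B"
    "homeomorphic_map (subtopology (mtop (mprod M N)) (cdom (mprod M N) (k, l)))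
       (subtopology (Rsp (mindex M <+> mindex N)) (cmap (mprod M N) (k, l) ` cdom (mprod M N) (k, l)))
       (cmap (mprod M N) (k, l))"
    "\<And>x. x \<in> B \<Longrightarrow> cinv (mprod M N) (k, l) x =
       (cinv M k (\<lambda>i\<in>mindex M. x (Inl i)), cinv N l (\<lambda>i\<in>mindex N. x (Inr i)))"
proof -
  let ?I = "mindex M <+> mindex N"
  let ?p = "\<lambda>x. \<lambda>i\<in>mindex M. x (Inl i)" and ?q = "\<lambda>x. \<lambda>i\<in>mindex N. x (Inr i)"
  let ?d = "\<lambda>x. (cinv M k (?p x), cinv N l (?q x))"
  have cp: "continuous_map (Rsp ?I) (Rsp (mindex M)) ?p"
    by (rule continuous_map_Rsp_reindex) auto
  have cq: "continuous_map (Rsp ?I) (Rsp (mindex N)) ?q"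
    by (rule continuous_map_Rsp_reindex) auto
  have "B = {x \<in> topspace (Rsp ?I). ?p x \<in> cmap M k ` cdom M k} \<inter> {x \<in> topspace (Rsp ?I). ?q x \<in> cmap N l ` cdom N l}"
    unfolding B_def by auto
  then show opB: "openin (Rsp ?I) B"
    using openin_continuous_map_preimage[OF cp charted_open_image[OF M k]]
      openin_continuous_map_preimage[OF cq charted_open_image[OF N l]] by auto
  have opA: "openin (mtop (mprod M N)) (cdom (mprod M N) (k, l))"
    using charted_open[OF M k] charted_open[OF N l] by (simp add: openin_prod_Times_iff)
  have cc: "continuous_map (subtopology (mtop (mprod M N)) (cdom (mprod M N) (k, l))) (Rsp ?I) (cmap (mprod M N) (k, l))"
    (is "continuous_map ?X _ _")
  proof -
    have fst: "continuous_map ?X (subtopology (mtop M) (cdom M k)) fst"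
      unfolding continuous_map_in_subtopology
      by (auto intro: continuous_map_from_subtopology continuous_map_fst)
    have snd: "continuous_map ?X (subtopology (mtop N) (cdom N l)) snd"
      unfolding continuous_map_in_subtopology
      by (auto intro: continuous_map_from_subtopology continuous_map_snd)
    have "continuous_map ?X euclideanreal (\<lambda>z. cmap M k (fst z) i)" if "i \<in> mindex M" for i
      using continuous_map_compose[OF continuous_map_compose[OF fst continuous_cmap[OF M k]]
          continuous_map_product_projection[OF that, of "\<lambda>_. euclideanreal", folded Rsp_def]]
      by (simp add: o_def)
    moreover have "continuous_map ?X euclideanreal (\<lambda>z. cmap N l (snd z) i)" if "i \<in> mindex N" for i
      using continuous_map_compose[OF continuous_map_compose[OF snd continuous_cmap[OF N l]]
          continuous_map_product_projection[OF that, of "\<lambda>_. euclideanreal", folded Rsp_def]]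
      by (simp add: o_def)
    ultimately have "continuous_map ?X euclideanreal (\<lambda>z. cmap (mprod M N) (k, l) z i)" if "i \<in> ?I" for i
      using that by (cases i) auto
    moreover have "cmap (mprod M N) (k, l) ` topspace ?X \<subseteq> extensional ?I" by auto
    ultimately show ?thesis
      unfolding Rsp_def continuous_map_componentwise by blast
  qed
  have cd: "continuous_map (subtopology (Rsp ?I) B) (mtop (mprod M N)) ?d"
  proof -
    have "continuous_map (subtopology (Rsp ?I) B) (subtopology (Rsp (mindex M)) (cmap M k ` cdom M k)) ?p"
      unfolding continuous_map_in_subtopology using cp
      by (auto intro: continuous_map_from_subtopology simp: B_def)
    moreover have "continuous_map (subtopology (Rsp ?I) B) (subtopology (Rsp (mindex N)) (cmap N l ` cdom N l)) ?q"
      unfolding continuous_map_in_subtopology using cq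
      by (auto intro: continuous_map_from_subtopology simp: B_def)
    ultimately have "continuous_map (subtopology (Rsp ?I) B) (mtop M) (cinv M k \<circ> ?p)"
      "continuous_map (subtopology (Rsp ?I) B) (mtop N) (cinv N l \<circ> ?q)"
      using continuous_map_compose continuous_cinv[OF M k] continuous_cinv[OF N l] by blast+
    then show ?thesis by (simp add: continuous_map_pairwise o_def)
  qed
  have A: "cmap (mprod M N) (k, l) z \<in> B \<and> ?d (cmap (mprod M N) (k, l) z) = z"
    if z: "z \<in> cdom (mprod M N) (k, l)" for z
  proof -
    have "?p (cmap (mprod M N) (k, l) z) = restrict (cmap M k (fst z)) (mindex M)"
      "?q (cmap (mprod M N) (k, l) z) = restrict (cmap N l (snd z)) (mindex N)"
      by (rule restrict_ext, auto)+
    moreover have "restrict (cmap M k (fst z)) (mindex M) = cmap M k (fst z)"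
      "restrict (cmap N l (snd z)) (mindex N) = cmap N l (snd z)"
      using z cmap_in_Rsp[OF M k, of "fst z"] cmap_in_Rsp[OF N l, of "snd z"]
      by (simp_all add: extensional_restrict mem_Times_iff)
    moreover have "cmap (mprod M N) (k, l) z \<in> extensional ?I" by simp
    ultimately show ?thesis
      using z M N k l unfolding B_def by (auto simp: cinv_cmap simp del: mprod_simps(5))
  qed
  have B: "?d x \<in> cdom (mprod M N) (k, l) \<and> cmap (mprod M N) (k, l) (?d x) = x" if x: "x \<in> B" for x
  proof -
    have pq: "?p x \<in> cmap M k ` cdom M k" "?q x \<in> cmap N l ` cdom N l" "x \<in> extensional ?I"
      using x by (auto simp: B_def)
    have "cmap (mprod M N) (k, l) (?d x) = x"
    proof
      fix i show "cmap (mprod M N) (k, l) (?d x) i = x i"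
        using cmap_cinv[OF pq(1)] cmap_cinv[OF pq(2)] extensional_arb[OF pq(3), of i]
        by (cases i; cases "i \<in> ?I") auto
    qed
    then show ?thesis using cinv_in[OF pq(1)] cinv_in[OF pq(2)] by simp
  qed
  note intro = homeomorphic_map_intro[OF opA opB cc A cd B]
  show "cmap (mprod M N) (k, l) ` cdom (mprod M N) (k, l) = B"
    "homeomorphic_map (subtopology (mtop (mprod M N)) (cdom (mprod M N) (k, l)))
       (subtopology (Rsp (mindex M <+> mindex N)) (cmap (mprod M N) (k, l) ` cdom (mprod M N) (k, l)))
       (cmap (mprod M N) (k, l))"
    by (rule intro; assumption)+
  show "cinv (mprod M N) (k, l) x = ?d x" if "x \<in> B" for x
    unfolding cinv_def[of "mprod M N"] by (rule intro(3)) (use that in auto)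
qed

lemma charted_mprod:
  assumes M: "charted M" and N: "charted N"
  shows "charted (mprod M N)"
  unfolding charted_def
proof (intro conjI ballI)
  show "finite (mindex (mprod M N))" using charted_finite[OF M] charted_finite[OF N] by simp
  show "points (mprod M N) = (\<Union>k\<in>charts (mprod M N). cdom (mprod M N) k)"
    using charted_points[OF M] charted_points[OF N] by fastforce
  fix p assume "p \<in> charts (mprod M N)"
  then obtain k l where p: "p = (k, l)" "k \<in> charts M" "l \<in> charts N" by auto
  show "openin (mtop (mprod M N)) (cdom (mprod M N) p)"
    using charted_open[OF M p(2)] charted_open[OF N p(3)] p(1) by (simp add: openin_prod_Times_iff)
  show "openin (Rsp (mindex (mprod M N))) (cmap (mprod M N) p ` cdom (mprod M N) p)"
    "homeomorphic_map (subtopology (mtop (mprod M N)) (cdom (mprod M N) p))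
       (subtopology (Rsp (mindex (mprod M N))) (cmap (mprod M N) p ` cdom (mprod M N) p)) (cmap (mprod M N) p)"
    using mprod_chart[OF M N p(2,3)] unfolding p(1) mprod_simps(2) by (simp_all only:)
qed

lemma smooth_map_mprodI:
  assumes F: "smooth_map M N (\<lambda>m. fst (F m))" and F': "smooth_map M N' (\<lambda>m. snd (F m))"
  shows "smooth_map M (mprod N N') F"
  unfolding smooth_map_iff
proof (intro conjI ballI)
  show "continuous_map (mtop M) (mtop (mprod N N')) F"
    using smooth_map_continuous[OF F] smooth_map_continuous[OF F'] by (simp add: continuous_map_pairwise o_def)
  fix p i assume "p \<in> charts (mprod N N')" "i \<in> mindex (mprod N N')"
  then have p: "fst p \<in> charts N" "snd p \<in> charts N'" and i: "i \<in> mindex N <+> mindex N'" by auto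
  have W: "{m. F m \<in> cdom (mprod N N') p} = {m. fst (F m) \<in> cdom N (fst p)} \<inter> {m. snd (F m) \<in> cdom N' (snd p)}"
    by (auto simp: mem_Times_iff)
  show "smooth_on M {m. F m \<in> cdom (mprod N N') p} (\<lambda>m. cmap (mprod N N') p (F m) i)"
  proof (cases i)
    case (Inl a)
    then have "smooth_on M {m. fst (F m) \<in> cdom N (fst p)} (\<lambda>m. cmap (mprod N N') p (F m) i)"
      using F i p unfolding smooth_map_iff by auto
    then show ?thesis unfolding W by (rule smooth_on_subset) blast
  next
    case (Inr a)
    then have "smooth_on M {m. snd (F m) \<in> cdom N' (snd p)} (\<lambda>m. cmap (mprod N N') p (F m) i)"
      using F' i p unfolding smooth_map_iff by auto
    then show ?thesis unfolding W by (rule smooth_on_subset) blast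
  qed
qed

lemma smooth_map_fst:
  assumes M: "is_manifold M" and N: "charted N"
  shows "smooth_map (mprod M N) M fst"
proof (rule smooth_map_projection[OF charted_mprod[OF is_manifold_imp_charted[OF M] N] M])
  show "continuous_map (mtop (mprod M N)) (mtop M) fst" by (simp add: continuous_map_fst)
  fix p assume "p \<in> charts (mprod M N)"
  then show "\<exists>k\<in>charts M. \<exists>r. r ` mindex M \<subseteq> mindex (mprod M N) \<and> (\<forall>z\<in>cdom (mprod M N) p.
      fst z \<in> cdom M k \<and> (\<forall>i\<in>mindex M. cmap M k (fst z) i = cmap (mprod M N) p z (r i)))"
    by (intro bexI[of _ "fst p"] exI[of _ Inl]) auto
qed

lemma smooth_map_snd:
  assumes M: "charted M" and N: "is_manifold N"
  shows "smooth_map (mprod M N) N snd"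
proof (rule smooth_map_projection[OF charted_mprod[OF M is_manifold_imp_charted[OF N]] N])
  show "continuous_map (mtop (mprod M N)) (mtop N) snd" by (simp add: continuous_map_snd)
  fix p assume "p \<in> charts (mprod M N)"
  then show "\<exists>k\<in>charts N. \<exists>r. r ` mindex N \<subseteq> mindex (mprod M N) \<and> (\<forall>z\<in>cdom (mprod M N) p.
      snd z \<in> cdom N k \<and> (\<forall>i\<in>mindex N. cmap N k (snd z) i = cmap (mprod M N) p z (r i)))"
    by (intro bexI[of _ "snd p"] exI[of _ Inr]) auto
qed

subsection \<open>Dependent products\<close>

text \<open>Boxes whose sides come from countable bases of the factors form a base. With finitely
  many factors there are countably many such boxes.\<close>

lemma second_countable_product_topology:
  assumes I: "finite I" and X: "\<And>i. i \<in> I \<Longrightarrow> second_countable (X i)"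
  shows "second_countable (product_topology X I)"
proof -
  have "\<forall>i\<in>I. \<exists>B. countable B \<and> (\<forall>V\<in>B. openin (X i) V) \<and>
      (\<forall>U x. openin (X i) U \<and> x \<in> U \<longrightarrow> (\<exists>V\<in>B. x \<in> V \<and> V \<subseteq> U))"
    using X unfolding second_countable_def by blast
  then obtain B where B: "\<And>i. i \<in> I \<Longrightarrow> countable (B i)" "\<And>i V. i \<in> I \<Longrightarrow> V \<in> B i \<Longrightarrow> openin (X i) V"
    "\<And>i U x. i \<in> I \<Longrightarrow> openin (X i) U \<Longrightarrow> x \<in> U \<Longrightarrow> \<exists>V\<in>B i. x \<in> V \<and> V \<subseteq> U"
    using bchoice[of I] by metis
  let ?B = "Pi\<^sub>E I ` Pi\<^sub>E I B"
  have "countable ?B" using countable_PiE[OF I B(1)] by simp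
  moreover have "openin (product_topology X I) V" if "V \<in> ?B" for V
    using that I B(2) PiE_mem[of _ I B] by (auto simp: openin_PiE_gen)
  moreover have "\<exists>V\<in>?B. x \<in> V \<and> V \<subseteq> U" if U: "openin (product_topology X I) U" "x \<in> U" for U x
  proof -
    obtain V where V: "\<forall>i\<in>I. openin (X i) (V i)" "x \<in> Pi\<^sub>E I V" "Pi\<^sub>E I V \<subseteq> U"
      using bspec[OF U(1)[unfolded openin_product_topology_alt] U(2)] by iprover
    have "\<forall>i\<in>I. \<exists>W\<in>B i. x i \<in> W \<and> W \<subseteq> V i"
    proof
      fix i assume i: "i \<in> I"
      show "\<exists>W\<in>B i. x i \<in> W \<and> W \<subseteq> V i"
        using i V(1) PiE_mem[OF V(2) i] by (intro B(3)) auto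
    qed
    then obtain W where W: "\<And>i. i \<in> I \<Longrightarrow> W i \<in> B i \<and> x i \<in> W i \<and> W i \<subseteq> V i"
      using bchoice[of I] by metis
    have "Pi\<^sub>E I (restrict W I) \<in> ?B" using W by auto
    moreover have "x \<in> Pi\<^sub>E I (restrict W I)" using W V(2) by (auto simp: PiE_iff)
    moreover have "Pi\<^sub>E I (restrict W I) \<subseteq> Pi\<^sub>E I V" by (rule PiE_mono) (simp add: W)
    then have "Pi\<^sub>E I (restrict W I) \<subseteq> U" using V(3) by (rule subset_trans)
    ultimately show ?thesis by (intro bexI[of _ "Pi\<^sub>E I (restrict W I)"] conjI)
  qed
  ultimately show ?thesis
    unfolding second_countable_def by (intro exI[of _ ?B] conjI ballI allI impI; (elim conjE)?; simp only:)
qed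

lemma dprod_simps [simp]:
  "mtop (dprod S) = product_topology (\<lambda>a. mtop (snd S a)) (fst S)"
  "mindex (dprod S) = (SIGMA a:fst S. mindex (snd S a))"
  "charts (dprod S) = (\<Pi>\<^sub>E a\<in>fst S. charts (snd S a))"
  "cdom (dprod S) k = (\<Pi>\<^sub>E a\<in>fst S. cdom (snd S a) (k a))"
  "cmap (dprod S) k x = (\<lambda>(a, i)\<in>(SIGMA a:fst S. mindex (snd S a)). cmap (snd S a) (k a) (x a) i)"
  by (cases S; simp add: dprod_def)+

lemma TFS_iff: "S \<in> TFS \<longleftrightarrow> finite (fst S) \<and> snd S \<in> extensional (fst S) \<and> (\<forall>a\<in>fst S. is_manifold (snd S a))"
  by (cases S) (auto simp: TFS_def Man_def PiE_iff)

lemma TFS_finite: "S \<in> TFS \<Longrightarrow> finite (fst S)"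
  and TFS_manifold: "S \<in> TFS \<Longrightarrow> a \<in> fst S \<Longrightarrow> is_manifold (snd S a)"
  by (simp_all add: TFS_iff)

lemma TFS_charted: "S \<in> TFS \<Longrightarrow> a \<in> fst S \<Longrightarrow> charted (snd S a)"
  by (simp add: TFS_manifold is_manifold_imp_charted)

text \<open>The counterpart of \<open>mprod_chart\<close> with one block \<open>r a\<close> of
  coordinates per index \<open>a\<close>. The last conclusion is what identifies the blocks of the
  Jacobian.\<close>

lemma dprod_chart:
  assumes S: "S \<in> TFS" and k: "k \<in> charts (dprod S)"
  defines "r \<equiv> \<lambda>a x. \<lambda>i\<in>mindex (snd S a). x (a, i)"
  defines "B \<equiv> {x \<in> extensional (mindex (dprod S)). \<forall>a\<in>fst S. r a x \<in> cmap (snd S a) (k a) ` cdom (snd S a) (k a)}"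
  shows "openin (Rsp (mindex (dprod S))) B"
    "cmap (dprod S) k ` cdom (dprod S) k = B"
    "homeomorphic_map (subtopology (mtop (dprod S)) (cdom (dprod S) k))
       (subtopology (Rsp (mindex (dprod S))) (cmap (dprod S) k ` cdom (dprod S) k)) (cmap (dprod S) k)"
    "\<And>x. x \<in> B \<Longrightarrow> cinv (dprod S) k x = (\<lambda>a\<in>fst S. cinv (snd S a) (k a) (r a x))"
    "\<And>z a. z \<in> cdom (dprod S) k \<Longrightarrow> a \<in> fst S \<Longrightarrow> r a (cmap (dprod S) k z) = cmap (snd S a) (k a) (z a)"
proof -
  let ?A = "fst S" and ?I = "mindex (dprod S)" and ?J = "\<lambda>a. mindex (snd S a)"
  let ?d = "\<lambda>x. \<lambda>a\<in>?A. cinv (snd S a) (k a) (r a x)"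
  note fin = TFS_finite[OF S] and man = TFS_charted[OF S]
  have k: "k a \<in> charts (snd S a)" if "a \<in> ?A" for a using k that by auto
  have cr: "continuous_map (Rsp ?I) (Rsp (?J a)) (r a)" if "a \<in> ?A" for a
    unfolding r_def using that by (intro continuous_map_Rsp_reindex) auto
  have "B = topspace (Rsp ?I) \<inter> (\<Inter>a\<in>?A. {x \<in> topspace (Rsp ?I). r a x \<in> cmap (snd S a) (k a) ` cdom (snd S a) (k a)})"
    unfolding B_def by auto
  moreover have "openin (Rsp ?I) {x \<in> topspace (Rsp ?I). r a x \<in> cmap (snd S a) (k a) ` cdom (snd S a) (k a)}"
    if "a \<in> ?A" for a
    by (rule openin_continuous_map_preimage[OF cr charted_open_image[OF man k]]) (rule that)+
  ultimately show opB: "openin (Rsp ?I) B"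
    using openin_INT[OF fin, of "Rsp ?I"] by (simp only: Int_commute)
  have opA: "openin (mtop (dprod S)) (cdom (dprod S) k)"
    using fin charted_open[OF man k] by (simp add: openin_PiE_gen)
  have cc: "continuous_map (subtopology (mtop (dprod S)) (cdom (dprod S) k)) (Rsp ?I) (cmap (dprod S) k)"
    (is "continuous_map ?X _ _")
  proof -
    have "continuous_map ?X euclideanreal (\<lambda>z. cmap (dprod S) k z (a, i))" if a: "a \<in> ?A" "i \<in> ?J a" for a i
    proof -
      have "continuous_map ?X (subtopology (mtop (snd S a)) (cdom (snd S a) (k a))) (\<lambda>z. z a)"
        unfolding continuous_map_in_subtopology using a
        by (auto intro!: continuous_map_from_subtopology continuous_map_product_projection)
      from continuous_map_compose[OF continuous_map_compose[OF this continuous_cmap[OF man k]]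
          continuous_map_product_projection[OF a(2), of "\<lambda>_. euclideanreal", folded Rsp_def]]
      show ?thesis using a by (simp add: o_def)
    qed
    then have "\<forall>p\<in>?I. continuous_map ?X euclideanreal (\<lambda>z. cmap (dprod S) k z p)"
      unfolding dprod_simps(2) by blast
    moreover have "cmap (dprod S) k ` topspace ?X \<subseteq> extensional ?I" by auto
    ultimately show ?thesis
      unfolding Rsp_def continuous_map_componentwise by blast
  qed
  have cd: "continuous_map (subtopology (Rsp ?I) B) (mtop (dprod S)) ?d"
  proof -
    have "continuous_map (subtopology (Rsp ?I) B) (mtop (snd S a)) (\<lambda>x. ?d x a)" if a: "a \<in> ?A" for a
    proof -
      have "continuous_map (subtopology (Rsp ?I) B)
          (subtopology (Rsp (?J a)) (cmap (snd S a) (k a) ` cdom (snd S a) (k a))) (r a)"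
        unfolding continuous_map_in_subtopology using cr[OF a] a
        by (auto intro: continuous_map_from_subtopology simp: B_def)
      from continuous_map_compose[OF this continuous_cinv[OF man[OF a] k[OF a]]]
      show ?thesis using a by (simp add: o_def)
    qed
    then show ?thesis by (auto simp: continuous_map_componentwise)
  qed
  show r: "r a (cmap (dprod S) k z) = cmap (snd S a) (k a) (z a)"
    if "z \<in> cdom (dprod S) k" "a \<in> ?A" for z a
  proof -
    have "r a (cmap (dprod S) k z) = restrict (cmap (snd S a) (k a) (z a)) (?J a)"
      unfolding r_def using that(2) by (intro restrict_ext) auto
    also have "\<dots> = cmap (snd S a) (k a) (z a)"
      using that by (intro extensional_restrict cmap_in_Rsp[OF man k]) auto
    finally show ?thesis .
  qed
  have A: "cmap (dprod S) k z \<in> B \<and> ?d (cmap (dprod S) k z) = z" if z: "z \<in> cdom (dprod S) k" for z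
  proof
    have za: "z a \<in> cdom (snd S a) (k a)" if "a \<in> ?A" for a using z that by auto
    have "cmap (dprod S) k z \<in> extensional ?I" by simp
    then show "cmap (dprod S) k z \<in> B" using r[OF z] za unfolding B_def by blast
    have "?d (cmap (dprod S) k z) = restrict z ?A"
      using r[OF z] za man k by (intro restrict_ext) (simp add: cinv_cmap del: dprod_simps)
    also have "\<dots> = z" using z by (intro extensional_restrict) (auto simp: PiE_iff)
    finally show "?d (cmap (dprod S) k z) = z" .
  qed
  have B: "?d x \<in> cdom (dprod S) k \<and> cmap (dprod S) k (?d x) = x" if x: "x \<in> B" for x
  proof
    have rx: "r a x \<in> cmap (snd S a) (k a) ` cdom (snd S a) (k a)" if "a \<in> ?A" for a
      using x that unfolding B_def by blast
    show "?d x \<in> cdom (dprod S) k" using cinv_in[OF rx] by simp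
    have "cmap (dprod S) k (?d x) = restrict x ?I"
      unfolding dprod_simps using cmap_cinv[OF rx] by (intro restrict_ext) (auto simp: r_def)
    also have "\<dots> = x" using x unfolding B_def by (intro extensional_restrict) blast
    finally show "cmap (dprod S) k (?d x) = x" .
  qed
  note intro = homeomorphic_map_intro[OF opA opB cc A cd B]
  show "cmap (dprod S) k ` cdom (dprod S) k = B"
    "homeomorphic_map (subtopology (mtop (dprod S)) (cdom (dprod S) k))
       (subtopology (Rsp ?I) (cmap (dprod S) k ` cdom (dprod S) k)) (cmap (dprod S) k)"
    by (rule intro; assumption)+
  show "cinv (dprod S) k x = ?d x" if "x \<in> B" for x
    unfolding cinv_def[of "dprod S"] by (rule intro(3)) (use that in auto)
qed

lemma charted_dprod:
  assumes S: "S \<in> TFS"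
  shows "charted (dprod S)"
  unfolding charted_def
proof (intro conjI ballI)
  note fin = TFS_finite[OF S] and man = TFS_charted[OF S]
  show "finite (mindex (dprod S))" using fin charted_finite[OF man] by auto
  show "points (dprod S) = (\<Union>k\<in>charts (dprod S). cdom (dprod S) k)"
  proof (intro equalityI subsetI)
    fix x assume x: "x \<in> points (dprod S)"
    have "\<forall>a\<in>fst S. \<exists>k. k \<in> charts (snd S a) \<and> x a \<in> cdom (snd S a) k"
      using x charted_points[OF man] by (auto simp: PiE_iff)
    then obtain k where "\<forall>a\<in>fst S. k a \<in> charts (snd S a) \<and> x a \<in> cdom (snd S a) (k a)"
      using bchoice[of "fst S"] by metis
    then show "x \<in> (\<Union>k\<in>charts (dprod S). cdom (dprod S) k)"
      using x by (intro UN_I[of "restrict k (fst S)"]) (auto simp: PiE_iff)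
  next
    fix x assume "x \<in> (\<Union>k\<in>charts (dprod S). cdom (dprod S) k)"
    then show "x \<in> points (dprod S)"
      using charted_cdom_subset[OF man] by (fastforce simp: PiE_iff)
  qed
  fix k assume k: "k \<in> charts (dprod S)"
  show "openin (mtop (dprod S)) (cdom (dprod S) k)"
    using fin k charted_open[OF man] by (auto simp: openin_PiE_gen PiE_iff)
  show "openin (Rsp (mindex (dprod S))) (cmap (dprod S) k ` cdom (dprod S) k)"
    "homeomorphic_map (subtopology (mtop (dprod S)) (cdom (dprod S) k))
       (subtopology (Rsp (mindex (dprod S))) (cmap (dprod S) k ` cdom (dprod S) k)) (cmap (dprod S) k)"
    using dprod_chart(1-3)[OF S k] by (simp_all only:)
qed

lemma smooth_map_dprod_coord:
  assumes S: "S \<in> TFS" and a: "a \<in> fst S"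
  shows "smooth_map (dprod S) (snd S a) (\<lambda>x. x a)"
proof (rule smooth_map_projection[OF charted_dprod[OF S] TFS_manifold[OF S a]])
  show "continuous_map (mtop (dprod S)) (mtop (snd S a)) (\<lambda>x. x a)"
    using continuous_map_product_projection[OF a, of "\<lambda>a. mtop (snd S a)"] by simp
  fix k assume "k \<in> charts (dprod S)"
  then show "\<exists>l\<in>charts (snd S a). \<exists>r. r ` mindex (snd S a) \<subseteq> mindex (dprod S) \<and> (\<forall>z\<in>cdom (dprod S) k.
      z a \<in> cdom (snd S a) l \<and> (\<forall>i\<in>mindex (snd S a). cmap (snd S a) l (z a) i = cmap (dprod S) k z (r i)))"
    using a by (intro bexI[of _ "k a"] exI[of _ "\<lambda>i. (a, i)"]) auto
qed

text \<open>With the identity for \<open>F\<close>, this says that the chart changes of a dependent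
  product are smooth, which is how \<open>is_manifold_dprod\<close> uses it.\<close>

lemma smooth_on_dprodI:
  assumes F: "\<And>a. a \<in> fst S \<Longrightarrow> smooth_map M (snd S a) (\<lambda>m. F m a)"
    and l: "l \<in> charts (dprod S)" and p: "p \<in> mindex (dprod S)"
  shows "smooth_on M {m. F m \<in> cdom (dprod S) l} (\<lambda>m. cmap (dprod S) l (F m) p)"
proof -
  obtain a i where ai: "p = (a, i)" "a \<in> fst S" "i \<in> mindex (snd S a)" using p by auto
  then have "smooth_on M {m. F m a \<in> cdom (snd S a) (l a)} (\<lambda>m. cmap (dprod S) l (F m) p)"
    using F[OF ai(2)] l unfolding smooth_map_iff by (auto simp: PiE_iff)
  then show ?thesis by (rule smooth_on_subset) (use ai in auto)
qed

lemma smooth_map_dprodI: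
  assumes F: "\<And>a. a \<in> fst S \<Longrightarrow> smooth_map M (snd S a) (\<lambda>m. F m a)"
    and ext: "\<And>m. m \<in> points M \<Longrightarrow> F m \<in> extensional (fst S)"
  shows "smooth_map M (dprod S) F"
  unfolding smooth_map_iff
proof (intro conjI ballI)
  show "continuous_map (mtop M) (mtop (dprod S)) F"
    using smooth_map_continuous[OF F] ext by (auto simp: continuous_map_componentwise)
qed (rule smooth_on_dprodI[OF F])

lemma is_manifold_dprod:
  assumes S: "S \<in> TFS"
  shows "is_manifold (dprod S)"
proof -
  have "Hausdorff_space (mtop (dprod S))"
    using TFS_manifold[OF S] unfolding dprod_simps Hausdorff_space_product_topology is_manifold_def by blast
  moreover have "second_countable (mtop (dprod S))"
    using TFS_finite[OF S] TFS_manifold[OF S] unfolding dprod_simps is_manifold_def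
    by (intro second_countable_product_topology) auto
  moreover have "smooth_fun (mindex (dprod S)) (cmap (dprod S) k ` (cdom (dprod S) k \<inter> cdom (dprod S) l))
      (\<lambda>x. cmap (dprod S) l (cinv (dprod S) k x) p)"
    if "k \<in> charts (dprod S)" "l \<in> charts (dprod S)" "p \<in> mindex (dprod S)" for k l p
    using smooth_on_dprodI[OF smooth_map_dprod_coord[OF S] that(2,3)] that(1)
    unfolding smooth_on_def by simp
  ultimately show ?thesis
    using charted_dprod[OF S] unfolding is_manifold_def charted_def by blast
qed

lemma smooth_map_dmap:
  assumes "S \<in> TFS" "T \<in> TFS" "q ` fst S \<subseteq> fst T" "\<And>a. a \<in> fst S \<Longrightarrow> snd T (q a) = snd S a"
  shows "smooth_map (dprod T) (dprod S) (dmap (fst S) q)"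
proof (rule smooth_map_dprodI)
  show "smooth_map (dprod T) (snd S a) (\<lambda>x. dmap (fst S) q x a)" if "a \<in> fst S" for a
    using smooth_map_dprod_coord[OF assms(2), of "q a"] that assms(3,4) by (auto simp: dmap_def)
qed (simp add: dmap_def)

subsection \<open>Tangent bundles\<close>

lemma tangent_bundle_simps [simp]:
  "mindex (tangent_bundle M) = mindex M <+> mindex M"
  "charts (tangent_bundle M) = charts M"
  "cdom (tangent_bundle M) = tcdom M"
  "cmap (tangent_bundle M) = tcmap M"
  by (simp_all add: tangent_bundle_def)

lemma tcmap_apply:
  "tcmap M k z = (\<lambda>i\<in>mindex M <+> mindex M. case_sum (cmap M k (fst z)) (snd z k) i)"
  by (simp add: tcmap_def case_prod_unfold)

lemma openin_tcdom: "k \<in> charts M \<Longrightarrow> openin (mtop (tangent_bundle M)) (tcdom M k)"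
proof -
  assume k: "k \<in> charts M"
  \<comment> \<open>Taking the whole coordinate space for \<open>V\<close> exhibits the chart domain
    as one of the generating open sets.\<close>
  have "tcdom M k = {z \<in> tcdom M k. tcmap M k z \<in> topspace (Rsp (mindex M <+> mindex M))}"
    by (auto simp: tcmap_def)
  then show ?thesis
    unfolding tangent_bundle_def manifold.simps
    using k openin_topspace by (intro topology_generated_by_Basis) blast
qed

text \<open>The generating open sets are pulled back from coordinate space, so continuity can be
  tested on the functions \<open>tcmap N l\<close> after \<open>F\<close>. Their first block comes
  from the base point and their second from the vector, and both are smooth by assumption.\<close>

lemma smooth_map_tangentI:
  assumes Q: "charted Q" and N: "charted N"
    and base: "smooth_map Q N (\<lambda>q. fst (F q))"
    and vec: "\<And>q. q \<in> points Q \<Longrightarrow> snd (F q) \<in> tangent_space N (fst (F q))"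
    and coords: "\<And>l j. l \<in> charts N \<Longrightarrow> j \<in> mindex N \<Longrightarrow>
      smooth_on Q {q. fst (F q) \<in> cdom N l} (\<lambda>q. snd (F q) l j)"
  shows "smooth_map Q (tangent_bundle N) F"
proof -
  let ?I = "mindex N <+> mindex N"
  have sm: "smooth_on Q {q \<in> points Q. fst (F q) \<in> cdom N l} (\<lambda>q. tcmap N l (F q) p)"
    if l: "l \<in> charts N" and p: "p \<in> ?I" for l p
  proof -
    have "smooth_on Q {q. fst (F q) \<in> cdom N l} (\<lambda>q. tcmap N l (F q) p)"
    proof (cases p)
      case (Inl j)
      with l p base show ?thesis by (auto simp: smooth_map_iff tcmap_apply)
    next
      case (Inr j)
      with l p coords[of l j] show ?thesis by (auto simp: tcmap_apply)
    qed
    then show ?thesis by (rule smooth_on_subset) auto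
  qed
  \<comment> \<open>Because the vectors are tangent at their base points, membership in a chart
    domain of the tangent bundle concerns the base point alone.\<close>
  have tc: "F q \<in> tcdom N l \<longleftrightarrow> fst (F q) \<in> cdom N l" if "q \<in> points Q" for q l
    using vec[OF that] by (simp add: tcdom_def mem_Sigma_iff[of "fst (F q)" "snd (F q)", simplified])
  have "continuous_map (mtop Q) (mtop (tangent_bundle N)) F"
    unfolding tangent_bundle_def manifold.simps continuous_on_generated_topo_iff
  proof (intro conjI allI impI)
    fix Z assume "Z \<in> {{z \<in> tcdom N k. tcmap N k z \<in> V} |k V. k \<in> charts N \<and> openin (Rsp ?I) V}"
    then obtain k V where Z: "Z = {z \<in> tcdom N k. tcmap N k z \<in> V}" "k \<in> charts N" "openin (Rsp ?I) V" by blast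
    let ?W = "{q \<in> points Q. fst (F q) \<in> cdom N k}"
    have opW: "openin (mtop Q) ?W"
      using smooth_map_continuous[OF base] charted_open[OF N Z(2)] by (rule openin_continuous_map_preimage)
    have "\<forall>p\<in>?I. continuous_map (subtopology (mtop Q) ?W) euclideanreal (\<lambda>q. tcmap N k (F q) p)"
      using smooth_on_continuous[OF Q opW sm[OF Z(2)]] by blast
    moreover have "(\<lambda>q. tcmap N k (F q)) ` topspace (subtopology (mtop Q) ?W) \<subseteq> extensional ?I"
      by (auto simp: tcmap_apply)
    ultimately have "continuous_map (subtopology (mtop Q) ?W) (Rsp ?I) (\<lambda>q. tcmap N k (F q))"
      unfolding Rsp_def continuous_map_componentwise by blast
    then have "openin (subtopology (mtop Q) ?W) {q \<in> topspace (subtopology (mtop Q) ?W). tcmap N k (F q) \<in> V}"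
      using Z(3) by (rule openin_continuous_map_preimage)
    then have "openin (mtop Q) {q \<in> topspace (subtopology (mtop Q) ?W). tcmap N k (F q) \<in> V}"
      using opW by (rule openin_trans_full)
    moreover have "{q \<in> topspace (subtopology (mtop Q) ?W). tcmap N k (F q) \<in> V} = F -` Z \<inter> points Q"
      using tc unfolding topspace_subtopology_open[OF opW] Z(1) by auto
    ultimately show "openin (mtop Q) (F -` Z \<inter> points Q)" by simp
  next
    show "F ` points Q \<subseteq> \<Union> {{z \<in> tcdom N k. tcmap N k z \<in> V} |k V. k \<in> charts N \<and> openin (Rsp ?I) V}"
    proof
      fix z assume "z \<in> F ` points Q"
      then obtain q where q: "q \<in> points Q" "z = F q" by blast
      have "fst (F q) \<in> points N"
        using continuous_map_image_subset_topspace[OF smooth_map_continuous[OF base]] q(1) by blast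
      then obtain k where k: "k \<in> charts N" "fst (F q) \<in> cdom N k" using charted_points[OF N] by blast
      then have "z \<in> {z \<in> tcdom N k. tcmap N k z \<in> topspace (Rsp ?I)}"
        using tc[OF q(1)] q(2) by (auto simp: tcmap_apply)
      then show "z \<in> \<Union> {{z \<in> tcdom N k. tcmap N k z \<in> V} |k V. k \<in> charts N \<and> openin (Rsp ?I) V}"
        using k(1) openin_topspace[of "Rsp ?I"] by blast
    qed
  qed
  moreover have "smooth_on Q {q. F q \<in> tcdom N l} (\<lambda>q. tcmap N l (F q) p)"
    if "l \<in> charts N" "p \<in> ?I" for l p
    using sm[OF that] by (rule smooth_on_subset) (use charted_points[OF Q] tc in auto)
  ultimately show ?thesis unfolding smooth_map_iff by simp
qed

text \<open>The converse passage: it takes the vector field of a given system apart into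
  coordinates, from which the field of a product system is reassembled.\<close>

lemma smooth_map_tangentD:
  assumes Q: "charted Q" and F: "smooth_map Q (tangent_bundle N) F"
    and vec: "\<And>q. q \<in> points Q \<Longrightarrow> snd (F q) \<in> tangent_space N (fst (F q))"
    and l: "l \<in> charts N" "j \<in> mindex N"
  shows "smooth_on Q {q. fst (F q) \<in> cdom N l} (\<lambda>q. snd (F q) l j)"
proof -
  have "smooth_on Q {q. F q \<in> tcdom N l} (\<lambda>q. tcmap N l (F q) (Inr j))"
    using F l unfolding smooth_map_iff by auto
  moreover have "(\<lambda>q. tcmap N l (F q) (Inr j)) = (\<lambda>q. snd (F q) l j)"
    using l by (auto simp: tcmap_apply)
  ultimately have "smooth_on Q {q. F q \<in> tcdom N l} (\<lambda>q. snd (F q) l j)" by simp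
  then show ?thesis
  proof (rule smooth_on_subset, intro subsetI)
    fix q assume "q \<in> {q. fst (F q) \<in> cdom N l} \<inter> (\<Union>k\<in>charts Q. cdom Q k)"
    then have "fst (F q) \<in> cdom N l" "snd (F q) \<in> tangent_space N (fst (F q))"
      using vec charted_points[OF Q] by auto
    then show "q \<in> {q. F q \<in> tcdom N l}"
      by (cases "F q") (simp add: tcdom_def)
  qed
qed

text \<open>The \<open>b\<close>-component of a chart change reads only the \<open>b\<close>-block
  of the coordinates. Along a direction from another block it is constant, and along one from the
  same block it is literally the chart change of the factor.\<close>

lemma pd_dprod_transition:
  assumes S: "S \<in> TFS" and k: "k \<in> charts (dprod S)" and x: "x \<in> cdom (dprod S) k"
    and ai: "(a, i) \<in> mindex (dprod S)" and bj: "(b, j) \<in> mindex (dprod S)"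
  shows "pd (a, i) (\<lambda>y. cmap (dprod S) l (cinv (dprod S) k y) (b, j)) (cmap (dprod S) k x) =
    (if a = b then pd i (\<lambda>y. cmap (snd S b) (l b) (cinv (snd S b) (k b) y) j) (cmap (snd S b) (k b) (x b)) else 0)"
proof -
  let ?r = "\<lambda>y. \<lambda>i\<in>mindex (snd S b). y (b, i)"
  let ?f = "\<lambda>y. cmap (snd S b) (l b) (cinv (snd S b) (k b) y) j"
  let ?X = "cmap (dprod S) k x"
  note ch = charted_dprod[OF S]
  have b: "b \<in> fst S" "j \<in> mindex (snd S b)" using bj by auto
  have "pd (a, i) (\<lambda>y. cmap (dprod S) l (cinv (dprod S) k y) (b, j)) ?X = pd (a, i) (\<lambda>y. ?f (?r y)) ?X"
  proof (rule pd_cong_open[OF charted_finite[OF ch] charted_open_image[OF ch k]])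
    show "?X \<in> cmap (dprod S) k ` cdom (dprod S) k" using x by blast
    show "(a, i) \<in> mindex (dprod S)" by (rule ai)
    show "cmap (dprod S) l (cinv (dprod S) k y) (b, j) = ?f (?r y)"
      if "y \<in> cmap (dprod S) k ` cdom (dprod S) k" for y
      using dprod_chart(4)[OF S k, of y] that b unfolding dprod_chart(2)[OF S k] by simp
  qed
  also have "\<dots> = (if a = b then pd i ?f (cmap (snd S b) (k b) (x b)) else 0)"
  proof (cases "a = b")
    case True
    have r: "?r (?X((b, i) := t)) = (?r ?X)(i := t)" for t
      using ai True by (auto simp: fun_eq_iff)
    have rX: "?r ?X = cmap (snd S b) (k b) (x b)"
      by (rule dprod_chart(5)[OF S k x b(1)])
    have "?X (b, i) = cmap (snd S b) (k b) (x b) i"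
      using ai True by simp
    then show ?thesis unfolding pd_def True r rX by simp
  next
    case False
    have r: "?r (?X((a, i) := t)) = ?r ?X" for t
      using False by (auto simp: fun_eq_iff)
    show ?thesis unfolding pd_def r using False by simp
  qed
  finally show ?thesis .
qed

text \<open>The vanishing blocks reduce the sum over all coordinates to the block of
  \<open>b\<close>. The condition thereby splits into one condition per factor, which survives
  regrouping the factors.\<close>

lemma tangent_space_dprod:
  assumes S: "S \<in> TFS"
  shows "v \<in> tangent_space (dprod S) x \<longleftrightarrow>
    v \<in> charts_at (dprod S) x \<rightarrow>\<^sub>E (mindex (dprod S) \<rightarrow>\<^sub>E UNIV) \<and>
    (\<forall>k\<in>charts_at (dprod S) x. \<forall>l\<in>charts_at (dprod S) x. \<forall>b\<in>fst S. \<forall>j\<in>mindex (snd S b).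
       v l (b, j) = (\<Sum>i\<in>mindex (snd S b).
         pd i (\<lambda>y. cmap (snd S b) (l b) (cinv (snd S b) (k b) y) j) (cmap (snd S b) (k b) (x b)) * v k (b, i)))"
proof -
  have "(\<Sum>p\<in>mindex (dprod S). pd p (\<lambda>y. cmap (dprod S) l (cinv (dprod S) k y) (b, j)) (cmap (dprod S) k x) * v k p) =
      (\<Sum>i\<in>mindex (snd S b).
         pd i (\<lambda>y. cmap (snd S b) (l b) (cinv (snd S b) (k b) y) j) (cmap (snd S b) (k b) (x b)) * v k (b, i))"
    (is "(\<Sum>p\<in>_. ?f p * v k p) = (\<Sum>i\<in>_. ?g i * v k (b, i))")
    if k: "k \<in> charts_at (dprod S) x" and b: "b \<in> fst S" "j \<in> mindex (snd S b)" for k l b j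
  proof -
    have k': "k \<in> charts (dprod S)" "x \<in> cdom (dprod S) k" using k by (auto simp: charts_at_def)
    have bj: "(b, j) \<in> mindex (dprod S)" using b by simp
    have fin: "\<forall>a\<in>fst S. finite (mindex (snd S a))" using charted_finite[OF TFS_charted[OF S]] by blast
    have "(\<Sum>p\<in>mindex (dprod S). ?f p * v k p) =
        (\<Sum>(a, i)\<in>mindex (dprod S). (if a = b then ?g i * v k (b, i) else 0))"
      using pd_dprod_transition[OF S k' _ bj, of _ _ l] by (intro sum.cong) auto
    also have "\<dots> = (\<Sum>a\<in>fst S. \<Sum>i\<in>mindex (snd S a). if a = b then ?g i * v k (b, i) else 0)"
      unfolding dprod_simps(2) using TFS_finite[OF S] fin by (rule sum.Sigma[symmetric])
    also have "\<dots> = (\<Sum>a\<in>fst S. if a = b then \<Sum>i\<in>mindex (snd S b). ?g i * v k (b, i) else 0)"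
      by (intro sum.cong) auto
    also have "\<dots> = (\<Sum>i\<in>mindex (snd S b). ?g i * v k (b, i))"
      using TFS_finite[OF S] b(1) by simp
    finally show ?thesis .
  qed
  note sum = this
  have ball: "(\<forall>p\<in>mindex (dprod S). P p) \<longleftrightarrow> (\<forall>b\<in>fst S. \<forall>j\<in>mindex (snd S b). P (b, j))" for P
    by auto
  show ?thesis
    unfolding tangent_space_def mem_Collect_eq ball using sum
    by (intro conj_cong refl ball_cong) simp
qed

section \<open>The monoidal category of wiring diagrams\<close>

subsection \<open>Disjoint unions of sets of natural numbers\<close>

lemma less_ub: "finite A \<Longrightarrow> a \<in> A \<Longrightarrow> a < ub A"
  by (auto simp: ub_def less_Suc_eq_le)

lemma inr_notin [simp]: "finite A \<Longrightarrow> inr A b \<notin> A"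
  using less_ub[of A "inr A b"] by (auto simp: inr_def)

lemma inl_simp [simp]: "inl a = a"
  by (simp add: inl_def)

lemma inl_image [simp]: "inl ` A = A"
  by (simp add: image_def)

lemma inr_eq_iff [simp]: "inr A b = inr A b' \<longleftrightarrow> b = b'"
  by (simp add: inr_def)

lemma inr_minus_ub [simp]: "inr A b - ub A = b"
  by (simp add: inr_def)

lemma inr_empty [simp]: "inr {} b = b"
  by (simp add: inr_def ub_def)

lemma dsumI1 [intro]: "a \<in> A \<Longrightarrow> a \<in> dsum A B"
  by (simp add: dsum_def image_iff)

lemma inr_in_dsum [simp]: "finite A \<Longrightarrow> inr A b \<in> dsum A B \<longleftrightarrow> b \<in> B"
  using inr_notin[of A b] by (auto simp: dsum_def image_iff)

lemma dsumE [elim]: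
  assumes "x \<in> dsum A B"
  obtains (inl) "x \<in> A" | (inr) b where "b \<in> B" "x = inr A b"
  using assms by (auto simp: dsum_def)

lemma finite_dsum [simp]: "finite A \<Longrightarrow> finite B \<Longrightarrow> finite (dsum A B)"
  by (simp add: dsum_def)

lemma dsum_empty [simp]: "dsum {} B = B" "dsum A {} = A"
  by (simp_all add: dsum_def)

lemma card_dsum: "finite A \<Longrightarrow> finite B \<Longrightarrow> card (dsum A B) = card A + card B"
proof -
  assume fin: "finite A" "finite B"
  have "inl ` A \<inter> inr A ` B = {}" using fin inr_notin by auto
  moreover have "inj_on inl A" "inj_on (inr A) B" by (auto simp: inj_on_def)
  ultimately show ?thesis using fin by (simp add: dsum_def card_Un_disjoint card_image)
qed

text \<open>The source of all strictness: upper bounds add, so that shifting past a disjoint union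
  is shifting past each part in turn. The value 0 for the empty set makes the law hold there as
  well.\<close>

lemma ub_dsum: "finite A \<Longrightarrow> finite B \<Longrightarrow> ub (dsum A B) = ub A + ub B"
proof (cases "B = {}")
  case True
  then show ?thesis by (simp add: ub_def)
next
  case False
  assume fin: "finite A" "finite B"
  have "Max (dsum A B) = inr A (Max B)"
  proof (rule Max_eqI)
    show "x \<le> inr A (Max B)" if "x \<in> dsum A B" for x
      using that fin less_ub[of A x] Max_ge[of B] by (auto simp: inr_def)
    show "inr A (Max B) \<in> dsum A B" using fin False by simp
  qed (use fin in simp)
  moreover have "dsum A B \<noteq> {}" using False by (auto simp: dsum_def)
  ultimately show ?thesis using False by (simp add: ub_def[of "dsum A B"] ub_def[of B] inr_def)
qed

lemma inr_dsum: "finite A \<Longrightarrow> finite B \<Longrightarrow> inr (dsum A B) c = inr A (inr B c)"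
  by (simp add: inr_def ub_dsum)

lemma dsum_assoc: "finite A \<Longrightarrow> finite B \<Longrightarrow> dsum (dsum A B) C = dsum A (dsum B C)"
proof -
  assume fin: "finite A" "finite B"
  have dsum: "dsum X Y = X \<union> inr X ` Y" for X Y by (simp add: dsum_def)
  have "dsum (dsum A B) C = dsum A B \<union> inr A ` inr B ` C"
    by (simp add: dsum[of "dsum A B"] image_image inr_dsum[OF fin])
  then show ?thesis
    by (simp add: dsum[of A] dsum[of B] image_Un Un_assoc)
qed

section \<open>Maps out of disjoint unions\<close>

lemma copair_inl [simp]: "a \<in> A \<Longrightarrow> copair A B f g a = f a"
  by (simp add: copair_def dsumI1)

lemma copair_inr [simp]: "finite A \<Longrightarrow> b \<in> B \<Longrightarrow> copair A B f g (inr A b) = g b"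
  by (simp add: copair_def)

lemma copair_extensional [simp]: "copair A B f g \<in> extensional (dsum A B)"
  by (simp add: copair_def)

lemma extensional_dsum_eqI:
  assumes "f \<in> extensional (dsum A B)" "g \<in> extensional (dsum A B)"
    and "\<And>a. a \<in> A \<Longrightarrow> f a = g a" "\<And>b. b \<in> B \<Longrightarrow> f (inr A b) = g (inr A b)"
  shows "f = g"
  using assms by (intro extensionalityI[of f "dsum A B" g]) auto

lemma copair_cong:
  "finite A \<Longrightarrow> (\<And>a. a \<in> A \<Longrightarrow> f a = f' a) \<Longrightarrow> (\<And>b. b \<in> B \<Longrightarrow> g b = g' b) \<Longrightarrow>
     copair A B f g = copair A B f' g'"
  by (rule extensional_dsum_eqI[of _ A B]) simp_all

lemma copair_empty1: "g \<in> extensional B \<Longrightarrow> copair {} B f g = g"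
  by (rule extensionalityI[of _ B]) (auto simp: copair_def ub_def)

lemma copair_empty2: "f \<in> extensional A \<Longrightarrow> copair A {} f g = f"
  by (rule extensionalityI[of _ A]) (auto simp: copair_def)

lemma copair_assoc:
  assumes "finite A" "finite B" "finite C"
  shows "copair (dsum A B) C (copair A B f g) h = copair A (dsum B C) f (copair B C g h)"
proof (rule extensional_dsum_eqI)
  show "copair (dsum A B) C (copair A B f g) h \<in> extensional (dsum (dsum A B) C)"
    by (rule copair_extensional)
  show "copair A (dsum B C) f (copair B C g h) \<in> extensional (dsum (dsum A B) C)"
    unfolding dsum_assoc[OF assms(1,2)] by (rule copair_extensional)
  show "copair (dsum A B) C (copair A B f g) h x = copair A (dsum B C) f (copair B C g h) x"
    if "x \<in> dsum A B" for x
    using that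
  proof (cases rule: dsumE)
    case inl
    then show ?thesis using that by simp
  next
    case (inr b)
    then show ?thesis using that assms by (simp add: dsumI1)
  qed
  show "copair (dsum A B) C (copair A B f g) h (inr (dsum A B) c) =
      copair A (dsum B C) f (copair B C g h) (inr (dsum A B) c)" if "c \<in> C" for c
    \<comment> \<open>Simplification rewrites \<open>inr (dsum A B) c\<close> to nested shifts, so
      the rule for the second summand is put into the same form first.\<close>
    using that assms by (simp add: inr_dsum copair_inr[of "dsum A B", unfolded inr_dsum[OF assms(1,2)]])
qed

lemma fsum_inl [simp]: "a \<in> A \<Longrightarrow> fsum A B A' f g a = f a"
  by (simp add: fsum_def)

lemma fsum_inr [simp]: "finite A \<Longrightarrow> b \<in> B \<Longrightarrow> fsum A B A' f g (inr A b) = inr A' (g b)"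
  by (simp add: fsum_def)

lemma nabla_simps [simp]: "a \<in> A \<Longrightarrow> nabla A a = a" "finite A \<Longrightarrow> a \<in> A \<Longrightarrow> nabla A (inr A a) = a"
  by (simp_all add: nabla_def)

lemma swap_simps [simp]: "a \<in> A \<Longrightarrow> swap A B a = inr B a" "finite A \<Longrightarrow> b \<in> B \<Longrightarrow> swap A B (inr A b) = b"
  by (simp_all add: swap_def)

lemma interchange_simps [simp]:
  assumes "finite A" "finite B" "finite C"
  shows "a \<in> A \<Longrightarrow> interchange A B C D a = a"
    "b \<in> B \<Longrightarrow> interchange A B C D (inr A b) = inr (dsum A C) b"
    "c \<in> C \<Longrightarrow> interchange A B C D (inr (dsum A B) c) = inr A c"
    "d \<in> D \<Longrightarrow> interchange A B C D (inr (dsum A B) (inr C d)) = inr (dsum A C) (inr B d)"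
  using assms by (simp_all add: interchange_def dsumI1)

definition enc :: "nat set \<Rightarrow> nat + nat \<Rightarrow> nat" where
  "enc A = case_sum id (inr A)"

lemma enc_simps [simp]: "enc A (Inl a) = a" "enc A (Inr b) = inr A b"
  by (simp_all add: enc_def)

lemma bij_betw_enc: "finite A \<Longrightarrow> bij_betw (enc A) (A <+> B) (dsum A B)"
  unfolding bij_betw_def inj_on_def
proof (intro conjI ballI impI)
  assume A: "finite A"
  fix s t assume "s \<in> A <+> B" "t \<in> A <+> B" "enc A s = enc A t"
  then show "s = t" using A inr_notin[OF A] by (auto elim!: PlusE)
next
  assume "finite A"
  then show "enc A ` (A <+> B) = dsum A B" by (force simp: image_iff)
qed

lemma bij_betw_card_surj:
  assumes "finite A" "card A = card B" "f ` A = B"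
  shows "bij_betw f A B"
  using assms eq_card_imp_inj_on[of A f] by (auto simp: bij_betw_def)

section \<open>Sums of typed sets and of boxes\<close>

lemma tsum_simps [simp]:
  "fst (tsum S T) = dsum (fst S) (fst T)"
  "a \<in> fst S \<Longrightarrow> snd (tsum S T) a = snd S a"
  "finite (fst S) \<Longrightarrow> b \<in> fst T \<Longrightarrow> snd (tsum S T) (inr (fst S) b) = snd T b"
  by (simp_all add: tsum_def)

lemma TFS_Man: "S \<in> TFS \<Longrightarrow> snd S \<in> fst S \<rightarrow>\<^sub>E Man"
  by (auto simp: TFS_def)

lemma tsum_TFS: "S \<in> TFS \<Longrightarrow> T \<in> TFS \<Longrightarrow> tsum S T \<in> TFS"
proof -
  assume ST: "S \<in> TFS" "T \<in> TFS"
  have "snd (tsum S T) x \<in> Man" if "x \<in> dsum (fst S) (fst T)" for x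
    using that TFS_finite[OF ST(1)] TFS_Man[OF ST(1)] TFS_Man[OF ST(2)] by (cases rule: dsumE) (auto simp: PiE_iff)
  moreover have "snd (tsum S T) \<in> extensional (dsum (fst S) (fst T))" by (simp add: tsum_def)
  ultimately show ?thesis
    using TFS_finite[OF ST(1)] TFS_finite[OF ST(2)]
    by (simp add: TFS_def case_prod_unfold PiE_iff)
qed

lemma tempty_TFS: "tempty \<in> TFS"
  by (auto simp: TFS_def tempty_def)

lemma tsum_assoc: "R \<in> TFS \<Longrightarrow> S \<in> TFS \<Longrightarrow> T \<in> TFS \<Longrightarrow> tsum (tsum R S) T = tsum R (tsum S T)"
  using TFS_finite by (simp add: tsum_def dsum_assoc copair_assoc)

lemma tsum_tempty: "S \<in> TFS \<Longrightarrow> tsum tempty S = S" "S \<in> TFS \<Longrightarrow> tsum S tempty = S"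
  using TFS_Man[of S] by (auto simp: tsum_def tempty_def copair_empty1 copair_empty2 PiE_iff)

definition boxes :: "box set" where
  "boxes = TFS \<times> TFS"

lemma boxes_finite [simp]: "X \<in> boxes \<Longrightarrow> finite (lin X)" "X \<in> boxes \<Longrightarrow> finite (lout X)"
  using TFS_finite by (auto simp: boxes_def)

lemma box_sum_simps [simp]:
  "box_in (box_sum X Y) = tsum (box_in X) (box_in Y)"
  "box_out (box_sum X Y) = tsum (box_out X) (box_out Y)"
  by (simp_all add: box_sum_def)

lemma box_sum_boxes [simp]: "X \<in> boxes \<Longrightarrow> Y \<in> boxes \<Longrightarrow> box_sum X Y \<in> boxes"
  by (auto simp: boxes_def box_sum_def tsum_TFS)

lemma box_sum_assoc:
  "X \<in> boxes \<Longrightarrow> Y \<in> boxes \<Longrightarrow> Z \<in> boxes \<Longrightarrow> box_sum (box_sum X Y) Z = box_sum X (box_sum Y Z)"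
  by (auto simp: boxes_def box_sum_def tsum_assoc)

abbreviation box_unit :: box where "box_unit \<equiv> (tempty, tempty)"

lemma box_unit_boxes [simp]: "box_unit \<in> boxes"
  by (simp add: boxes_def tempty_TFS)

lemma box_sum_unit: "X \<in> boxes \<Longrightarrow> box_sum box_unit X = X" "X \<in> boxes \<Longrightarrow> box_sum X box_unit = X"
  by (auto simp: boxes_def box_sum_def tsum_tempty)

subsection \<open>Wiring diagrams in terms of sum types\<close>

text \<open>Reading \<open>lout X + lin Y\<close> as a sum type turns every equation between wiring diagrams into a
  case distinction.\<close>

definition wiring_of :: "box \<Rightarrow> box \<Rightarrow> (nat \<Rightarrow> nat + nat) \<Rightarrow> (nat \<Rightarrow> nat) \<Rightarrow> wiring" where
  "wiring_of X Y \<alpha> \<beta> = mk_wiring X Y (\<lambda>a. enc (lout X) (\<alpha> a)) \<beta>"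

text \<open>The requirement that outputs of \<open>Y\<close> are fed by outputs of \<open>X\<close>
  is built into the branch \<open>Inl \<circ> \<beta>\<close>. The last two conjuncts say that wires
  preserve types.\<close>

definition wiring_ok :: "box \<Rightarrow> box \<Rightarrow> (nat \<Rightarrow> nat + nat) \<Rightarrow> (nat \<Rightarrow> nat) \<Rightarrow> bool" where
  "wiring_ok X Y \<alpha> \<beta> \<longleftrightarrow>
     bij_betw (case_sum \<alpha> (Inl \<circ> \<beta>)) (lin X <+> lout Y) (lout X <+> lin Y) \<and>
     (\<forall>a\<in>lin X. case_sum (snd (box_out X)) (snd (box_in Y)) (\<alpha> a) = snd (box_in X) a) \<and>
     (\<forall>b\<in>lout Y. snd (box_out X) (\<beta> b) = snd (box_out Y) b)"

lemma wiring_ok_in: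
  assumes "wiring_ok X Y \<alpha> \<beta>" "a \<in> lin X"
  shows "\<alpha> a \<in> lout X <+> lin Y"
proof -
  have "case_sum \<alpha> (Inl \<circ> \<beta>) (Inl a) \<in> lout X <+> lin Y"
    using bij_betw_apply[OF conjunct1[OF assms(1)[unfolded wiring_ok_def]] InlI[OF assms(2)]] .
  then show ?thesis by simp
qed

lemma wiring_ok_inE:
  assumes "wiring_ok X Y \<alpha> \<beta>" "a \<in> lin X"
  obtains (to_out) x where "\<alpha> a = Inl x" "x \<in> lout X" | (to_in) y where "\<alpha> a = Inr y" "y \<in> lin Y"
  using wiring_ok_in[OF assms] by auto

lemma wiring_ok_out:
  assumes "wiring_ok X Y \<alpha> \<beta>" "b \<in> lout Y"
  shows "\<beta> b \<in> lout X"
proof -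
  have "case_sum \<alpha> (Inl \<circ> \<beta>) (Inr b) \<in> lout X <+> lin Y"
    using bij_betw_apply[OF conjunct1[OF assms(1)[unfolded wiring_ok_def]] InrI[OF assms(2)]] .
  then show ?thesis by auto
qed

lemma wiring_ok_type_in:
  "wiring_ok X Y \<alpha> \<beta> \<Longrightarrow> a \<in> lin X \<Longrightarrow> case_sum (snd (box_out X)) (snd (box_in Y)) (\<alpha> a) = snd (box_in X) a"
  and wiring_ok_type_out:
  "wiring_ok X Y \<alpha> \<beta> \<Longrightarrow> b \<in> lout Y \<Longrightarrow> snd (box_out X) (\<beta> b) = snd (box_out Y) b"
  by (auto simp: wiring_ok_def)

lemma wiring_ok_surj_in:
  assumes "wiring_ok X Y \<alpha> \<beta>" "y \<in> lin Y"
  obtains a where "a \<in> lin X" "\<alpha> a = Inr y"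
proof -
  have "Inr y \<in> case_sum \<alpha> (Inl \<circ> \<beta>) ` (lin X <+> lout Y)"
    using assms unfolding wiring_ok_def bij_betw_def by auto
  then show thesis using that by auto
qed

lemma wiring_ok_surj_out:
  assumes "wiring_ok X Y \<alpha> \<beta>" "x \<in> lout X"
  obtains (in_wire) a where "a \<in> lin X" "\<alpha> a = Inl x" | (out_wire) b where "b \<in> lout Y" "\<beta> b = x"
proof -
  have "Inl x \<in> case_sum \<alpha> (Inl \<circ> \<beta>) ` (lin X <+> lout Y)"
    using assms unfolding wiring_ok_def bij_betw_def by auto
  then show thesis using that by auto
qed

lemma wiring_ok_card:
  assumes "wiring_ok X Y \<alpha> \<beta>" "X \<in> boxes" "Y \<in> boxes"
  shows "card (lin X) + card (lout Y) = card (lout X) + card (lin Y)"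
  using bij_betw_same_card[of "case_sum \<alpha> (Inl \<circ> \<beta>)" "lin X <+> lout Y" "lout X <+> lin Y"] assms
  by (simp add: wiring_ok_def card_Plus)

text \<open>Surjectivity can be established by tracing a wire backwards, whereas injectivity would
  require comparing two paths. The count supplies it instead.\<close>

lemma wiring_okI:
  assumes XY: "X \<in> boxes" "Y \<in> boxes" and card: "card (lin X) + card (lout Y) = card (lout X) + card (lin Y)"
    and \<alpha>: "\<And>a. a \<in> lin X \<Longrightarrow> \<alpha> a \<in> lout X <+> lin Y" and \<beta>: "\<And>b. b \<in> lout Y \<Longrightarrow> \<beta> b \<in> lout X"
    and sin: "\<And>y. y \<in> lin Y \<Longrightarrow> \<exists>a\<in>lin X. \<alpha> a = Inr y"
    and sout: "\<And>x. x \<in> lout X \<Longrightarrow> (\<exists>a\<in>lin X. \<alpha> a = Inl x) \<or> (\<exists>b\<in>lout Y. \<beta> b = x)"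
    and tin: "\<And>a. a \<in> lin X \<Longrightarrow> case_sum (snd (box_out X)) (snd (box_in Y)) (\<alpha> a) = snd (box_in X) a"
    and tout: "\<And>b. b \<in> lout Y \<Longrightarrow> snd (box_out X) (\<beta> b) = snd (box_out Y) b"
  shows "wiring_ok X Y \<alpha> \<beta>"
proof -
  let ?g = "case_sum \<alpha> (Inl \<circ> \<beta>)"
  have "bij_betw ?g (lin X <+> lout Y) (lout X <+> lin Y)"
  proof (rule bij_betw_card_surj)
    show "finite (lin X <+> lout Y)" "card (lin X <+> lout Y) = card (lout X <+> lin Y)"
      using boxes_finite[OF XY(1)] boxes_finite[OF XY(2)] card by (simp_all add: card_Plus)
    show "?g ` (lin X <+> lout Y) = lout X <+> lin Y"
    proof (intro equalityI subsetI)
      fix s assume "s \<in> ?g ` (lin X <+> lout Y)"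
      then show "s \<in> lout X <+> lin Y" using \<alpha> \<beta> by auto
    next
      fix s assume s: "s \<in> lout X <+> lin Y"
      have "(\<exists>a\<in>lin X. \<alpha> a = s) \<or> (\<exists>b\<in>lout Y. Inl (\<beta> b) = s)"
        using s sin sout by (cases s) auto
      then show "s \<in> ?g ` (lin X <+> lout Y)"
      proof (elim disjE bexE)
        fix a assume "a \<in> lin X" "\<alpha> a = s"
        then show ?thesis by (intro image_eqI[of _ _ "Inl a"]) auto
      next
        fix b assume "b \<in> lout Y" "Inl (\<beta> b) = s"
        then show ?thesis by (intro image_eqI[of _ _ "Inr b"]) auto
      qed
    qed
  qed
  then show ?thesis using tin tout by (simp add: wiring_ok_def)
qed

lemma wiring_of_cong:
  assumes "X \<in> boxes" "\<And>a. a \<in> lin X \<Longrightarrow> \<alpha> a = \<alpha>' a" "\<And>b. b \<in> lout Y \<Longrightarrow> \<beta> b = \<beta>' b"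
  shows "wiring_of X Y \<alpha> \<beta> = wiring_of X Y \<alpha>' \<beta>'"
  using assms by (auto simp: wiring_of_def mk_wiring_def intro!: copair_cong)

text \<open>Conjugation with \<open>enc\<close> on both sides turns the bijection of sum types into
  one of shifted unions.\<close>

lemma wiring_of_wirings:
  assumes XY: "X \<in> boxes" "Y \<in> boxes" and ok: "wiring_ok X Y \<alpha> \<beta>"
  shows "wiring_of X Y \<alpha> \<beta> \<in> wirings X Y"
proof -
  note fin [simp] = boxes_finite[OF XY(1)] boxes_finite[OF XY(2)]
  define \<phi> where "\<phi> = copair (lin X) (lout Y) (\<lambda>a. enc (lout X) (\<alpha> a)) (inl \<circ> \<beta>)"
  let ?g = "case_sum \<alpha> (Inl \<circ> \<beta>)"
  have g: "bij_betw ?g (lin X <+> lout Y) (lout X <+> lin Y)" using ok by (simp add: wiring_ok_def)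
  have eq: "\<phi> (enc (lin X) s) = enc (lout X) (?g s)" if "s \<in> lin X <+> lout Y" for s
    using that by (auto simp: \<phi>_def)
  have "bij_betw (enc (lout X) \<circ> ?g) (lin X <+> lout Y) (dsum (lout X) (lin Y))"
    by (rule bij_betw_trans[OF g bij_betw_enc]) simp
  then have "bij_betw (\<phi> \<circ> enc (lin X)) (lin X <+> lout Y) (dsum (lout X) (lin Y))"
    by (subst bij_betw_cong[of _ _ "enc (lout X) \<circ> ?g"]) (simp_all add: eq)
  then have bij: "bij_betw \<phi> (dsum (lin X) (lout Y)) (dsum (lout X) (lin Y))"
    using bij_betw_comp_iff[OF bij_betw_enc[of "lin X" "lout Y"], of \<phi>] by simp
  have type: "snd (tsum (box_out X) (box_in Y)) (\<phi> x) = snd (tsum (box_in X) (box_out Y)) x"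
    if "x \<in> dsum (lin X) (lout Y)" for x
    using that
  proof (cases rule: dsumE)
    case inl
    then show ?thesis
      using wiring_ok_in[OF ok inl] wiring_ok_type_in[OF ok inl] by (auto simp: \<phi>_def)
  next
    case (inr b)
    then show ?thesis
      using wiring_ok_out[OF ok inr(1)] wiring_ok_type_out[OF ok inr(1)] by (simp add: \<phi>_def)
  qed
  have "\<phi> \<in> extensional (dsum (lin X) (lout Y))" by (simp add: \<phi>_def)
  then have "\<phi> \<in> typed_fun (tsum (box_in X) (box_out Y)) (tsum (box_out X) (box_in Y))"
    using bij_betw_imp_funcset[OF bij] type by (auto simp: typed_fun_def PiE_def)
  moreover have "\<phi> ` inr (lin X) ` lout Y \<subseteq> inl ` lout X"
    using wiring_ok_out[OF ok] by (auto simp: \<phi>_def)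
  ultimately show ?thesis
    using bij by (simp add: wiring_of_def mk_wiring_def wirings_def \<phi>_def)
qed

lemma wirings_cases:
  assumes "\<Phi> \<in> wirings X Y" "X \<in> boxes" "Y \<in> boxes"
  obtains \<alpha> \<beta> where "\<Phi> = wiring_of X Y \<alpha> \<beta>" "wiring_ok X Y \<alpha> \<beta>"
proof -
  note fin [simp] = boxes_finite[OF assms(2)] boxes_finite[OF assms(3)]
  obtain \<phi> where \<phi>: "\<Phi> = (X, Y, \<phi>)"
    "\<phi> \<in> typed_fun (tsum (box_in X) (box_out Y)) (tsum (box_out X) (box_in Y))"
    "bij_betw \<phi> (dsum (lin X) (lout Y)) (dsum (lout X) (lin Y))"
    "\<phi> ` inr (lin X) ` lout Y \<subseteq> inl ` lout X"
    using assms(1) by (auto simp: wirings_def)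
  \<comment> \<open>Decodes a value of the shifted union: values in \<open>lout X\<close> belong to
    the first summand, and all others are shifted back by its upper bound.\<close>
  define \<alpha> where "\<alpha> a = (if \<phi> a \<in> lout X then Inl (\<phi> a) else Inr (\<phi> a - ub (lout X)))" for a
  define \<beta> where "\<beta> b = \<phi> (inr (lin X) b)" for b
  let ?g = "case_sum \<alpha> (Inl \<circ> \<beta>)"
  have \<beta>: "\<beta> b \<in> lout X" if "b \<in> lout Y" for b using \<phi>(4) that by (force simp: \<beta>_def)
  have enc: "enc (lout X) (\<alpha> a) = \<phi> a" "\<alpha> a \<in> lout X <+> lin Y" if "a \<in> lin X" for a
  proof -
    have "\<phi> a \<in> dsum (lout X) (lin Y)" using bij_betw_apply[OF \<phi>(3)] that by blast
    then show "enc (lout X) (\<alpha> a) = \<phi> a" "\<alpha> a \<in> lout X <+> lin Y" by (auto simp: \<alpha>_def)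
  qed
  have ext: "\<phi> \<in> extensional (dsum (lin X) (lout Y))"
    using \<phi>(2) by (auto simp: typed_fun_def PiE_iff)
  have "copair (lin X) (lout Y) (\<lambda>a. enc (lout X) (\<alpha> a)) (inl \<circ> \<beta>) = \<phi>"
    by (rule extensional_dsum_eqI[OF _ ext]) (simp_all add: enc \<beta>_def)
  then have \<Phi>: "\<Phi> = wiring_of X Y \<alpha> \<beta>" by (simp add: \<phi>(1) wiring_of_def mk_wiring_def)
  have "\<phi> (enc (lin X) s) = enc (lout X) (?g s)" if "s \<in> lin X <+> lout Y" for s
    using that by (auto simp: enc \<beta>_def)
  moreover have "bij_betw (\<phi> \<circ> enc (lin X)) (lin X <+> lout Y) (dsum (lout X) (lin Y))"
    using bij_betw_trans[OF bij_betw_enc \<phi>(3)] by simp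
  ultimately have "bij_betw (enc (lout X) \<circ> ?g) (lin X <+> lout Y) (dsum (lout X) (lin Y))"
    by (subst bij_betw_cong[of _ _ "\<phi> \<circ> enc (lin X)"]) simp_all
  moreover have sub: "?g ` (lin X <+> lout Y) \<subseteq> lout X <+> lin Y" using enc(2) \<beta> by auto
  ultimately have "bij_betw ?g (lin X <+> lout Y) (lout X <+> lin Y)"
    by (simp only: bij_betw_comp_iff2[OF bij_betw_enc[OF fin(2)] sub])
  moreover have "case_sum (snd (box_out X)) (snd (box_in Y)) (\<alpha> a) = snd (box_in X) a" if a: "a \<in> lin X" for a
  proof -
    have "snd (tsum (box_out X) (box_in Y)) (\<phi> a) = snd (tsum (box_in X) (box_out Y)) a"
      using \<phi>(2) dsumI1[OF a] by (simp add: typed_fun_def del: tsum_simps(2))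
    moreover have "snd (tsum (box_out X) (box_in Y)) (enc (lout X) (\<alpha> a)) =
        case_sum (snd (box_out X)) (snd (box_in Y)) (\<alpha> a)"
      using enc(2)[OF a] by auto
    ultimately show ?thesis using enc(1)[OF a] a by simp
  qed
  moreover have "snd (box_out X) (\<beta> b) = snd (box_out Y) b" if b: "b \<in> lout Y" for b
  proof -
    have "inr (lin X) b \<in> dsum (lin X) (lout Y)" using b by simp
    then have "snd (tsum (box_out X) (box_in Y)) (\<beta> b) = snd (tsum (box_in X) (box_out Y)) (inr (lin X) b)"
      using \<phi>(2) by (simp add: typed_fun_def \<beta>_def)
    then show ?thesis using b \<beta>[OF b] by simp
  qed
  ultimately have "wiring_ok X Y \<alpha> \<beta>" by (simp add: wiring_ok_def)
  with \<Phi> show thesis by (rule that)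
qed

section \<open>Composites, identities, sums and braidings in the sum-type form\<close>

lemma wiring_of_simps [simp]:
  "fst (wiring_of X Y \<alpha> \<beta>) = X" "fst (snd (wiring_of X Y \<alpha> \<beta>)) = Y"
  by (simp_all add: wiring_of_def mk_wiring_def)

lemma wire_in_of [simp]: "a \<in> lin X \<Longrightarrow> wire_in (wiring_of X Y \<alpha> \<beta>) a = enc (lout X) (\<alpha> a)"
  by (simp add: wire_in_def wiring_of_def mk_wiring_def)

lemma wire_out_of [simp]: "X \<in> boxes \<Longrightarrow> b \<in> lout Y \<Longrightarrow> wire_out (wiring_of X Y \<alpha> \<beta>) b = \<beta> b"
  by (simp add: wire_out_def wiring_of_def mk_wiring_def)

text \<open>A wire that starts at an input of \<open>X\<close> and ends at an output of
  \<open>X\<close> is finished. One that leads to an input of \<open>Y\<close> is continued by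
  \<open>\<alpha>'\<close>, and if it arrives at an output of \<open>Y\<close>, then
  \<open>\<beta>\<close> names the output of \<open>X\<close> feeding that one. The codiagonal of
  the original formula merges the two kinds of \<open>Inl\<close> result.\<close>

definition cmp_in :: "(nat \<Rightarrow> nat + nat) \<Rightarrow> (nat \<Rightarrow> nat) \<Rightarrow> (nat \<Rightarrow> nat + nat) \<Rightarrow> nat \<Rightarrow> nat + nat" where
  "cmp_in \<alpha> \<beta> \<alpha>' a = (case \<alpha> a of Inl x \<Rightarrow> Inl x | Inr y \<Rightarrow> map_sum \<beta> id (\<alpha>' y))"

lemma wiring_cmp_of:
  assumes boxes: "X \<in> boxes" "Y \<in> boxes" "Z \<in> boxes"
    and ok: "wiring_ok X Y \<alpha> \<beta>" "wiring_ok Y Z \<alpha>' \<beta>'"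
  shows "wiring_cmp (wiring_of Y Z \<alpha>' \<beta>') (wiring_of X Y \<alpha> \<beta>) =
    wiring_of X Z (cmp_in \<alpha> \<beta> \<alpha>') (\<beta> \<circ> \<beta>')"
proof -
  note fin [simp] = boxes_finite[OF boxes(1)] boxes_finite[OF boxes(2)] boxes_finite[OF boxes(3)] boxes
  let ?\<Phi> = "wiring_of X Y \<alpha> \<beta>" and ?\<Psi> = "wiring_of Y Z \<alpha>' \<beta>'"
  let ?in = "fsum (dsum (lout X) (lout X)) (lin Z) (lout X) (nabla (lout X)) id
          \<circ> fsum (lout X) (dsum (lout Y) (lin Z)) (lout X) id
              (fsum (lout Y) (lin Z) (lout X) (wire_out ?\<Phi>) id)
          \<circ> fsum (lout X) (lin Y) (lout X) id (wire_in ?\<Psi>)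
          \<circ> wire_in ?\<Phi>"
  have "?in a = enc (lout X) (cmp_in \<alpha> \<beta> \<alpha>' a)" if a: "a \<in> lin X" for a
    using ok(1) a
  proof (cases rule: wiring_ok_inE)
    case (to_out x)
    then show ?thesis using a by (simp add: cmp_in_def dsumI1)
  next
    case (to_in y)
    from ok(2) to_in(2) show ?thesis
    proof (cases rule: wiring_ok_inE)
      case (to_out x)
      then show ?thesis
        using a to_in wiring_ok_out[OF ok(1), of x] by (simp add: cmp_in_def dsumI1)
    next
      case (to_in z)
      then have "fsum (dsum (lout X) (lout X)) (lin Z) (lout X) (nabla (lout X)) id
          (inr (dsum (lout X) (lout X)) z) = inr (lout X) z" by simp
      then show ?thesis
        using a to_in \<open>y \<in> lin Y\<close> \<open>\<alpha> a = Inr y\<close> by (simp add: cmp_in_def inr_dsum)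
    qed
  qed
  moreover have "(wire_out ?\<Phi> \<circ> wire_out ?\<Psi>) b = (\<beta> \<circ> \<beta>') b" if "b \<in> lout Z" for b
    using that wiring_ok_out[OF ok(2) that] by simp
  ultimately have "copair (lin X) (lout Z) ?in (inl \<circ> (wire_out ?\<Phi> \<circ> wire_out ?\<Psi>)) =
      copair (lin X) (lout Z) (\<lambda>a. enc (lout X) (cmp_in \<alpha> \<beta> \<alpha>' a)) (inl \<circ> (\<beta> \<circ> \<beta>'))"
    by (intro copair_cong) (simp_all only: fin inl_simp o_apply)
  then show ?thesis
    unfolding wiring_cmp_def Let_def wiring_of_simps mk_wiring_def wiring_of_def[of X Z] by (simp only:)
qed

lemma wiring_ok_cmp:
  assumes boxes: "X \<in> boxes" "Y \<in> boxes" "Z \<in> boxes"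
    and ok: "wiring_ok X Y \<alpha> \<beta>" "wiring_ok Y Z \<alpha>' \<beta>'"
  shows "wiring_ok X Z (cmp_in \<alpha> \<beta> \<alpha>') (\<beta> \<circ> \<beta>')"
proof (rule wiring_okI[OF boxes(1,3)])
  \<comment> \<open>In the sum of the two counts the wires of \<open>Y\<close> occur on both sides
    and cancel.\<close>
  show "card (lin X) + card (lout Z) = card (lout X) + card (lin Z)"
    using wiring_ok_card[OF ok(1) boxes(1,2)] wiring_ok_card[OF ok(2) boxes(2,3)] by linarith
  show "cmp_in \<alpha> \<beta> \<alpha>' a \<in> lout X <+> lin Z"
    "case_sum (snd (box_out X)) (snd (box_in Z)) (cmp_in \<alpha> \<beta> \<alpha>' a) = snd (box_in X) a" if a: "a \<in> lin X" for a
  proof -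
    have "cmp_in \<alpha> \<beta> \<alpha>' a \<in> lout X <+> lin Z \<and>
      case_sum (snd (box_out X)) (snd (box_in Z)) (cmp_in \<alpha> \<beta> \<alpha>' a) = snd (box_in X) a"
      using ok(1) a
    proof (cases rule: wiring_ok_inE)
      case (to_out x)
      then show ?thesis using wiring_ok_type_in[OF ok(1) a] by (simp add: cmp_in_def InlI)
    next
      case (to_in y)
      from ok(2) to_in(2) show ?thesis
        using to_in wiring_ok_type_in[OF ok(1) a] wiring_ok_type_in[OF ok(2) to_in(2)]
          wiring_ok_out[OF ok(1)] wiring_ok_type_out[OF ok(1)]
        by (cases rule: wiring_ok_inE) (auto simp: cmp_in_def)
    qed
    then show "cmp_in \<alpha> \<beta> \<alpha>' a \<in> lout X <+> lin Z"
      "case_sum (snd (box_out X)) (snd (box_in Z)) (cmp_in \<alpha> \<beta> \<alpha>' a) = snd (box_in X) a" by simp_all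
  qed
  show "(\<beta> \<circ> \<beta>') b \<in> lout X" "snd (box_out X) ((\<beta> \<circ> \<beta>') b) = snd (box_out Z) b" if "b \<in> lout Z" for b
    using that wiring_ok_out[OF ok(2) that] wiring_ok_type_out[OF ok(2) that]
      wiring_ok_out[OF ok(1)] wiring_ok_type_out[OF ok(1)] by simp_all
  show "\<exists>a\<in>lin X. cmp_in \<alpha> \<beta> \<alpha>' a = Inr z" if z: "z \<in> lin Z" for z
  proof -
    obtain y where y: "y \<in> lin Y" "\<alpha>' y = Inr z" using wiring_ok_surj_in[OF ok(2) z] .
    obtain a where a: "a \<in> lin X" "\<alpha> a = Inr y" using wiring_ok_surj_in[OF ok(1) y(1)] .
    show ?thesis using a y by (intro bexI[of _ a]) (simp_all add: cmp_in_def)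
  qed
  show "(\<exists>a\<in>lin X. cmp_in \<alpha> \<beta> \<alpha>' a = Inl x) \<or> (\<exists>b\<in>lout Z. (\<beta> \<circ> \<beta>') b = x)" if "x \<in> lout X" for x
    using ok(1) that
  proof (cases rule: wiring_ok_surj_out)
    case (in_wire a)
    then show ?thesis by (intro disjI1 bexI[of _ a]) (simp_all add: cmp_in_def)
  next
    \<comment> \<open>The output \<open>x\<close> feeds the output \<open>y\<close> of
      \<open>Y\<close>. Either \<open>y\<close> is fed back to an input of \<open>Y\<close>, which
      is traced back to an input of \<open>X\<close>, or \<open>y\<close> feeds an output of
      \<open>Z\<close>.\<close>
    case (out_wire y)
    from ok(2) out_wire(1) show ?thesis
    proof (cases rule: wiring_ok_surj_out)
      case (in_wire c)
      obtain a where a: "a \<in> lin X" "\<alpha> a = Inr c" using wiring_ok_surj_in[OF ok(1) in_wire(1)] .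
      show ?thesis
        using a in_wire out_wire by (intro disjI1 bexI[of _ a]) (simp_all add: cmp_in_def)
    next
      case (out_wire b)
      then show ?thesis using \<open>\<beta> y = x\<close> by (intro disjI2 bexI[of _ b]) simp_all
    qed
  qed
qed

lemma wiring_id_of: "wiring_id X = wiring_of X X Inr id"
  by (simp add: wiring_id_def wiring_of_def mk_wiring_def swap_def o_def inl_def[abs_def])

lemma wiring_ok_id: "X \<in> boxes \<Longrightarrow> wiring_ok X X Inr id"
  by (rule wiring_okI) auto

definition sum_in :: "box \<Rightarrow> box \<Rightarrow> box \<Rightarrow> (nat \<Rightarrow> nat + nat) \<Rightarrow> (nat \<Rightarrow> nat + nat) \<Rightarrow> nat \<Rightarrow> nat + nat" where
  "sum_in X Y X' \<alpha> \<alpha>' =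
     copair (lin X) (lin X') \<alpha> (map_sum (inr (lout X)) (inr (lin Y)) \<circ> \<alpha>')"

definition sum_out :: "box \<Rightarrow> box \<Rightarrow> box \<Rightarrow> (nat \<Rightarrow> nat) \<Rightarrow> (nat \<Rightarrow> nat) \<Rightarrow> nat \<Rightarrow> nat" where
  "sum_out X Y Y' \<beta> \<beta>' = copair (lout Y) (lout Y') \<beta> (inr (lout X) \<circ> \<beta>')"

lemma sum_in_simps [simp]:
  "a \<in> lin X \<Longrightarrow> sum_in X Y X' \<alpha> \<alpha>' a = \<alpha> a"
  "X \<in> boxes \<Longrightarrow> a \<in> lin X' \<Longrightarrow> sum_in X Y X' \<alpha> \<alpha>' (inr (lin X) a) = map_sum (inr (lout X)) (inr (lin Y)) (\<alpha>' a)"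
  by (simp_all add: sum_in_def)

lemma sum_out_simps [simp]:
  "b \<in> lout Y \<Longrightarrow> sum_out X Y Y' \<beta> \<beta>' b = \<beta> b"
  "Y \<in> boxes \<Longrightarrow> b \<in> lout Y' \<Longrightarrow> sum_out X Y Y' \<beta> \<beta>' (inr (lout Y) b) = inr (lout X) (\<beta>' b)"
  by (simp_all add: sum_out_def)

lemma wiring_sum_of:
  assumes boxes: "X \<in> boxes" "Y \<in> boxes" "X' \<in> boxes" "Y' \<in> boxes"
    and ok: "wiring_ok X Y \<alpha> \<beta>" "wiring_ok X' Y' \<alpha>' \<beta>'"
  shows "wiring_sum (wiring_of X Y \<alpha> \<beta>) (wiring_of X' Y' \<alpha>' \<beta>') =
    wiring_of (box_sum X X') (box_sum Y Y') (sum_in X Y X' \<alpha> \<alpha>') (sum_out X Y Y' \<beta> \<beta>')"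
proof -
  note [simp] = boxes
  let ?\<phi> = "copair (lin X) (lout Y) (\<lambda>a. enc (lout X) (\<alpha> a)) (inl \<circ> \<beta>)"
  let ?\<phi>' = "copair (lin X') (lout Y') (\<lambda>a. enc (lout X') (\<alpha>' a)) (inl \<circ> \<beta>')"
  let ?D = "dsum (dsum (lin X) (lin X')) (dsum (lout Y) (lout Y'))"
  let ?I = "interchange (lout X) (lin Y) (lout X') (lin Y')"
  let ?L = "\<lambda>x. ?I (fsum (dsum (lin X) (lout Y)) (dsum (lin X') (lout Y')) (dsum (lout X) (lin Y)) ?\<phi> ?\<phi>'
            (interchange (lin X) (lin X') (lout Y) (lout Y') x))"
  let ?R = "copair (dsum (lin X) (lin X')) (dsum (lout Y) (lout Y'))
     (\<lambda>a. enc (dsum (lout X) (lout X')) (sum_in X Y X' \<alpha> \<alpha>' a)) (inl \<circ> sum_out X Y Y' \<beta> \<beta>')"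
  have "restrict ?L ?D = ?R"
  proof (rule extensional_dsum_eqI)
    fix a assume a: "a \<in> dsum (lin X) (lin X')"
    then have "?L a = enc (dsum (lout X) (lout X')) (sum_in X Y X' \<alpha> \<alpha>' a)"
    proof (cases rule: dsumE)
      case inl
      from ok(1) inl show ?thesis
      proof (cases rule: wiring_ok_inE)
        case (to_out x)
        then show ?thesis using inl by (simp add: dsumI1)
      next
        case (to_in y)
        then show ?thesis using inl by (simp add: dsumI1)
      qed
    next
      case (inr c)
      from ok(2) inr(1) show ?thesis
      proof (cases rule: wiring_ok_inE)
        case (to_out x)
        then show ?thesis using inr by (simp add: dsumI1)
      next
        case (to_in y)
        then show ?thesis using inr by (simp add: dsumI1)
      qed
    qed
    then show "restrict ?L ?D a = ?R a" using a by (simp add: dsumI1)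
  next
    fix b assume b: "b \<in> dsum (lout Y) (lout Y')"
    then have "?L (inr (dsum (lin X) (lin X')) b) = sum_out X Y Y' \<beta> \<beta>' b"
    proof (cases rule: dsumE)
      case inl
      with wiring_ok_out[OF ok(1) inl] show ?thesis by (simp add: dsumI1)
    next
      case (inr c)
      with wiring_ok_out[OF ok(2) inr(1)] show ?thesis by (simp add: dsumI1)
    qed
    then show "restrict ?L ?D (inr (dsum (lin X) (lin X')) b) = ?R (inr (dsum (lin X) (lin X')) b)"
      using b by simp
  qed simp_all
  then show ?thesis
    by (simp add: wiring_sum_def wiring_of_def mk_wiring_def)
qed

lemma wiring_ok_sum:
  assumes boxes: "X \<in> boxes" "Y \<in> boxes" "X' \<in> boxes" "Y' \<in> boxes"
    and ok: "wiring_ok X Y \<alpha> \<beta>" "wiring_ok X' Y' \<alpha>' \<beta>'"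
  shows "wiring_ok (box_sum X X') (box_sum Y Y') (sum_in X Y X' \<alpha> \<alpha>') (sum_out X Y Y' \<beta> \<beta>')"
proof (rule wiring_okI)
  note [simp] = boxes
  show "box_sum X X' \<in> boxes" "box_sum Y Y' \<in> boxes" by simp_all
  show "card (lin (box_sum X X')) + card (lout (box_sum Y Y')) =
      card (lout (box_sum X X')) + card (lin (box_sum Y Y'))"
    using wiring_ok_card[OF ok(1)] wiring_ok_card[OF ok(2)] by (simp add: card_dsum)
  fix a assume "a \<in> lin (box_sum X X')"
  then have a: "a \<in> dsum (lin X) (lin X')" by simp
  then have "sum_in X Y X' \<alpha> \<alpha>' a \<in> lout (box_sum X X') <+> lin (box_sum Y Y') \<and>
    case_sum (snd (box_out (box_sum X X'))) (snd (box_in (box_sum Y Y'))) (sum_in X Y X' \<alpha> \<alpha>' a) =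
      snd (box_in (box_sum X X')) a"
  proof (cases rule: dsumE)
    case inl
    from ok(1) inl show ?thesis
      using inl wiring_ok_type_in[OF ok(1) inl] by (cases rule: wiring_ok_inE) (auto simp: dsumI1)
  next
    case (inr c)
    from ok(2) inr(1) show ?thesis
      using inr wiring_ok_type_in[OF ok(2) inr(1)] by (cases rule: wiring_ok_inE) (auto simp: dsumI1)
  qed
  then show "sum_in X Y X' \<alpha> \<alpha>' a \<in> lout (box_sum X X') <+> lin (box_sum Y Y')"
    "case_sum (snd (box_out (box_sum X X'))) (snd (box_in (box_sum Y Y'))) (sum_in X Y X' \<alpha> \<alpha>' a) =
      snd (box_in (box_sum X X')) a" by blast+
next
  note [simp] = boxes
  fix b assume "b \<in> lout (box_sum Y Y')"
  then have b: "b \<in> dsum (lout Y) (lout Y')" by simp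
  then have "sum_out X Y Y' \<beta> \<beta>' b \<in> lout (box_sum X X') \<and>
    snd (box_out (box_sum X X')) (sum_out X Y Y' \<beta> \<beta>' b) = snd (box_out (box_sum Y Y')) b"
  proof (cases rule: dsumE)
    case inl
    then show ?thesis
      using wiring_ok_out[OF ok(1) inl] wiring_ok_type_out[OF ok(1) inl] by (simp add: dsumI1)
  next
    case (inr c)
    then show ?thesis
      using wiring_ok_out[OF ok(2) inr(1)] wiring_ok_type_out[OF ok(2) inr(1)] by simp
  qed
  then show "sum_out X Y Y' \<beta> \<beta>' b \<in> lout (box_sum X X')"
    "snd (box_out (box_sum X X')) (sum_out X Y Y' \<beta> \<beta>' b) = snd (box_out (box_sum Y Y')) b" by blast+
next
  note [simp] = boxes
  fix y assume "y \<in> lin (box_sum Y Y')"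
  then have "y \<in> dsum (lin Y) (lin Y')" by simp
  then show "\<exists>a\<in>lin (box_sum X X'). sum_in X Y X' \<alpha> \<alpha>' a = Inr y"
  proof (cases rule: dsumE)
    case inl
    obtain a where "a \<in> lin X" "\<alpha> a = Inr y" using wiring_ok_surj_in[OF ok(1) inl] .
    then show ?thesis by (intro bexI[of _ a]) (simp_all add: dsumI1)
  next
    case (inr c)
    obtain a where "a \<in> lin X'" "\<alpha>' a = Inr c" using wiring_ok_surj_in[OF ok(2) inr(1)] .
    then show ?thesis using inr by (intro bexI[of _ "inr (lin X) a"]) simp_all
  qed
next
  note [simp] = boxes
  fix x assume "x \<in> lout (box_sum X X')"
  then have "x \<in> dsum (lout X) (lout X')" by simp
  then show "(\<exists>a\<in>lin (box_sum X X'). sum_in X Y X' \<alpha> \<alpha>' a = Inl x) \<or>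
      (\<exists>b\<in>lout (box_sum Y Y'). sum_out X Y Y' \<beta> \<beta>' b = x)"
  proof (cases rule: dsumE)
    case inl
    from ok(1) inl show ?thesis
    proof (cases rule: wiring_ok_surj_out)
      case (in_wire a)
      then show ?thesis by (intro disjI1 bexI[of _ a]) (simp_all add: dsumI1)
    next
      case (out_wire b)
      then show ?thesis by (intro disjI2 bexI[of _ b]) (simp_all add: dsumI1)
    qed
  next
    case (inr c)
    from ok(2) inr(1) show ?thesis
    proof (cases rule: wiring_ok_surj_out)
      case (in_wire a)
      then show ?thesis using inr by (intro disjI1 bexI[of _ "inr (lin X) a"]) simp_all
    next
      case (out_wire b)
      then show ?thesis using inr by (intro disjI2 bexI[of _ "inr (lout Y) b"]) simp_all
    qed
  qed
qed

lemma wiring_braid_of: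
  assumes "X \<in> boxes" "Y \<in> boxes"
  shows "wiring_braid X Y =
    wiring_of (box_sum X Y) (box_sum Y X) (Inr \<circ> swap (lin X) (lin Y)) (swap (lout Y) (lout X))"
  by (simp add: wiring_braid_def wiring_of_def o_def)

lemma wiring_ok_braid:
  assumes boxes: "X \<in> boxes" "Y \<in> boxes"
  shows "wiring_ok (box_sum X Y) (box_sum Y X) (Inr \<circ> swap (lin X) (lin Y)) (swap (lout Y) (lout X))"
proof (rule wiring_okI)
  note [simp] = boxes
  show "box_sum X Y \<in> boxes" "box_sum Y X \<in> boxes" by simp_all
  show "card (lin (box_sum X Y)) + card (lout (box_sum Y X)) = card (lout (box_sum X Y)) + card (lin (box_sum Y X))"
    by (simp add: card_dsum)
  fix a assume "a \<in> lin (box_sum X Y)"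
  then have "a \<in> dsum (lin X) (lin Y)" by simp
  then have "swap (lin X) (lin Y) a \<in> dsum (lin Y) (lin X) \<and>
      snd (tsum (box_in Y) (box_in X)) (swap (lin X) (lin Y) a) = snd (tsum (box_in X) (box_in Y)) a"
    by (cases rule: dsumE) (simp_all add: dsumI1)
  then show "(Inr \<circ> swap (lin X) (lin Y)) a \<in> lout (box_sum X Y) <+> lin (box_sum Y X)"
    "case_sum (snd (box_out (box_sum X Y))) (snd (box_in (box_sum Y X))) ((Inr \<circ> swap (lin X) (lin Y)) a) =
      snd (box_in (box_sum X Y)) a" by auto
next
  note [simp] = boxes
  fix b assume "b \<in> lout (box_sum Y X)"
  then have "b \<in> dsum (lout Y) (lout X)" by simp
  then have "swap (lout Y) (lout X) b \<in> dsum (lout X) (lout Y) \<and>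
      snd (tsum (box_out X) (box_out Y)) (swap (lout Y) (lout X) b) = snd (tsum (box_out Y) (box_out X)) b"
    by (cases rule: dsumE) (simp_all add: dsumI1)
  then show "swap (lout Y) (lout X) b \<in> lout (box_sum X Y)"
    "snd (box_out (box_sum X Y)) (swap (lout Y) (lout X) b) = snd (box_out (box_sum Y X)) b" by auto
next
  note [simp] = boxes
  fix y assume "y \<in> lin (box_sum Y X)"
  then have "y \<in> dsum (lin Y) (lin X)" by simp
  then have "swap (lin Y) (lin X) y \<in> dsum (lin X) (lin Y) \<and> swap (lin X) (lin Y) (swap (lin Y) (lin X) y) = y"
    by (cases rule: dsumE) (simp_all add: dsumI1)
  then show "\<exists>a\<in>lin (box_sum X Y). (Inr \<circ> swap (lin X) (lin Y)) a = Inr y"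
    by (intro bexI[of _ "swap (lin Y) (lin X) y"]) simp_all
next
  note [simp] = boxes
  fix x assume "x \<in> lout (box_sum X Y)"
  then have "x \<in> dsum (lout X) (lout Y)" by simp
  then have "swap (lout X) (lout Y) x \<in> dsum (lout Y) (lout X) \<and> swap (lout Y) (lout X) (swap (lout X) (lout Y) x) = x"
    by (cases rule: dsumE) (simp_all add: dsumI1)
  then show "(\<exists>a\<in>lin (box_sum X Y). (Inr \<circ> swap (lin X) (lin Y)) a = Inl x) \<or>
      (\<exists>b\<in>lout (box_sum Y X). swap (lout Y) (lout X) b = x)"
    by (intro disjI2 bexI[of _ "swap (lout X) (lout Y) x"]) simp_all
qed

subsection \<open>The symmetric monoidal structure\<close>

lemma WD_simps [simp]:
  "obs WD = boxes" "hom WD = wirings" "ident WD = wiring_id" "cmp WD = wiring_cmp"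
  "tens WD = box_sum" "tensm WD = wiring_sum" "tunit WD = box_unit"
  "assoc WD = (\<lambda>X Y Z. wiring_id (box_sum (box_sum X Y) Z))"
  "lunit WD = wiring_id" "runit WD = wiring_id" "braid WD = wiring_braid"
  by (simp_all add: WD_def boxes_def)

lemma wiring_id_hom: "X \<in> boxes \<Longrightarrow> wiring_id X \<in> wirings X X"
  unfolding wiring_id_of by (intro wiring_of_wirings wiring_ok_id)

lemma wiring_cmp_hom:
  assumes "X \<in> boxes" "Y \<in> boxes" "Z \<in> boxes" "\<Phi> \<in> wirings X Y" "\<Psi> \<in> wirings Y Z"
  shows "wiring_cmp \<Psi> \<Phi> \<in> wirings X Z"
proof -
  obtain \<alpha> \<beta> where \<Phi>: "\<Phi> = wiring_of X Y \<alpha> \<beta>" "wiring_ok X Y \<alpha> \<beta>"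
    using wirings_cases[OF assms(4,1,2)] .
  obtain \<alpha>' \<beta>' where \<Psi>: "\<Psi> = wiring_of Y Z \<alpha>' \<beta>'" "wiring_ok Y Z \<alpha>' \<beta>'"
    using wirings_cases[OF assms(5,2,3)] .
  show ?thesis
    unfolding \<Phi>(1) \<Psi>(1) wiring_cmp_of[OF assms(1-3) \<Phi>(2) \<Psi>(2)]
    by (rule wiring_of_wirings[OF assms(1,3) wiring_ok_cmp[OF assms(1-3) \<Phi>(2) \<Psi>(2)]])
qed

lemma wiring_cmp_id_left:
  assumes "X \<in> boxes" "Y \<in> boxes" "\<Phi> \<in> wirings X Y"
  shows "wiring_cmp (wiring_id Y) \<Phi> = \<Phi>"
proof -
  obtain \<alpha> \<beta> where \<Phi>: "\<Phi> = wiring_of X Y \<alpha> \<beta>" "wiring_ok X Y \<alpha> \<beta>"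
    using wirings_cases[OF assms(3,1,2)] .
  have "cmp_in \<alpha> \<beta> Inr = \<alpha>" by (auto simp: cmp_in_def fun_eq_iff split: sum.split)
  then show ?thesis
    unfolding \<Phi>(1) wiring_id_of
      wiring_cmp_of[OF assms(1,2,2) \<Phi>(2) wiring_ok_id[OF assms(2)]] by simp
qed

lemma wiring_cmp_id_right:
  assumes "X \<in> boxes" "Y \<in> boxes" "\<Phi> \<in> wirings X Y"
  shows "wiring_cmp \<Phi> (wiring_id X) = \<Phi>"
proof -
  obtain \<alpha> \<beta> where \<Phi>: "\<Phi> = wiring_of X Y \<alpha> \<beta>" "wiring_ok X Y \<alpha> \<beta>"
    using wirings_cases[OF assms(3,1,2)] .
  have "cmp_in Inr id \<alpha> = \<alpha>" by (auto simp: cmp_in_def fun_eq_iff map_sum.id)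
  then show ?thesis
    unfolding \<Phi>(1) wiring_id_of
      wiring_cmp_of[OF assms(1,1,2) wiring_ok_id[OF assms(1)] \<Phi>(2)] by simp
qed

lemma wiring_cmp_assoc:
  assumes boxes: "W \<in> boxes" "X \<in> boxes" "Y \<in> boxes" "Z \<in> boxes"
    and hom: "\<Phi> \<in> wirings W X" "\<Psi> \<in> wirings X Y" "\<Omega> \<in> wirings Y Z"
  shows "wiring_cmp \<Omega> (wiring_cmp \<Psi> \<Phi>) = wiring_cmp (wiring_cmp \<Omega> \<Psi>) \<Phi>"
proof -
  obtain \<alpha> \<beta> where \<Phi>: "\<Phi> = wiring_of W X \<alpha> \<beta>" "wiring_ok W X \<alpha> \<beta>"
    using wirings_cases[OF hom(1) boxes(1,2)] .
  obtain \<alpha>' \<beta>' where \<Psi>: "\<Psi> = wiring_of X Y \<alpha>' \<beta>'" "wiring_ok X Y \<alpha>' \<beta>'"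
    using wirings_cases[OF hom(2) boxes(2,3)] .
  obtain \<alpha>'' \<beta>'' where \<Omega>: "\<Omega> = wiring_of Y Z \<alpha>'' \<beta>''" "wiring_ok Y Z \<alpha>'' \<beta>''"
    using wirings_cases[OF hom(3) boxes(3,4)] .
  have "cmp_in (cmp_in \<alpha> \<beta> \<alpha>') (\<beta> \<circ> \<beta>') \<alpha>'' a = cmp_in \<alpha> \<beta> (cmp_in \<alpha>' \<beta>' \<alpha>'') a" for a
  proof (cases "\<alpha> a")
    case (Inr y)
    then show ?thesis
      by (cases "\<alpha>' y") (simp_all add: cmp_in_def sum.map_comp)
  qed (simp add: cmp_in_def)
  then have "cmp_in (cmp_in \<alpha> \<beta> \<alpha>') (\<beta> \<circ> \<beta>') \<alpha>'' = cmp_in \<alpha> \<beta> (cmp_in \<alpha>' \<beta>' \<alpha>'')" by blast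
  then show ?thesis
    unfolding \<Phi>(1) \<Psi>(1) \<Omega>(1) wiring_cmp_of[OF boxes(1-3) \<Phi>(2) \<Psi>(2)] wiring_cmp_of[OF boxes(2-4) \<Psi>(2) \<Omega>(2)]
      wiring_cmp_of[OF boxes(1,3,4) wiring_ok_cmp[OF boxes(1-3) \<Phi>(2) \<Psi>(2)] \<Omega>(2)]
      wiring_cmp_of[OF boxes(1,2,4) \<Phi>(2) wiring_ok_cmp[OF boxes(2-4) \<Psi>(2) \<Omega>(2)]]
    by (simp add: o_assoc)
qed

lemma wiring_sum_hom:
  assumes "X \<in> boxes" "X' \<in> boxes" "Y \<in> boxes" "Y' \<in> boxes" "\<Phi> \<in> wirings X X'" "\<Psi> \<in> wirings Y Y'"
  shows "wiring_sum \<Phi> \<Psi> \<in> wirings (box_sum X Y) (box_sum X' Y')"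
proof -
  obtain \<alpha> \<beta> where \<Phi>: "\<Phi> = wiring_of X X' \<alpha> \<beta>" "wiring_ok X X' \<alpha> \<beta>"
    using wirings_cases[OF assms(5,1,2)] .
  obtain \<alpha>' \<beta>' where \<Psi>: "\<Psi> = wiring_of Y Y' \<alpha>' \<beta>'" "wiring_ok Y Y' \<alpha>' \<beta>'"
    using wirings_cases[OF assms(6,3,4)] .
  show ?thesis
    unfolding \<Phi>(1) \<Psi>(1) wiring_sum_of[OF assms(1-4) \<Phi>(2) \<Psi>(2)]
    by (rule wiring_of_wirings[OF _ _ wiring_ok_sum[OF assms(1-4) \<Phi>(2) \<Psi>(2)]]) (simp_all add: assms)
qed

lemma wiring_sum_id:
  assumes "X \<in> boxes" "Y \<in> boxes"
  shows "wiring_sum (wiring_id X) (wiring_id Y) = wiring_id (box_sum X Y)"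
  unfolding wiring_id_of wiring_sum_of[OF assms(1,1,2,2) wiring_ok_id[OF assms(1)] wiring_ok_id[OF assms(2)]]
proof (rule wiring_of_cong)
  show "box_sum X Y \<in> boxes" using assms by simp
  show "sum_in X X Y Inr Inr a = Inr a" if "a \<in> lin (box_sum X Y)" for a
  proof -
    have "a \<in> dsum (lin X) (lin Y)" using that by simp
    then show ?thesis by (cases rule: dsumE) (simp_all add: assms)
  qed
  show "sum_out X X Y id id b = id b" if "b \<in> lout (box_sum X Y)" for b
  proof -
    have "b \<in> dsum (lout X) (lout Y)" using that by simp
    then show ?thesis by (cases rule: dsumE) (simp_all add: assms)
  qed
qed

lemma wiring_sum_cmp:
  assumes boxes: "X \<in> boxes" "X' \<in> boxes" "X'' \<in> boxes" "Y \<in> boxes" "Y' \<in> boxes" "Y'' \<in> boxes"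
    and hom: "\<Phi> \<in> wirings X X'" "\<Phi>' \<in> wirings X' X''" "\<Psi> \<in> wirings Y Y'" "\<Psi>' \<in> wirings Y' Y''"
  shows "wiring_sum (wiring_cmp \<Phi>' \<Phi>) (wiring_cmp \<Psi>' \<Psi>) = wiring_cmp (wiring_sum \<Phi>' \<Psi>') (wiring_sum \<Phi> \<Psi>)"
proof -
  note [simp] = boxes
  obtain \<alpha> \<beta> where \<Phi>: "\<Phi> = wiring_of X X' \<alpha> \<beta>" "wiring_ok X X' \<alpha> \<beta>"
    using wirings_cases[OF hom(1) boxes(1,2)] .
  obtain \<alpha>' \<beta>' where \<Phi>': "\<Phi>' = wiring_of X' X'' \<alpha>' \<beta>'" "wiring_ok X' X'' \<alpha>' \<beta>'"
    using wirings_cases[OF hom(2) boxes(2,3)] .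
  obtain \<gamma> \<delta> where \<Psi>: "\<Psi> = wiring_of Y Y' \<gamma> \<delta>" "wiring_ok Y Y' \<gamma> \<delta>"
    using wirings_cases[OF hom(3) boxes(4,5)] .
  obtain \<gamma>' \<delta>' where \<Psi>': "\<Psi>' = wiring_of Y' Y'' \<gamma>' \<delta>'" "wiring_ok Y' Y'' \<gamma>' \<delta>'"
    using wirings_cases[OF hom(4) boxes(5,6)] .
  have sums: "box_sum X Y \<in> boxes" "box_sum X' Y' \<in> boxes" "box_sum X'' Y'' \<in> boxes" by simp_all
  let ?in = "sum_in X X' Y \<alpha> \<gamma>" and ?out = "sum_out X X' Y' \<beta> \<delta>"
  let ?in' = "sum_in X' X'' Y' \<alpha>' \<gamma>'" and ?out' = "sum_out X' X'' Y'' \<beta>' \<delta>'"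
  have "wiring_of (box_sum X Y) (box_sum X'' Y'')
      (sum_in X X'' Y (cmp_in \<alpha> \<beta> \<alpha>') (cmp_in \<gamma> \<delta> \<gamma>')) (sum_out X X'' Y'' (\<beta> \<circ> \<beta>') (\<delta> \<circ> \<delta>')) =
    wiring_of (box_sum X Y) (box_sum X'' Y'') (cmp_in ?in ?out ?in') (?out \<circ> ?out')"
  proof (rule wiring_of_cong[OF sums(1)])
    fix a assume "a \<in> lin (box_sum X Y)"
    then have "a \<in> dsum (lin X) (lin Y)" by simp
    then show "sum_in X X'' Y (cmp_in \<alpha> \<beta> \<alpha>') (cmp_in \<gamma> \<delta> \<gamma>') a = cmp_in ?in ?out ?in' a"
    proof (cases rule: dsumE)
      case inl
      from \<Phi>(2) inl show ?thesis
      proof (cases rule: wiring_ok_inE)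
        case (to_out x)
        then show ?thesis using inl by (simp add: cmp_in_def)
      next
        case (to_in y)
        from \<Phi>'(2) to_in(2) show ?thesis
          by (cases rule: wiring_ok_inE) (use inl to_in in \<open>simp_all add: cmp_in_def\<close>)
      qed
    next
      case (inr c)
      from \<Psi>(2) inr(1) show ?thesis
      proof (cases rule: wiring_ok_inE)
        case (to_out x)
        then show ?thesis using inr by (simp add: cmp_in_def)
      next
        case (to_in y)
        from \<Psi>'(2) to_in(2) show ?thesis
          by (cases rule: wiring_ok_inE) (use inr to_in in \<open>simp_all add: cmp_in_def\<close>)
      qed
    qed
  next
    fix b assume "b \<in> lout (box_sum X'' Y'')"
    then have "b \<in> dsum (lout X'') (lout Y'')" by simp
    then show "sum_out X X'' Y'' (\<beta> \<circ> \<beta>') (\<delta> \<circ> \<delta>') b = (?out \<circ> ?out') b"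
      by (cases rule: dsumE) (simp_all add: wiring_ok_out[OF \<Phi>'(2)] wiring_ok_out[OF \<Psi>'(2)])
  qed
  then show ?thesis
    unfolding \<Phi>(1) \<Phi>'(1) \<Psi>(1) \<Psi>'(1)
      wiring_cmp_of[OF boxes(1-3) \<Phi>(2) \<Phi>'(2)] wiring_cmp_of[OF boxes(4-6) \<Psi>(2) \<Psi>'(2)]
      wiring_sum_of[OF boxes(1,2,4,5) \<Phi>(2) \<Psi>(2)] wiring_sum_of[OF boxes(2,3,5,6) \<Phi>'(2) \<Psi>'(2)]
      wiring_sum_of[OF boxes(1,3,4,6) wiring_ok_cmp[OF boxes(1-3) \<Phi>(2) \<Phi>'(2)]
        wiring_ok_cmp[OF boxes(4-6) \<Psi>(2) \<Psi>'(2)]]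
      wiring_cmp_of[OF sums wiring_ok_sum[OF boxes(1,2,4,5) \<Phi>(2) \<Psi>(2)]
        wiring_ok_sum[OF boxes(2,3,5,6) \<Phi>'(2) \<Psi>'(2)]] .
qed

text \<open>The rule for the second summand, restated with the nested shifts that
  \<open>inr_dsum\<close> produces, so that it matches after simplification.\<close>

lemma sum_in_dsum:
  assumes "X \<in> boxes" "Y \<in> boxes" "a \<in> lin Z"
  shows "sum_in (box_sum X Y) V Z \<alpha> \<alpha>' (inr (lin X) (inr (lin Y) a)) =
     map_sum (inr (lout X) \<circ> inr (lout Y)) (inr (lin V)) (\<alpha>' a)"
proof -
  have "inr (lout (box_sum X Y)) = inr (lout X) \<circ> inr (lout Y)"
    using assms by (simp add: fun_eq_iff inr_dsum)
  then show ?thesis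
    using sum_in_simps(2)[of "box_sum X Y" a Z V \<alpha> \<alpha>'] assms by (simp add: inr_dsum)
qed

lemma sum_out_dsum:
  assumes "X \<in> boxes" "Y \<in> boxes" "b \<in> lout Z"
  shows "sum_out V (box_sum X Y) Z \<beta> \<beta>' (inr (lout X) (inr (lout Y) b)) = inr (lout V) (\<beta>' b)"
  using sum_out_simps(2)[of "box_sum X Y" b Z V \<beta> \<beta>'] assms by (simp add: inr_dsum)

text \<open>An equation and not only an isomorphism: by \<open>box_sum_assoc\<close> both sides run
  between the same boxes, and shifts past a union are composed shifts.\<close>

lemma wiring_sum_assoc:
  assumes boxes: "X \<in> boxes" "X' \<in> boxes" "Y \<in> boxes" "Y' \<in> boxes" "Z \<in> boxes" "Z' \<in> boxes"
    and hom: "\<Phi> \<in> wirings X X'" "\<Psi> \<in> wirings Y Y'" "\<Omega> \<in> wirings Z Z'"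
  shows "wiring_sum (wiring_sum \<Phi> \<Psi>) \<Omega> = wiring_sum \<Phi> (wiring_sum \<Psi> \<Omega>)"
proof -
  note [simp] = boxes
  obtain \<alpha> \<beta> where \<Phi>: "\<Phi> = wiring_of X X' \<alpha> \<beta>" "wiring_ok X X' \<alpha> \<beta>"
    using wirings_cases[OF hom(1) boxes(1,2)] .
  obtain \<gamma> \<delta> where \<Psi>: "\<Psi> = wiring_of Y Y' \<gamma> \<delta>" "wiring_ok Y Y' \<gamma> \<delta>"
    using wirings_cases[OF hom(2) boxes(3,4)] .
  obtain \<zeta> \<eta> where \<Omega>: "\<Omega> = wiring_of Z Z' \<zeta> \<eta>" "wiring_ok Z Z' \<zeta> \<eta>"
    using wirings_cases[OF hom(3) boxes(5,6)] .
  have sums: "box_sum X Y \<in> boxes" "box_sum X' Y' \<in> boxes" "box_sum Y Z \<in> boxes" "box_sum Y' Z' \<in> boxes"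
    "box_sum X (box_sum Y Z) \<in> boxes" by simp_all
  let ?in = "sum_in (box_sum X Y) (box_sum X' Y') Z (sum_in X X' Y \<alpha> \<gamma>) \<zeta>"
  let ?in' = "sum_in X X' (box_sum Y Z) \<alpha> (sum_in Y Y' Z \<gamma> \<zeta>)"
  let ?out = "sum_out (box_sum X Y) (box_sum X' Y') Z' (sum_out X X' Y' \<beta> \<delta>) \<eta>"
  let ?out' = "sum_out X X' (box_sum Y' Z') \<beta> (sum_out Y Y' Z' \<delta> \<eta>)"
  have "wiring_of (box_sum X (box_sum Y Z)) (box_sum X' (box_sum Y' Z')) ?in ?out =
    wiring_of (box_sum X (box_sum Y Z)) (box_sum X' (box_sum Y' Z')) ?in' ?out'"
  proof (rule wiring_of_cong[OF sums(5)])
    fix a assume "a \<in> lin (box_sum X (box_sum Y Z))"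
    then have "a \<in> dsum (lin X) (dsum (lin Y) (lin Z))" by simp
    then show "?in a = ?in' a"
    proof (cases rule: dsumE)
      case inl
      then show ?thesis by (simp add: dsumI1)
    next
      case (inr c)
      from inr(1) show ?thesis
      proof (cases rule: dsumE)
        case inl
        then show ?thesis using inr by (simp add: dsumI1)
      next
        case (inr d)
        then show ?thesis using \<open>a = inr (lin X) c\<close>
          by (cases "\<zeta> d") (simp_all add: sum_in_dsum inr_dsum)
      qed
    qed
  next
    fix b assume "b \<in> lout (box_sum X' (box_sum Y' Z'))"
    then have "b \<in> dsum (lout X') (dsum (lout Y') (lout Z'))" by simp
    then show "?out b = ?out' b"
    proof (cases rule: dsumE)
      case inl
      then show ?thesis by (simp add: dsumI1)
    next
      case (inr c)
      from inr(1) show ?thesis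
      proof (cases rule: dsumE)
        case inl
        then show ?thesis using inr by (simp add: dsumI1)
      next
        case (inr d)
        then show ?thesis using \<open>b = inr (lout X') c\<close> by (simp add: sum_out_dsum inr_dsum)
      qed
    qed
  qed
  then show ?thesis
    unfolding \<Phi>(1) \<Psi>(1) \<Omega>(1) wiring_sum_of[OF boxes(1-4) \<Phi>(2) \<Psi>(2)] wiring_sum_of[OF boxes(3-6) \<Psi>(2) \<Omega>(2)]
      wiring_sum_of[OF sums(1,2) boxes(5,6) wiring_ok_sum[OF boxes(1-4) \<Phi>(2) \<Psi>(2)] \<Omega>(2)]
      wiring_sum_of[OF boxes(1,2) sums(3,4) \<Phi>(2) wiring_ok_sum[OF boxes(3-6) \<Psi>(2) \<Omega>(2)]]
      box_sum_assoc[OF boxes(1,3,5)] box_sum_assoc[OF boxes(2,4,6)] .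
qed

lemma tempty_fst [simp]: "fst tempty = {}"
  by (simp add: tempty_def)

lemma wiring_sum_unit:
  assumes "X \<in> boxes" "Y \<in> boxes" "\<Phi> \<in> wirings X Y"
  shows "wiring_sum (wiring_id box_unit) \<Phi> = \<Phi>" "wiring_sum \<Phi> (wiring_id box_unit) = \<Phi>"
proof -
  note [simp] = assms(1,2)
  obtain \<alpha> \<beta> where \<Phi>: "\<Phi> = wiring_of X Y \<alpha> \<beta>" "wiring_ok X Y \<alpha> \<beta>"
    using wirings_cases[OF assms(3,1,2)] .
  note id = wiring_ok_id[OF box_unit_boxes]
  have "wiring_of X Y (sum_in box_unit box_unit X Inr \<alpha>) (sum_out box_unit box_unit Y id \<beta>) = wiring_of X Y \<alpha> \<beta>"
  proof (rule wiring_of_cong[OF assms(1)])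
    \<comment> \<open>Shifting past the empty set is the identity, so the rule for the second
      summand applies to \<open>a\<close> itself.\<close>
    show "sum_in box_unit box_unit X Inr \<alpha> a = \<alpha> a" if "a \<in> lin X" for a
      using sum_in_simps(2)[OF box_unit_boxes that, of box_unit Inr \<alpha>] by (cases "\<alpha> a") simp_all
    show "sum_out box_unit box_unit Y id \<beta> b = \<beta> b" if "b \<in> lout Y" for b
      using sum_out_simps(2)[OF box_unit_boxes that, of box_unit id \<beta>] by simp
  qed
  then show "wiring_sum (wiring_id box_unit) \<Phi> = \<Phi>"
    unfolding \<Phi>(1) wiring_id_of wiring_sum_of[OF box_unit_boxes box_unit_boxes assms(1,2) id \<Phi>(2)]
      box_sum_unit[OF assms(1)] box_sum_unit[OF assms(2)] .
  have "wiring_of X Y (sum_in X Y box_unit \<alpha> Inr) (sum_out X Y box_unit \<beta> id) = wiring_of X Y \<alpha> \<beta>"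
    by (rule wiring_of_cong[OF assms(1)]) simp_all
  then show "wiring_sum \<Phi> (wiring_id box_unit) = \<Phi>"
    unfolding \<Phi>(1) wiring_id_of wiring_sum_of[OF assms(1,2) box_unit_boxes box_unit_boxes \<Phi>(2) id]
      box_sum_unit[OF assms(1)] box_sum_unit[OF assms(2)] .
qed

lemma wiring_braid_hom:
  assumes "X \<in> boxes" "Y \<in> boxes"
  shows "wiring_braid X Y \<in> wirings (box_sum X Y) (box_sum Y X)"
  unfolding wiring_braid_of[OF assms]
  using assms by (intro wiring_of_wirings wiring_ok_braid) simp_all

lemma wiring_braid_braid:
  assumes "X \<in> boxes" "Y \<in> boxes"
  shows "wiring_cmp (wiring_braid Y X) (wiring_braid X Y) = wiring_id (box_sum X Y)"
proof -
  note [simp] = assms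
  have sums: "box_sum X Y \<in> boxes" "box_sum Y X \<in> boxes" by simp_all
  show ?thesis
    unfolding wiring_braid_of[OF assms] wiring_braid_of[OF assms(2,1)] wiring_id_of
      wiring_cmp_of[OF sums(1,2,1) wiring_ok_braid[OF assms] wiring_ok_braid[OF assms(2,1)]]
  proof (rule wiring_of_cong[OF sums(1)])
    fix a assume "a \<in> lin (box_sum X Y)"
    then have "a \<in> dsum (lin X) (lin Y)" by simp
    then show "cmp_in (Inr \<circ> swap (lin X) (lin Y)) (swap (lout Y) (lout X)) (Inr \<circ> swap (lin Y) (lin X)) a = Inr a"
      by (cases rule: dsumE) (simp_all add: cmp_in_def)
  next
    fix b assume "b \<in> lout (box_sum X Y)"
    then have "b \<in> dsum (lout X) (lout Y)" by simp
    then show "(swap (lout Y) (lout X) \<circ> swap (lout X) (lout Y)) b = id b"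
      by (cases rule: dsumE) simp_all
  qed
qed

lemma wiring_braid_natural:
  assumes boxes: "X \<in> boxes" "X' \<in> boxes" "Y \<in> boxes" "Y' \<in> boxes"
    and hom: "\<Phi> \<in> wirings X X'" "\<Psi> \<in> wirings Y Y'"
  shows "wiring_cmp (wiring_braid X' Y') (wiring_sum \<Phi> \<Psi>) = wiring_cmp (wiring_sum \<Psi> \<Phi>) (wiring_braid X Y)"
proof -
  note [simp] = boxes
  have sums: "box_sum X Y \<in> boxes" "box_sum X' Y' \<in> boxes" "box_sum Y X \<in> boxes" "box_sum Y' X' \<in> boxes"
    by simp_all
  obtain \<alpha> \<beta> where \<Phi>: "\<Phi> = wiring_of X X' \<alpha> \<beta>" "wiring_ok X X' \<alpha> \<beta>"
    using wirings_cases[OF hom(1) boxes(1,2)] .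
  obtain \<gamma> \<delta> where \<Psi>: "\<Psi> = wiring_of Y Y' \<gamma> \<delta>" "wiring_ok Y Y' \<gamma> \<delta>"
    using wirings_cases[OF hom(2) boxes(3,4)] .
  note ok = wiring_ok_sum[OF boxes \<Phi>(2) \<Psi>(2)] wiring_ok_sum[OF boxes(3,4,1,2) \<Psi>(2) \<Phi>(2)]
    wiring_ok_braid[OF boxes(1,3)] wiring_ok_braid[OF boxes(2,4)]
  show ?thesis
    unfolding \<Phi>(1) \<Psi>(1) wiring_braid_of[OF boxes(1,3)] wiring_braid_of[OF boxes(2,4)]
      wiring_sum_of[OF boxes \<Phi>(2) \<Psi>(2)] wiring_sum_of[OF boxes(3,4,1,2) \<Psi>(2) \<Phi>(2)]
      wiring_cmp_of[OF sums(1,2,4) ok(1,4)] wiring_cmp_of[OF sums(1,3,4) ok(3,2)]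
  proof (rule wiring_of_cong[OF sums(1)])
    fix a assume "a \<in> lin (box_sum X Y)"
    then have "a \<in> dsum (lin X) (lin Y)" by simp
    then show "cmp_in (sum_in X X' Y \<alpha> \<gamma>) (sum_out X X' Y' \<beta> \<delta>) (Inr \<circ> swap (lin X') (lin Y')) a =
        cmp_in (Inr \<circ> swap (lin X) (lin Y)) (swap (lout Y) (lout X)) (sum_in Y Y' X \<gamma> \<alpha>) a"
    proof (cases rule: dsumE)
      case inl
      from \<Phi>(2) inl show ?thesis
        by (cases rule: wiring_ok_inE) (use inl in \<open>simp_all add: cmp_in_def\<close>)
    next
      case (inr c)
      from \<Psi>(2) inr(1) show ?thesis
        by (cases rule: wiring_ok_inE) (use inr in \<open>simp_all add: cmp_in_def\<close>)
    qed
  next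
    fix b assume "b \<in> lout (box_sum Y' X')"
    then have "b \<in> dsum (lout Y') (lout X')" by simp
    then show "(sum_out X X' Y' \<beta> \<delta> \<circ> swap (lout Y') (lout X')) b =
        (swap (lout Y) (lout X) \<circ> sum_out Y Y' X' \<delta> \<beta>) b"
      by (cases rule: dsumE) (simp_all add: wiring_ok_out[OF \<Phi>(2)] wiring_ok_out[OF \<Psi>(2)])
  qed
qed

text \<open>The hexagon after its identity associators have been removed: moving \<open>X\<close>
  past \<open>Y\<close> and \<open>Z\<close> at once is moving it past one after the other.\<close>

lemma wiring_hexagon:
  assumes boxes: "X \<in> boxes" "Y \<in> boxes" "Z \<in> boxes"
  shows "wiring_braid X (box_sum Y Z) =
    wiring_cmp (wiring_sum (wiring_id Y) (wiring_braid X Z)) (wiring_sum (wiring_braid X Y) (wiring_id Z))"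
proof -
  note [simp] = boxes
  have sums: "box_sum X Y \<in> boxes" "box_sum Y X \<in> boxes" "box_sum X Z \<in> boxes" "box_sum Z X \<in> boxes"
    "box_sum Y Z \<in> boxes" "box_sum X (box_sum Y Z) \<in> boxes" "box_sum Y (box_sum X Z) \<in> boxes"
    "box_sum Y (box_sum Z X) \<in> boxes"
    by simp_all
  \<comment> \<open>Reassociated in advance, since the composite is formed only after
    \<open>box_sum_assoc\<close> has made the middle boxes syntactically equal.\<close>
  note ok1 = wiring_ok_sum[OF sums(1,2) boxes(3,3) wiring_ok_braid[OF boxes(1,2)] wiring_ok_id[OF boxes(3)],
      unfolded box_sum_assoc[OF boxes(1,2,3)] box_sum_assoc[OF boxes(2,1,3)]]
  note ok2 = wiring_ok_sum[OF boxes(2,2) sums(3,4) wiring_ok_id[OF boxes(2)] wiring_ok_braid[OF boxes(1,3)]]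
  let ?in = "sum_in (box_sum X Y) (box_sum Y X) Z (Inr \<circ> swap (lin X) (lin Y)) Inr"
  let ?out = "sum_out (box_sum X Y) (box_sum Y X) Z (swap (lout Y) (lout X)) id"
  let ?in' = "sum_in Y Y (box_sum X Z) Inr (Inr \<circ> swap (lin X) (lin Z))"
  let ?out' = "sum_out Y Y (box_sum Z X) id (swap (lout Z) (lout X))"
  show ?thesis
    unfolding wiring_id_of wiring_braid_of[OF boxes(1,2)] wiring_braid_of[OF boxes(1,3)]
      wiring_braid_of[OF boxes(1) sums(5)]
      wiring_sum_of[OF sums(1,2) boxes(3,3) wiring_ok_braid[OF boxes(1,2)] wiring_ok_id[OF boxes(3)]]
      wiring_sum_of[OF boxes(2,2) sums(3,4) wiring_ok_id[OF boxes(2)] wiring_ok_braid[OF boxes(1,3)]]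
      box_sum_assoc[OF boxes(1,2,3)] box_sum_assoc[OF boxes(2,1,3)] box_sum_assoc[OF boxes(2,3,1)]
      wiring_cmp_of[OF sums(6,7,8) ok1 ok2]
  proof (rule wiring_of_cong[OF sums(6)])
    fix a assume "a \<in> lin (box_sum X (box_sum Y Z))"
    then have "a \<in> dsum (lin X) (dsum (lin Y) (lin Z))" by simp
    then show "(Inr \<circ> swap (lin X) (lin (box_sum Y Z))) a = cmp_in ?in ?out ?in' a"
    proof (cases rule: dsumE)
      case inl
      then show ?thesis by (simp add: cmp_in_def dsumI1 inr_dsum)
    next
      case (inr c)
      from inr(1) show ?thesis
      proof (cases rule: dsumE)
        case inl
        then show ?thesis using inr by (simp add: cmp_in_def dsumI1)
      next
        case (inr d)
        then show ?thesis using \<open>a = inr (lin X) c\<close>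
          by (simp add: cmp_in_def sum_in_dsum inr_dsum)
      qed
    qed
  next
    fix b assume "b \<in> lout (box_sum Y (box_sum Z X))"
    then have "b \<in> dsum (lout Y) (dsum (lout Z) (lout X))" by simp
    then show "swap (lout (box_sum Y Z)) (lout X) b = (?out \<circ> ?out') b"
    proof (cases rule: dsumE)
      case inl
      then show ?thesis by (simp add: dsumI1)
    next
      case (inr c)
      from inr(1) show ?thesis
      proof (cases rule: dsumE)
        case inl
        then show ?thesis using inr by (simp add: dsumI1 sum_out_dsum inr_dsum)
      next
        case (inr d)
        then have "swap (dsum (lout Y) (lout Z)) (lout X) (inr (dsum (lout Y) (lout Z)) d) = d" by simp
        then show ?thesis using inr \<open>b = inr (lout Y) c\<close> by (simp add: dsumI1 inr_dsum)
      qed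
    qed
  qed
qed

section \<open>The axioms of a symmetric monoidal category\<close>

lemma cat_WD: "cat WD"
  by standard (auto simp: wiring_id_hom wiring_cmp_hom wiring_cmp_id_left wiring_cmp_id_right
      intro: wiring_cmp_assoc)

lemma is_iso_wiring_id: "X \<in> boxes \<Longrightarrow> X = Y \<Longrightarrow> is_iso WD X Y (wiring_id X)"
  unfolding is_iso_def WD_simps
  by (auto simp: wiring_id_hom wiring_cmp_id_left intro!: bexI[of _ "wiring_id X"])

text \<open>All structural isomorphisms are identity diagrams. Pentagon and triangle thus reduce to
  composites and sums of identities, and naturality reduces to the strict laws for
  \<open>wiring_sum\<close>.\<close>

lemma monoidal_cat_WD: "monoidal_cat WD"
proof (intro monoidal_cat.intro cat_WD monoidal_cat_axioms.intro; unfold WD_simps)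
  show "box_unit \<in> boxes" by simp
  show "box_sum X Y \<in> boxes" if "X \<in> boxes" "Y \<in> boxes" for X Y using that by simp
  show "is_iso WD (box_sum (box_sum X Y) Z) (box_sum X (box_sum Y Z)) (wiring_id (box_sum (box_sum X Y) Z))"
    if "X \<in> boxes" "Y \<in> boxes" "Z \<in> boxes" for X Y Z
    using that by (intro is_iso_wiring_id) (simp_all add: box_sum_assoc)
  show "is_iso WD (box_sum box_unit X) X (wiring_id X)" "is_iso WD (box_sum X box_unit) X (wiring_id X)"
    if "X \<in> boxes" for X
    using that is_iso_wiring_id[of X X] by (simp_all add: box_sum_unit)
  show "wiring_cmp (wiring_id (box_sum (box_sum X' Y') Z')) (wiring_sum (wiring_sum f g) h) =
      wiring_cmp (wiring_sum f (wiring_sum g h)) (wiring_id (box_sum (box_sum X Y) Z))"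
    if "X \<in> boxes" "X' \<in> boxes" "Y \<in> boxes" "Y' \<in> boxes" "Z \<in> boxes" "Z' \<in> boxes"
      "f \<in> wirings X X'" "g \<in> wirings Y Y'" "h \<in> wirings Z Z'" for X X' Y Y' Z Z' f g h
  proof -
    have hom: "wiring_sum (wiring_sum f g) h \<in> wirings (box_sum (box_sum X Y) Z) (box_sum (box_sum X' Y') Z')"
      using that by (intro wiring_sum_hom) simp_all
    show ?thesis
      using wiring_cmp_id_left[OF _ _ hom] wiring_cmp_id_right[OF _ _ hom] that
      by (simp add: wiring_sum_assoc[of X X' Y Y' Z Z' f g h])
  qed
  show "wiring_cmp (wiring_id Y) (wiring_sum (wiring_id box_unit) f) = wiring_cmp f (wiring_id X)"
    "wiring_cmp (wiring_id Y) (wiring_sum f (wiring_id box_unit)) = wiring_cmp f (wiring_id X)"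
    if "X \<in> boxes" "Y \<in> boxes" "f \<in> wirings X Y" for X Y f
    using that wiring_cmp_id_left[OF that] wiring_cmp_id_right[OF that] wiring_sum_unit[OF that] by simp_all
  show "wiring_cmp (wiring_id (box_sum (box_sum W X) (box_sum Y Z)))
      (wiring_id (box_sum (box_sum (box_sum W X) Y) Z)) =
      wiring_cmp (wiring_sum (wiring_id W) (wiring_id (box_sum (box_sum X Y) Z)))
       (wiring_cmp (wiring_id (box_sum (box_sum W (box_sum X Y)) Z))
         (wiring_sum (wiring_id (box_sum (box_sum W X) Y)) (wiring_id Z)))"
    if "W \<in> boxes" "X \<in> boxes" "Y \<in> boxes" "Z \<in> boxes" for W X Y Z
  proof -
    have B: "box_sum W (box_sum X (box_sum Y Z)) \<in> boxes" using that by simp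
    show ?thesis
      using that wiring_cmp_id_left[OF B B wiring_id_hom[OF B]]
      by (simp add: wiring_sum_id box_sum_assoc)
  qed
  show "wiring_cmp (wiring_sum (wiring_id X) (wiring_id Y)) (wiring_id (box_sum (box_sum X box_unit) Y)) =
      wiring_sum (wiring_id X) (wiring_id Y)" if "X \<in> boxes" "Y \<in> boxes" for X Y
  proof -
    have B: "box_sum X Y \<in> boxes" using that by simp
    show ?thesis
      using that wiring_cmp_id_left[OF B B wiring_id_hom[OF B]] by (simp add: wiring_sum_id box_sum_unit)
  qed
qed (simp_all add: wiring_sum_hom wiring_sum_id wiring_sum_cmp)

lemma symmetric_monoidal_cat_WD: "symmetric_monoidal_cat WD"
proof (intro symmetric_monoidal_cat.intro monoidal_cat_WD symmetric_monoidal_cat_axioms.intro; unfold WD_simps)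
  show "wiring_cmp (wiring_id (box_sum (box_sum Y Z) X))
      (wiring_cmp (wiring_braid X (box_sum Y Z)) (wiring_id (box_sum (box_sum X Y) Z))) =
    wiring_cmp (wiring_sum (wiring_id Y) (wiring_braid X Z))
      (wiring_cmp (wiring_id (box_sum (box_sum Y X) Z)) (wiring_sum (wiring_braid X Y) (wiring_id Z)))"
    if XYZ: "X \<in> boxes" "Y \<in> boxes" "Z \<in> boxes" for X Y Z
  proof -
    have hom: "wiring_braid X (box_sum Y Z) \<in> wirings (box_sum X (box_sum Y Z)) (box_sum (box_sum Y Z) X)"
      "wiring_sum (wiring_braid X Y) (wiring_id Z) \<in> wirings (box_sum (box_sum X Y) Z) (box_sum (box_sum Y X) Z)"
      using XYZ by (simp_all add: wiring_braid_hom wiring_sum_hom wiring_id_hom)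
    have "wiring_cmp (wiring_braid X (box_sum Y Z)) (wiring_id (box_sum (box_sum X Y) Z)) =
        wiring_braid X (box_sum Y Z)"
      using wiring_cmp_id_right[OF _ _ hom(1)] XYZ by (simp add: box_sum_assoc)
    then show ?thesis
      using wiring_cmp_id_left[OF _ _ hom(1)] wiring_cmp_id_left[OF _ _ hom(2)] wiring_hexagon[OF XYZ] XYZ
      by simp
  qed
qed (simp_all add: wiring_braid_hom wiring_braid_braid wiring_braid_natural)

section \<open>The algebra of open systems\<close>

text \<open>From here on dependent products are treated as manifolds in their own right, and folded
  terms keep the facts about them applicable.\<close>

declare dprod_simps [simp del]

abbreviation pts :: "tfs \<Rightarrow> (nat \<Rightarrow> real) set" where
  "pts S \<equiv> points (dprod S)"

lemma pts_eq: "pts S = (\<Pi>\<^sub>E a\<in>fst S. points (snd S a))"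
  by (simp add: dprod_simps)

lemma pts_extensional: "x \<in> pts S \<Longrightarrow> x \<in> extensional (fst S)"
  by (simp add: pts_eq PiE_iff)

lemma boxes_TFS [simp]: "X \<in> boxes \<Longrightarrow> box_in X \<in> TFS" "X \<in> boxes \<Longrightarrow> box_out X \<in> TFS"
  by (auto simp: boxes_def)

lemma restrict_Times_eqI:
  "(\<And>s u. s \<in> A \<Longrightarrow> u \<in> B \<Longrightarrow> f (s, u) = g (s, u)) \<Longrightarrow> restrict f (A \<times> B) = restrict g (A \<times> B)"
  by (rule restrict_ext) auto

lemma G_ob_iff:
  assumes "X \<in> boxes"
  shows "(S, fin, fout) \<in> G_ob X \<longleftrightarrow> S \<in> TFS \<and>
    fin \<in> extensional (pts S \<times> pts (box_in X)) \<and> fout \<in> extensional (pts S) \<and>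
    smooth_map (mprod (dprod S) (dprod (box_in X))) (tangent_bundle (dprod S)) fin \<and>
    smooth_map (dprod S) (dprod (box_out X)) fout \<and>
    (\<forall>s\<in>pts S. \<forall>u\<in>pts (box_in X). fst (fin (s, u)) = s \<and> snd (fin (s, u)) \<in> tangent_space (dprod S) s)"
  using assms unfolding G_ob_def open_system_def
  by (auto simp: is_manifold_dprod mem_Times_iff)

lemma G_obD:
  assumes "(S, fin, fout) \<in> G_ob X" "X \<in> boxes"
  shows "S \<in> TFS" "fin \<in> extensional (pts S \<times> pts (box_in X))" "fout \<in> extensional (pts S)"
    "smooth_map (mprod (dprod S) (dprod (box_in X))) (tangent_bundle (dprod S)) fin"
    "smooth_map (dprod S) (dprod (box_out X)) fout"
    "\<And>s u. s \<in> pts S \<Longrightarrow> u \<in> pts (box_in X) \<Longrightarrow> fst (fin (s, u)) = s"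
    "\<And>s u. s \<in> pts S \<Longrightarrow> u \<in> pts (box_in X) \<Longrightarrow> snd (fin (s, u)) \<in> tangent_space (dprod S) s"
    "\<And>s. s \<in> pts S \<Longrightarrow> fout s \<in> pts (box_out X)"
  using assms(1) continuous_map_image_subset_topspace[OF smooth_map_continuous, of "dprod S" "dprod (box_out X)" fout]
  unfolding G_ob_iff[OF assms(2)] by blast+

lemma G_ob_cases:
  assumes "a \<in> G_ob X"
  obtains S fin fout where "a = (S, fin, fout)" "(S, fin, fout) \<in> G_ob X"
  using assms by (cases a) auto

lemma smooth_map_dprod_cong:
  assumes "charted M" "smooth_map M (dprod S) F" "S \<in> TFS" "\<And>m. m \<in> points M \<Longrightarrow> F m = F' m"
  shows "smooth_map M (dprod S) F'"
  by (rule smooth_map_cong[OF assms(1,2) charted_open[OF charted_dprod[OF assms(3)]] assms(4)])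

subsection \<open>Functoriality\<close>

text \<open>The induced map of dependent products in the sum-type form: input \<open>a\<close> reads
  the value carried by the wire \<open>\<alpha> a\<close>, taken from the outputs \<open>u\<close>
  of \<open>X\<close> or the inputs \<open>y\<close> of \<open>Y\<close>.\<close>

definition reroute_in :: "box \<Rightarrow> (nat \<Rightarrow> nat + nat) \<Rightarrow> (nat \<Rightarrow> 'b) \<Rightarrow> (nat \<Rightarrow> 'b) \<Rightarrow> nat \<Rightarrow> 'b" where
  "reroute_in X \<alpha> u y = (\<lambda>a\<in>lin X. case_sum u y (\<alpha> a))"

definition reroute_out :: "box \<Rightarrow> (nat \<Rightarrow> nat) \<Rightarrow> (nat \<Rightarrow> 'b) \<Rightarrow> nat \<Rightarrow> 'b" where
  "reroute_out Y \<beta> u = (\<lambda>b\<in>lout Y. u (\<beta> b))"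

lemma G_map_of:
  assumes "X \<in> boxes" "Y \<in> boxes" "wiring_ok X Y \<alpha> \<beta>"
  shows "G_map (wiring_of X Y \<alpha> \<beta>) (S, fin, fout) =
    (S, \<lambda>(s, y)\<in>pts S \<times> pts (box_in Y). fin (s, reroute_in X \<alpha> (fout s) y),
     \<lambda>s\<in>pts S. reroute_out Y \<beta> (fout s))"
proof -
  have "dmap (lin X) (wire_in (wiring_of X Y \<alpha> \<beta>)) (copair (lout X) (lin Y) u y) = reroute_in X \<alpha> u y" for u y :: "nat \<Rightarrow> real"
    unfolding dmap_def reroute_in_def
  proof (rule restrict_ext)
    fix a assume "a \<in> lin X"
    with assms(3) show "copair (lout X) (lin Y) u y (wire_in (wiring_of X Y \<alpha> \<beta>) a) = case_sum u y (\<alpha> a)"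
      by (cases rule: wiring_ok_inE) (use assms(1) \<open>a \<in> lin X\<close> in simp_all)
  qed
  moreover have "dmap (lout Y) (wire_out (wiring_of X Y \<alpha> \<beta>)) u = reroute_out Y \<beta> u" for u :: "nat \<Rightarrow> real"
    unfolding dmap_def reroute_out_def by (rule restrict_ext) (simp add: assms(1))
  ultimately show ?thesis by (simp add: G_map_def Let_def)
qed

lemma reroute_in_pts:
  assumes "wiring_ok X Y \<alpha> \<beta>" "u \<in> pts (box_out X)" "y \<in> pts (box_in Y)"
  shows "reroute_in X \<alpha> u y \<in> pts (box_in X)"
proof -
  have "case_sum u y (\<alpha> a) \<in> points (snd (box_in X) a)" if a: "a \<in> lin X" for a
    using assms(1) a
  proof (cases rule: wiring_ok_inE)
    case (to_out x)
    then show ?thesis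
      using PiE_mem[OF assms(2)[unfolded pts_eq] to_out(2)] wiring_ok_type_in[OF assms(1) a] by simp
  next
    case (to_in x)
    then show ?thesis
      using PiE_mem[OF assms(3)[unfolded pts_eq] to_in(2)] wiring_ok_type_in[OF assms(1) a] by simp
  qed
  then show ?thesis by (simp add: pts_eq reroute_in_def)
qed

text \<open>Each new coordinate is a coordinate of \<open>fout\<close> or of the outer input, and
  preservation of types makes its manifold the right one. The state is carried along in the first
  map so that a vector field can be composed with it.\<close>

lemma smooth_map_reroute:
  assumes X: "X \<in> boxes" and Y: "Y \<in> boxes" and S: "S \<in> TFS" and ok: "wiring_ok X Y \<alpha> \<beta>"
    and fout: "smooth_map (dprod S) (dprod (box_out X)) fout"
  shows "smooth_map (mprod (dprod S) (dprod (box_in Y))) (mprod (dprod S) (dprod (box_in X)))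
      (\<lambda>p. (fst p, reroute_in X \<alpha> (fout (fst p)) (snd p)))"
    "smooth_map (dprod S) (dprod (box_out Y)) (\<lambda>s. reroute_out Y \<beta> (fout s))"
proof -
  note [simp] = X Y S
  have ch: "charted (dprod T)" "is_manifold (dprod T)" if "T \<in> TFS" for T
    using that by (simp_all add: charted_dprod is_manifold_dprod)
  have Q: "charted (mprod (dprod S) (dprod (box_in Y)))" by (simp add: charted_mprod ch)
  have coord: "smooth_map (dprod S) (snd (box_out X) x) (\<lambda>s. fout s x)" if "x \<in> lout X" for x
    by (rule smooth_map_compose[OF ch(1) ch(1) fout smooth_map_dprod_coord])
       (simp_all add: that charted_open TFS_charted)
  show "smooth_map (mprod (dprod S) (dprod (box_in Y))) (mprod (dprod S) (dprod (box_in X)))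
      (\<lambda>p. (fst p, reroute_in X \<alpha> (fout (fst p)) (snd p)))"
  proof (rule smooth_map_mprodI; simp only: fst_conv snd_conv)
    show fst: "smooth_map (mprod (dprod S) (dprod (box_in Y))) (dprod S) fst"
      by (simp add: smooth_map_fst ch)
    show "smooth_map (mprod (dprod S) (dprod (box_in Y))) (dprod (box_in X))
        (\<lambda>p. reroute_in X \<alpha> (fout (fst p)) (snd p))"
    proof (rule smooth_map_dprodI)
      fix a assume a: "a \<in> lin X"
      show "smooth_map (mprod (dprod S) (dprod (box_in Y))) (snd (box_in X) a)
          (\<lambda>p. reroute_in X \<alpha> (fout (fst p)) (snd p) a)"
        using ok a
      proof (cases rule: wiring_ok_inE)
        case (to_out x)
        have "smooth_map (mprod (dprod S) (dprod (box_in Y))) (snd (box_out X) x) (\<lambda>p. fout (fst p) x)"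
          by (rule smooth_map_compose[OF Q ch(1) fst coord]) (simp_all add: to_out charted_open TFS_charted)
        then show ?thesis
          using to_out a wiring_ok_type_in[OF ok a] by (simp add: reroute_in_def)
      next
        case (to_in y)
        have "smooth_map (mprod (dprod S) (dprod (box_in Y))) (dprod (box_in Y)) snd"
          by (simp add: smooth_map_snd ch)
        from smooth_map_compose[OF Q ch(1) this smooth_map_dprod_coord]
        have "smooth_map (mprod (dprod S) (dprod (box_in Y))) (snd (box_in Y) y) (\<lambda>p. snd p y)"
          by (simp add: to_in charted_open TFS_charted)
        then show ?thesis
          using to_in a wiring_ok_type_in[OF ok a] by (simp add: reroute_in_def)
      qed
    qed (simp add: reroute_in_def)
  qed
  show "smooth_map (dprod S) (dprod (box_out Y)) (\<lambda>s. reroute_out Y \<beta> (fout s))"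
  proof (rule smooth_map_dprodI)
    show "smooth_map (dprod S) (snd (box_out Y) b) (\<lambda>s. reroute_out Y \<beta> (fout s) b)" if b: "b \<in> lout Y" for b
      using coord[OF wiring_ok_out[OF ok b]] wiring_ok_type_out[OF ok b] b by (simp add: reroute_out_def)
  qed (simp add: reroute_out_def)
qed

lemma G_map_into:
  assumes X: "X \<in> boxes" and Y: "Y \<in> boxes" and \<Phi>: "\<Phi> \<in> wirings X Y" and a: "a \<in> G_ob X"
  shows "G_map \<Phi> a \<in> G_ob Y"
proof -
  note [simp] = X Y
  obtain \<alpha> \<beta> where \<Phi>: "\<Phi> = wiring_of X Y \<alpha> \<beta>" and ok: "wiring_ok X Y \<alpha> \<beta>"
    using wirings_cases[OF \<Phi> X Y] .
  obtain S fin fout where a: "a = (S, fin, fout)" "(S, fin, fout) \<in> G_ob X" using G_ob_cases[OF a] .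
  note f = G_obD[OF a(2) X]
  have [simp]: "S \<in> TFS" by (rule f(1))
  let ?F = "\<lambda>p. fin (fst p, reroute_in X \<alpha> (fout (fst p)) (snd p))"
  have ch: "charted (dprod T)" if "T \<in> TFS" for T using that by (rule charted_dprod)
  have Q: "charted (mprod (dprod S) (dprod T))" if "T \<in> TFS" for T using that by (simp add: charted_mprod ch)
  have mem: "reroute_in X \<alpha> (fout s) y \<in> pts (box_in X)" if "s \<in> pts S" "y \<in> pts (box_in Y)" for s y
    using reroute_in_pts[OF ok f(8)[OF that(1)] that(2)] .
  have "smooth_map (mprod (dprod S) (dprod (box_in Y))) (tangent_bundle (dprod S)) ?F"
    by (rule smooth_map_compose[OF Q Q smooth_map_reroute(1)[OF X Y f(1) ok f(5)] f(4)])
       (simp_all add: openin_tcdom)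
  then have "smooth_map (mprod (dprod S) (dprod (box_in Y))) (tangent_bundle (dprod S))
      (\<lambda>(s, y)\<in>pts S \<times> pts (box_in Y). fin (s, reroute_in X \<alpha> (fout s) y))"
    by (rule smooth_map_cong[OF Q[OF boxes_TFS(1)[OF Y]]]) (auto simp: openin_tcdom)
  moreover have "smooth_map (dprod S) (dprod (box_out Y)) (\<lambda>s\<in>pts S. reroute_out Y \<beta> (fout s))"
    by (rule smooth_map_dprod_cong[OF ch smooth_map_reroute(2)[OF X Y f(1) ok f(5)]]) simp_all
  ultimately show ?thesis
    unfolding \<Phi> a(1) G_map_of[OF X Y ok] G_ob_iff[OF Y] using f mem by simp
qed

lemma reroute_in_id: "y \<in> extensional (lin X) \<Longrightarrow> reroute_in X Inr u y = y"
  by (simp add: reroute_in_def extensional_restrict)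

lemma reroute_out_id: "u \<in> extensional (lout X) \<Longrightarrow> reroute_out X id u = u"
  by (simp add: reroute_out_def extensional_restrict)

lemma G_map_id:
  assumes X: "X \<in> boxes" and a: "a \<in> G_ob X"
  shows "G_map (wiring_id X) a = a"
proof -
  obtain S fin fout where a: "a = (S, fin, fout)" "(S, fin, fout) \<in> G_ob X" using G_ob_cases[OF a] .
  note f = G_obD[OF a(2) X]
  have "(\<lambda>(s, y)\<in>pts S \<times> pts (box_in X). fin (s, reroute_in X Inr (fout s) y)) = restrict fin (pts S \<times> pts (box_in X))"
    by (rule restrict_Times_eqI) (simp add: reroute_in_id pts_extensional)
  moreover have "(\<lambda>s\<in>pts S. reroute_out X id (fout s)) = restrict fout (pts S)"
    by (rule restrict_ext) (simp add: reroute_out_id pts_extensional[OF f(8)])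
  ultimately show ?thesis
    unfolding a(1) wiring_id_of G_map_of[OF X X wiring_ok_id[OF X]] using f(2,3) by (simp add: extensional_restrict)
qed

text \<open>A wire of the composite that passes through \<open>Y\<close> reads what \<open>Y\<close>
  receives after its own rerouting. One pass along the composite therefore equals two passes, where
  the second is given the outputs as \<open>Y\<close> shows them.\<close>

lemma G_map_cmp:
  assumes boxes: "X \<in> boxes" "Y \<in> boxes" "Z \<in> boxes"
    and \<Phi>: "\<Phi> \<in> wirings X Y" and \<Psi>: "\<Psi> \<in> wirings Y Z" and a: "a \<in> G_ob X"
  shows "G_map (wiring_cmp \<Psi> \<Phi>) a = G_map \<Psi> (G_map \<Phi> a)"
proof -
  obtain \<alpha> \<beta> where \<Phi>: "\<Phi> = wiring_of X Y \<alpha> \<beta>" and ok: "wiring_ok X Y \<alpha> \<beta>"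
    using wirings_cases[OF \<Phi> boxes(1,2)] .
  obtain \<alpha>' \<beta>' where \<Psi>: "\<Psi> = wiring_of Y Z \<alpha>' \<beta>'" and ok': "wiring_ok Y Z \<alpha>' \<beta>'"
    using wirings_cases[OF \<Psi> boxes(2,3)] .
  obtain S fin fout where a: "a = (S, fin, fout)" "(S, fin, fout) \<in> G_ob X" using G_ob_cases[OF a] .
  note f = G_obD[OF a(2) boxes(1)]
  \<comment> \<open>The vector field obtained from \<open>\<Phi>\<close> is cut off outside the
    points, so the inputs that \<open>\<Psi>\<close> hands to it must be shown to be points.\<close>
  have out_pts: "reroute_out Y \<beta> (fout s) \<in> pts (box_out Y)" if "s \<in> pts S" for s
    using continuous_map_image_subset_topspace[OF smooth_map_continuous[OF
        smooth_map_reroute(2)[OF boxes(1,2) f(1) ok f(5)]]] that by blast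
  have "reroute_in X (cmp_in \<alpha> \<beta> \<alpha>') u z = reroute_in X \<alpha> u (reroute_in Y \<alpha>' (reroute_out Y \<beta> u) z)"
    for u z :: "nat \<Rightarrow> real"
    unfolding reroute_in_def[of X]
  proof (rule restrict_ext)
    fix a assume a: "a \<in> lin X"
    from ok a show "case_sum u z (cmp_in \<alpha> \<beta> \<alpha>' a) = case_sum u (reroute_in Y \<alpha>' (reroute_out Y \<beta> u) z) (\<alpha> a)"
    proof (cases rule: wiring_ok_inE)
      case (to_out x)
      then show ?thesis by (simp add: cmp_in_def)
    next
      case (to_in y)
      from ok' to_in(2) show ?thesis
        by (cases rule: wiring_ok_inE) (use to_in in \<open>simp_all add: cmp_in_def reroute_in_def reroute_out_def\<close>)
    qed
  qed
  moreover have "reroute_out Z (\<beta> \<circ> \<beta>') u = reroute_out Z \<beta>' (reroute_out Y \<beta> u)" for u :: "nat \<Rightarrow> real"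
    unfolding reroute_out_def[of Z]
    by (rule restrict_ext) (simp add: reroute_out_def wiring_ok_out[OF ok'])
  ultimately show ?thesis
    unfolding \<Phi> \<Psi> a(1) wiring_cmp_of[OF boxes ok ok'] G_map_of[OF boxes(1,3) wiring_ok_cmp[OF boxes ok ok']]
      G_map_of[OF boxes(1,2) ok] G_map_of[OF boxes(2,3) ok']
    by (auto intro!: restrict_Times_eqI restrict_ext simp: reroute_in_pts[OF ok' out_pts])
qed

subsection \<open>Points, charts and tangent vectors of a disjoint union\<close>

text \<open>The second component of \<open>split\<close>; the first is an ordinary restriction,
  because \<open>inl\<close> is an inclusion.\<close>

definition rpart :: "nat set \<Rightarrow> nat set \<Rightarrow> (nat \<Rightarrow> 'b) \<Rightarrow> nat \<Rightarrow> 'b" where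
  "rpart A B x = (\<lambda>b\<in>B. x (inr A b))"

lemma rpart_simps [simp]: "b \<in> B \<Longrightarrow> rpart A B x b = x (inr A b)" "rpart A B x \<in> extensional B"
  by (simp_all add: rpart_def)

lemma split_eq: "split A B x = (restrict x A, rpart A B x)"
  by (simp add: split_def dmap_def rpart_def restrict_def)

lemma ball_tsum:
  assumes "finite (fst S)"
  shows "(\<forall>a\<in>dsum (fst S) (fst T). P a (snd (tsum S T) a)) \<longleftrightarrow>
    (\<forall>a\<in>fst S. P a (snd S a)) \<and> (\<forall>b\<in>fst T. P (inr (fst S) b) (snd T b))"
proof (intro iffI conjI ballI)
  assume *: "\<forall>a\<in>dsum (fst S) (fst T). P a (snd (tsum S T) a)"
  show "P a (snd S a)" if "a \<in> fst S" for a
    using bspec[OF * dsumI1[OF that]] that by simp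
  show "P (inr (fst S) b) (snd T b)" if "b \<in> fst T" for b
    using bspec[OF *, of "inr (fst S) b"] that assms by simp
next
  fix a
  assume *: "(\<forall>a\<in>fst S. P a (snd S a)) \<and> (\<forall>b\<in>fst T. P (inr (fst S) b) (snd T b))"
    and a: "a \<in> dsum (fst S) (fst T)"
  from a show "P a (snd (tsum S T) a)"
    by (cases rule: dsumE) (use * assms in simp_all)
qed

lemma pts_tsum:
  assumes "x \<in> pts (tsum S T)" "S \<in> TFS"
  shows "restrict x (fst S) \<in> pts S" "rpart (fst S) (fst T) x \<in> pts T"
  using assms(1) ball_tsum[OF TFS_finite[OF assms(2)], of T "\<lambda>a M. x a \<in> points M"]
  by (simp_all add: pts_eq PiE_iff)

lemma copair_parts:
  assumes "finite A" "x \<in> extensional (dsum A B)"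
  shows "copair A B (restrict x A) (rpart A B x) = x"
  by (rule extensional_dsum_eqI[OF _ assms(2)]) (simp_all add: assms(1))

lemma charts_at_dprod:
  "k \<in> charts_at (dprod S) x \<longleftrightarrow>
     k \<in> extensional (fst S) \<and> (\<forall>a\<in>fst S. k a \<in> charts (snd S a)) \<and>
     x \<in> extensional (fst S) \<and> (\<forall>a\<in>fst S. x a \<in> cdom (snd S a) (k a))"
  by (auto simp: charts_at_def dprod_simps PiE_iff)

lemma charts_at_tsum:
  assumes "k \<in> charts_at (dprod (tsum S T)) x" "S \<in> TFS"
  shows "restrict k (fst S) \<in> charts_at (dprod S) (restrict x (fst S))"
    "rpart (fst S) (fst T) k \<in> charts_at (dprod T) (rpart (fst S) (fst T) x)"
  using assms(1) ball_tsum[OF TFS_finite[OF assms(2)], of T "\<lambda>a M. k a \<in> charts M"]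
    ball_tsum[OF TFS_finite[OF assms(2)], of T "\<lambda>a M. x a \<in> cdom M (k a)"]
  by (simp_all add: charts_at_dprod)

text \<open>The vector part of \<open>tangent_join\<close> after \<open>tangent_pair\<close> in a
  single formula. The parts of a chart index \<open>k\<close> select the charts in which
  \<open>v\<close> and \<open>w\<close> are read, and the summand containing \<open>a\<close>
  decides which of the two is read.\<close>

definition join_vec where
  "join_vec S T x v w = (\<lambda>k\<in>charts_at (dprod (tsum S T)) x. \<lambda>(a, i)\<in>mindex (dprod (tsum S T)).
     if a \<in> fst S then v (restrict k (fst S)) (a, i) else w (rpart (fst S) (fst T) k) (a - ub (fst S), i))"

lemma tangent_join_pair:
  assumes S: "S \<in> TFS" and x: "x \<in> pts (tsum S T)"
  shows "tangent_join S T (tangent_pair (dprod S) (dprod T)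
      (restrict x (fst S), v) (rpart (fst S) (fst T) x, w)) = (x, join_vec S T x v w)"
proof -
  have fin: "finite (fst S)" using S by (rule TFS_finite)
  have x': "copair (fst S) (fst T) (restrict x (fst S)) (rpart (fst S) (fst T) x) = x"
    using copair_parts[OF fin] pts_extensional[OF x] by simp
  have "(\<lambda>k\<in>charts_at (dprod (tsum S T)) x. \<lambda>(a, i)\<in>mindex (dprod (tsum S T)).
       (\<lambda>(k, l)\<in>charts_at (mprod (dprod S) (dprod T)) (restrict x (fst S), rpart (fst S) (fst T) x).
          \<lambda>i\<in>mindex (dprod S) <+> mindex (dprod T). case_sum (v k) (w l) i)
         (restrict k (fst S), rpart (fst S) (fst T) k)
         (if a \<in> fst S then Inl (a, i) else Inr (a - ub (fst S), i))) = join_vec S T x v w"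
    unfolding join_vec_def
  proof (intro restrict_ext, clarify)
    fix k a i assume k: "k \<in> charts_at (dprod (tsum S T)) x" and ai: "(a, i) \<in> mindex (dprod (tsum S T))"
    \<comment> \<open>Both cut-offs inside \<open>tangent_pair\<close> are evaluated within their
      domains: here for the charts, next for the coordinates.\<close>
    have "(restrict k (fst S), rpart (fst S) (fst T) k) \<in>
        charts_at (mprod (dprod S) (dprod T)) (restrict x (fst S), rpart (fst S) (fst T) x)"
      using charts_at_tsum[OF k S] by (simp add: charts_at_def)
    moreover have "a \<in> dsum (fst S) (fst T)" "i \<in> mindex (snd (tsum S T) a)"
      using ai by (simp_all add: dprod_simps)
    then have "(if a \<in> fst S then Inl (a, i) else Inr (a - ub (fst S), i)) \<in> mindex (dprod S) <+> mindex (dprod T)"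
      using fin by (auto simp: dprod_simps)
    ultimately show "(\<lambda>(k, l)\<in>charts_at (mprod (dprod S) (dprod T)) (restrict x (fst S), rpart (fst S) (fst T) x).
          \<lambda>i\<in>mindex (dprod S) <+> mindex (dprod T). case_sum (v k) (w l) i)
         (restrict k (fst S), rpart (fst S) (fst T) k)
         (if a \<in> fst S then Inl (a, i) else Inr (a - ub (fst S), i)) =
       (if a \<in> fst S then v (restrict k (fst S)) (a, i) else w (rpart (fst S) (fst T) k) (a - ub (fst S), i))"
      by simp
  qed
  then show ?thesis
    unfolding tangent_join_def tangent_pair_def prod.case split_eq x' Let_def by simp
qed

lemma G_mu_of:
  assumes X: "X \<in> boxes" and X': "X' \<in> boxes"
    and f: "(S, fin, fout) \<in> G_ob X" and f': "(S', fin', fout') \<in> G_ob X'"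
  shows "G_mu X X' ((S, fin, fout), (S', fin', fout')) =
    (tsum S S',
     \<lambda>(s, u)\<in>pts (tsum S S') \<times> pts (tsum (box_in X) (box_in X')).
       (s, join_vec S S' s (snd (fin (restrict s (fst S), restrict u (lin X))))
             (snd (fin' (rpart (fst S) (fst S') s, rpart (lin X) (lin X') u)))),
     \<lambda>s\<in>pts (tsum S S').
       copair (lout X) (lout X') (fout (restrict s (fst S))) (fout' (rpart (fst S) (fst S') s)))"
proof -
  note F = G_obD[OF f X] and F' = G_obD[OF f' X']
  let ?g = "system_prod (dprod S) (dprod (box_in X)) (fin, fout) (dprod S') (dprod (box_in X')) (fin', fout')"
  have "tangent_join S S' (fst ?g (split (fst S) (fst S') s, split (lin X) (lin X') u)) =
     (s, join_vec S S' s (snd (fin (restrict s (fst S), restrict u (lin X))))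
             (snd (fin' (rpart (fst S) (fst S') s, rpart (lin X) (lin X') u))))"
    if s: "s \<in> pts (tsum S S')" and u: "u \<in> pts (tsum (box_in X) (box_in X'))" for s u
  proof -
    note s' = pts_tsum[OF s F(1)] and u' = pts_tsum[OF u boxes_TFS(1)[OF X]]
    \<comment> \<open>Vector fields keep the base point, which gives the value the shape that
      \<open>tangent_join_pair\<close> expects.\<close>
    obtain v where v: "fin (restrict s (fst S), restrict u (lin X)) = (restrict s (fst S), v)"
      using F(6)[OF s'(1) u'(1)] by (metis prod.collapse)
    obtain w where w: "fin' (rpart (fst S) (fst S') s, rpart (lin X) (lin X') u) = (rpart (fst S) (fst S') s, w)"
      using F'(6)[OF s'(2) u'(2)] by (metis prod.collapse)
    have "fst ?g (split (fst S) (fst S') s, split (lin X) (lin X') u) =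
        tangent_pair (dprod S) (dprod S') (fin (restrict s (fst S), restrict u (lin X)))
          (fin' (rpart (fst S) (fst S') s, rpart (lin X) (lin X') u))"
      using s' u' by (simp add: system_prod_def split_eq)
    then show ?thesis
      using tangent_join_pair[OF F(1) s, of v w] by (simp add: v w)
  qed
  moreover have "snd ?g (split (fst S) (fst S') s) = (fout (restrict s (fst S)), fout' (rpart (fst S) (fst S') s))"
    if s: "s \<in> pts (tsum S S')" for s
    using pts_tsum[OF s F(1)] by (simp add: system_prod_def split_eq)
  ultimately show ?thesis
    unfolding G_mu_def Let_def prod.case
    by (auto intro!: restrict_Times_eqI restrict_ext)
qed

subsection \<open>The coherence maps\<close>

lemma join_vec_apply:
  assumes "k \<in> charts_at (dprod (tsum S T)) x" "i \<in> mindex (snd (tsum S T) a)"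
  shows "a \<in> fst S \<Longrightarrow> join_vec S T x v w k (a, i) = v (restrict k (fst S)) (a, i)"
    "finite (fst S) \<Longrightarrow> b \<in> fst T \<Longrightarrow> a = inr (fst S) b \<Longrightarrow>
       join_vec S T x v w k (a, i) = w (rpart (fst S) (fst T) k) (b, i)"
  using assms by (simp_all add: join_vec_def dprod_simps dsumI1)

text \<open>By \<open>tangent_space_dprod\<close> the condition at an index concerns its own factor
  only, so it is inherited from \<open>v\<close> or from \<open>w\<close>.\<close>

lemma join_vec_tangent:
  assumes S: "S \<in> TFS" and T: "T \<in> TFS" and x: "x \<in> pts (tsum S T)"
    and v: "v \<in> tangent_space (dprod S) (restrict x (fst S))"
    and w: "w \<in> tangent_space (dprod T) (rpart (fst S) (fst T) x)"
  shows "join_vec S T x v w \<in> tangent_space (dprod (tsum S T)) x"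
proof -
  have fin: "finite (fst S)" using S by (rule TFS_finite)
  let ?R = "tsum S T" and ?j = "join_vec S T x v w"
  have "?j l (b, j) = (\<Sum>i\<in>mindex (snd ?R b).
       pd i (\<lambda>y. cmap (snd ?R b) (l b) (cinv (snd ?R b) (k b) y) j) (cmap (snd ?R b) (k b) (x b)) * ?j k (b, i))"
    if k: "k \<in> charts_at (dprod ?R) x" and l: "l \<in> charts_at (dprod ?R) x"
      and b: "b \<in> dsum (fst S) (fst T)" and j: "j \<in> mindex (snd ?R b)" for k l b j
    using b
  proof (cases rule: dsumE)
    case inl
    then show ?thesis
      using v charts_at_tsum(1)[OF k S] charts_at_tsum(1)[OF l S] j
      unfolding tangent_space_dprod[OF S]
      by (simp add: join_vec_apply(1)[OF k] join_vec_apply(1)[OF l])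
  next
    case (inr c)
    then show ?thesis
      using w charts_at_tsum(2)[OF k S] charts_at_tsum(2)[OF l S] j fin
      unfolding tangent_space_dprod[OF T]
      by (simp add: join_vec_apply(2)[OF k _ fin inr(1) refl] join_vec_apply(2)[OF l _ fin inr(1) refl])
  qed
  moreover have "?j \<in> charts_at (dprod ?R) x \<rightarrow>\<^sub>E (mindex (dprod ?R) \<rightarrow>\<^sub>E UNIV)"
    by (auto simp: join_vec_def)
  ultimately show ?thesis unfolding tangent_space_dprod[OF tsum_TFS[OF S T]] tsum_simps(1) by blast
qed

text \<open>Both projections are induced by the inclusions of the summands, which are typed
  functions.\<close>

lemma smooth_map_parts:
  assumes "S \<in> TFS" "T \<in> TFS"
  shows "smooth_map (dprod (tsum S T)) (dprod S) (\<lambda>x. restrict x (fst S))"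
    "smooth_map (dprod (tsum S T)) (dprod T) (rpart (fst S) (fst T))"
proof -
  have "dmap (fst S) inl = (\<lambda>x :: nat \<Rightarrow> real. restrict x (fst S))"
    by (simp add: dmap_def restrict_def fun_eq_iff)
  moreover have "fst S \<subseteq> dsum (fst S) (fst T)" by (auto intro: dsumI1)
  ultimately show "smooth_map (dprod (tsum S T)) (dprod S) (\<lambda>x. restrict x (fst S))"
    using smooth_map_dmap[of S "tsum S T" inl] assms by (simp add: tsum_TFS)
  have "dmap (fst T) (inr (fst S)) = (rpart (fst S) (fst T) :: (nat \<Rightarrow> real) \<Rightarrow> _)"
    by (simp add: dmap_def rpart_def fun_eq_iff)
  moreover have "inr (fst S) ` fst T \<subseteq> dsum (fst S) (fst T)" using TFS_finite[OF assms(1)] by auto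
  ultimately show "smooth_map (dprod (tsum S T)) (dprod T) (rpart (fst S) (fst T))"
    using smooth_map_dmap[of T "tsum S T" "inr (fst S)"] assms TFS_finite[of S] by (simp add: tsum_TFS)
qed

lemma smooth_map_mprod_map:
  assumes "charted M" "charted N" "is_manifold M" "is_manifold N" "charted M'" "charted N'"
    and F: "smooth_map M M' F" and G: "smooth_map N N' G"
  shows "smooth_map (mprod M N) (mprod M' N') (\<lambda>p. (F (fst p), G (snd p)))"
proof (rule smooth_map_mprodI; simp only: fst_conv snd_conv)
  show "smooth_map (mprod M N) M' (\<lambda>p. F (fst p))"
    by (rule smooth_map_compose[OF charted_mprod[OF assms(1,2)] assms(1) smooth_map_fst[OF assms(3,2)] F
          charted_open[OF assms(5)]])
  show "smooth_map (mprod M N) N' (\<lambda>p. G (snd p))"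
    by (rule smooth_map_compose[OF charted_mprod[OF assms(1,2)] assms(2) smooth_map_snd[OF assms(1,4)] G
          charted_open[OF assms(6)]])
qed

text \<open>The coordinates of a vector in the chart \<open>l\<close> are smooth where the base
  point lies in that chart. As \<open>fin\<close> keeps the base point, this region is the open set
  \<open>cdom (dprod S) l \<times> pts U\<close>, and composition with \<open>G\<close> applies
  there.\<close>

lemma smooth_vector_pullback:
  assumes S: "S \<in> TFS" and U: "U \<in> TFS" and Q: "charted Q"
    and fin: "smooth_map (mprod (dprod S) (dprod U)) (tangent_bundle (dprod S)) fin"
    and vec: "\<And>s u. s \<in> pts S \<Longrightarrow> u \<in> pts U \<Longrightarrow> fst (fin (s, u)) = s \<and> snd (fin (s, u)) \<in> tangent_space (dprod S) s"
    and G: "smooth_map Q (mprod (dprod S) (dprod U)) G"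
    and l: "l \<in> charts (dprod S)" and p: "p \<in> mindex (dprod S)"
  shows "smooth_on Q {q. fst (G q) \<in> cdom (dprod S) l} (\<lambda>q. snd (fin (G q)) l p)"
proof -
  have P: "charted (mprod (dprod S) (dprod U))" using S U by (simp add: charted_mprod charted_dprod)
  let ?W = "cdom (dprod S) l \<times> pts U"
  have vec': "fst (fin z) = fst z" "snd (fin z) \<in> tangent_space (dprod S) (fst z)"
    if "z \<in> pts S \<times> pts U" for z
    using vec[of "fst z" "snd z"] that by auto
  have "smooth_on (mprod (dprod S) (dprod U)) {z. fst (fin z) \<in> cdom (dprod S) l} (\<lambda>z. snd (fin z) l p)"
    by (rule smooth_map_tangentD[OF P fin _ l p]) (use vec' in simp)
  then have "smooth_on (mprod (dprod S) (dprod U)) ?W (\<lambda>z. snd (fin z) l p)"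
    by (rule smooth_on_subset)
       (use vec' charted_cdom_subset[OF charted_dprod[OF S] l] in auto)
  moreover have "openin (mtop (mprod (dprod S) (dprod U))) ?W"
    using charted_open[OF charted_dprod[OF S] l] by (simp add: openin_prod_Times_iff)
  ultimately have "smooth_on Q {q. G q \<in> ?W} (\<lambda>q. snd (fin (G q)) l p)"
    by (intro smooth_on_compose[OF Q P G])
  then show ?thesis
  proof (rule smooth_on_subset, intro subsetI)
    fix q assume q: "q \<in> {q. fst (G q) \<in> cdom (dprod S) l} \<inter> (\<Union>k\<in>charts Q. cdom Q k)"
    then have "G q \<in> points (mprod (dprod S) (dprod U))"
      using continuous_map_image_subset_topspace[OF smooth_map_continuous[OF G]] charted_points[OF Q] by blast
    then show "q \<in> {q. G q \<in> ?W}" using q by (auto simp: mem_Times_iff)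
  qed
qed

lemma G_mu_into:
  assumes X: "X \<in> boxes" and X': "X' \<in> boxes" and a: "a \<in> G_ob X" and a': "a' \<in> G_ob X'"
  shows "G_mu X X' (a, a') \<in> G_ob (box_sum X X')"
proof -
  obtain S fin fout where a: "a = (S, fin, fout)" and f: "(S, fin, fout) \<in> G_ob X" using G_ob_cases[OF a] .
  obtain S' fin' fout' where a': "a' = (S', fin', fout')" and f': "(S', fin', fout') \<in> G_ob X'"
    using G_ob_cases[OF a'] .
  note F = G_obD[OF f X] and F' = G_obD[OF f' X']
  let ?R = "tsum S S'" and ?U = "tsum (box_in X) (box_in X')" and ?A = "fst S" and ?A' = "fst S'"
  have TFS: "?R \<in> TFS" "?U \<in> TFS" using F(1) F'(1) X X' by (simp_all add: tsum_TFS)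
  have finA: "finite ?A" using F(1) by (rule TFS_finite)
  have ch: "charted (dprod T)" "is_manifold (dprod T)" if "T \<in> TFS" for T
    using that by (simp_all add: charted_dprod is_manifold_dprod)
  let ?Q = "mprod (dprod ?R) (dprod ?U)"
  have Q: "charted ?Q" using TFS by (simp add: charted_mprod ch)
  \<comment> \<open>\<open>?G\<close> and \<open>?G'\<close> project the joint state and the joint
    input to the two component systems.\<close>
  let ?G = "\<lambda>q. (restrict (fst q) ?A, restrict (snd q) (lin X))"
  let ?G' = "\<lambda>q. (rpart ?A ?A' (fst q), rpart (lin X) (lin X') (snd q))"
  have G: "smooth_map ?Q (mprod (dprod S) (dprod (box_in X))) ?G"
    using F(1) F'(1) X X' TFS by (intro smooth_map_mprod_map smooth_map_parts) (simp_all add: ch)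
  have G': "smooth_map ?Q (mprod (dprod S') (dprod (box_in X'))) ?G'"
    using F(1) F'(1) X X' TFS by (intro smooth_map_mprod_map smooth_map_parts) (simp_all add: ch)
  let ?v = "\<lambda>q. snd (fin (?G q))" and ?w = "\<lambda>q. snd (fin' (?G' q))"
  let ?F = "\<lambda>q. (fst q, join_vec S S' (fst q) (?v q) (?w q))"
  have vec: "snd (?F q) \<in> tangent_space (dprod ?R) (fst q)" if "q \<in> pts ?R \<times> pts ?U" for q
  proof -
    have q: "fst q \<in> pts ?R" "snd q \<in> pts ?U" using that by auto
    note s = pts_tsum[OF q(1) F(1)] and u = pts_tsum[OF q(2) boxes_TFS(1)[OF X]]
    show ?thesis
      using join_vec_tangent[OF F(1) F'(1) q(1) F(7)[OF s(1) u(1)] F'(7)[OF s(2) u(2)]] by simp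
  qed
  have "smooth_map ?Q (tangent_bundle (dprod ?R)) ?F"
  proof (rule smooth_map_tangentI[OF Q ch(1)[OF TFS(1)]])
    show "smooth_map ?Q (dprod ?R) (\<lambda>q. fst (?F q))"
      using TFS by (simp add: smooth_map_fst ch)
    show "snd (?F q) \<in> tangent_space (dprod ?R) (fst (?F q))" if "q \<in> points ?Q" for q
      using vec[of q] that by simp
    fix l p assume l: "l \<in> charts (dprod ?R)" and p: "p \<in> mindex (dprod ?R)"
    \<comment> \<open>Cut down to the points, this is the preimage of a chart domain and hence open,
      as replacing the function on it requires.\<close>
    let ?W = "{q. fst q \<in> cdom (dprod ?R) l} \<inter> points ?Q"
    have W: "openin (mtop ?Q) ?W"
      using openin_continuous_map_preimage[OF smooth_map_continuous[OF smooth_map_fst[OF ch(2)[OF TFS(1)] ch(1)[OF TFS(2)]]]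
          charted_open[OF ch(1)[OF TFS(1)] l]] by (simp add: Int_def conj_commute)
    have l_at: "l \<in> charts_at (dprod ?R) (fst q)" if "q \<in> ?W" for q
      using that l by (simp add: charts_at_def)
    obtain b j where b: "p = (b, j)" "b \<in> dsum ?A ?A'" "j \<in> mindex (snd ?R b)"
      using p by (auto simp: dprod_simps)
    \<comment> \<open>On \<open>?W\<close> the joined vector has, at an index from one summand, the
      coordinate of that component's vector in the corresponding part of the chart
      \<open>l\<close>.\<close>
    have "smooth_on ?Q ?W (\<lambda>q. snd (?F q) l p)"
      using b(2)
    proof (cases rule: dsumE)
      case inl
      have l': "restrict l ?A \<in> charts (dprod S)"
        using l ball_tsum[OF finA, of S' "\<lambda>a M. l a \<in> charts M"] by (simp add: dprod_simps PiE_iff)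
      have "smooth_on ?Q {q. fst (?G q) \<in> cdom (dprod S) (restrict l ?A)} (\<lambda>q. snd (fin (?G q)) (restrict l ?A) p)"
        by (rule smooth_vector_pullback[OF F(1) boxes_TFS(1)[OF X] Q F(4) _ G l'])
           (use F(6,7) inl b in \<open>simp_all add: dprod_simps\<close>)
      then have "smooth_on ?Q ?W (\<lambda>q. snd (fin (?G q)) (restrict l ?A) p)"
        by (rule smooth_on_subset)
           (use charts_at_tsum(1)[OF l_at F(1)] in \<open>auto simp: charts_at_def\<close>)
      then show ?thesis
        by (rule smooth_on_cong[OF Q W])
           (use inl b in \<open>simp add: join_vec_apply(1)[OF l_at]\<close>)
    next
      case (inr c)
      have l': "rpart ?A ?A' l \<in> charts (dprod S')"
        using l ball_tsum[OF finA, of S' "\<lambda>a M. l a \<in> charts M"] by (simp add: dprod_simps PiE_iff)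
      have "smooth_on ?Q {q. fst (?G' q) \<in> cdom (dprod S') (rpart ?A ?A' l)}
          (\<lambda>q. snd (fin' (?G' q)) (rpart ?A ?A' l) (c, j))"
        by (rule smooth_vector_pullback[OF F'(1) boxes_TFS(1)[OF X'] Q F'(4) _ G' l'])
           (use F'(6,7) inr b finA in \<open>simp_all add: dprod_simps\<close>)
      then have "smooth_on ?Q ?W (\<lambda>q. snd (fin' (?G' q)) (rpart ?A ?A' l) (c, j))"
        by (rule smooth_on_subset)
           (use charts_at_tsum(2)[OF l_at F(1)] in \<open>auto simp: charts_at_def\<close>)
      then show ?thesis
        by (rule smooth_on_cong[OF Q W])
           (use inr b finA in \<open>simp add: join_vec_apply(2)[OF l_at _ finA inr(1) refl]\<close>)
    qed
    then show "smooth_on ?Q {q. fst (?F q) \<in> cdom (dprod ?R) l} (\<lambda>q. snd (?F q) l p)"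
      by (rule smooth_on_subset) (use charted_points[OF Q] in auto)
  qed
  then have "smooth_map ?Q (tangent_bundle (dprod ?R)) (\<lambda>(s, u)\<in>pts ?R \<times> pts ?U.
       (s, join_vec S S' s (snd (fin (restrict s ?A, restrict u (lin X))))
             (snd (fin' (rpart ?A ?A' s, rpart (lin X) (lin X') u)))))"
    by (rule smooth_map_cong[OF Q]) (auto simp: openin_tcdom)
  moreover have "smooth_map (dprod ?R) (dprod (tsum (box_out X) (box_out X')))
      (\<lambda>s\<in>pts ?R. copair (lout X) (lout X') (fout (restrict s ?A)) (fout' (rpart ?A ?A' s)))"
  proof (rule smooth_map_dprod_cong[OF ch(1)[OF TFS(1)]])
    show "tsum (box_out X) (box_out X') \<in> TFS" using X X' by (simp add: tsum_TFS)
    show "smooth_map (dprod ?R) (dprod (tsum (box_out X) (box_out X')))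
      (\<lambda>s. copair (lout X) (lout X') (fout (restrict s ?A)) (fout' (rpart ?A ?A' s)))"
    proof (rule smooth_map_dprodI)
      fix b assume "b \<in> fst (tsum (box_out X) (box_out X'))"
      then have "b \<in> dsum (lout X) (lout X')" by simp
      then show "smooth_map (dprod ?R) (snd (tsum (box_out X) (box_out X')) b)
          (\<lambda>s. copair (lout X) (lout X') (fout (restrict s ?A)) (fout' (rpart ?A ?A' s)) b)"
      proof (cases rule: dsumE)
        case inl
        have "smooth_map (dprod S) (snd (box_out X) b) (\<lambda>s. fout s b)"
          by (rule smooth_map_compose[OF ch(1) ch(1) F(5) smooth_map_dprod_coord])
             (simp_all add: inl X F(1) charted_open TFS_charted)
        from smooth_map_compose[OF ch(1) ch(1) smooth_map_parts(1)[OF F(1) F'(1)] this]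
        show ?thesis using inl X F(1) TFS by (simp add: charted_open TFS_charted)
      next
        case (inr c)
        have "smooth_map (dprod S') (snd (box_out X') c) (\<lambda>s. fout' s c)"
          by (rule smooth_map_compose[OF ch(1) ch(1) F'(5) smooth_map_dprod_coord])
             (simp_all add: inr X' F'(1) charted_open TFS_charted)
        from smooth_map_compose[OF ch(1) ch(1) smooth_map_parts(2)[OF F(1) F'(1)] this]
        show ?thesis using inr X X' F'(1) TFS by (simp add: charted_open TFS_charted)
      qed
    qed simp
  qed simp
  ultimately show ?thesis
    unfolding a a' G_mu_of[OF X X' f f'] G_ob_iff[OF box_sum_boxes[OF X X']]
    using TFS vec by (auto simp: mem_Times_iff)
qed

text \<open>In a sum of diagrams no wire crosses between the summands, so each part of the rerouted
  input is determined by the matching parts of the data.\<close>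

lemma reroute_in_sum:
  assumes boxes: "X \<in> boxes" "X' \<in> boxes" "Y \<in> boxes" "Y' \<in> boxes"
    and ok: "wiring_ok X X' \<alpha> \<beta>" "wiring_ok Y Y' \<gamma> \<delta>"
  defines "r \<equiv> \<lambda>u v y. reroute_in (box_sum X Y) (sum_in X X' Y \<alpha> \<gamma>) (copair (lout X) (lout Y) u v) y"
  shows "restrict (r u v y) (lin X) = reroute_in X \<alpha> u (restrict y (lin X'))"
    "rpart (lin X) (lin Y) (r u v y) = reroute_in Y \<gamma> v (rpart (lin X') (lin Y') y)"
proof -
  note [simp] = boxes
  show "restrict (r u v y) (lin X) = reroute_in X \<alpha> u (restrict y (lin X'))"
    unfolding reroute_in_def[of X]
  proof (rule restrict_ext)
    fix a assume a: "a \<in> lin X"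
    from ok(1) a show "r u v y a = case_sum u (restrict y (lin X')) (\<alpha> a)"
      by (cases rule: wiring_ok_inE) (use a in \<open>simp_all add: r_def reroute_in_def dsumI1\<close>)
  qed
  show "rpart (lin X) (lin Y) (r u v y) = reroute_in Y \<gamma> v (rpart (lin X') (lin Y') y)"
    unfolding rpart_def[of "lin X"] reroute_in_def[of Y]
  proof (rule restrict_ext)
    fix a assume a: "a \<in> lin Y"
    from ok(2) a show "r u v y (inr (lin X) a) = case_sum v (rpart (lin X') (lin Y') y) (\<gamma> a)"
      by (cases rule: wiring_ok_inE) (use a in \<open>simp_all add: r_def reroute_in_def\<close>)
  qed
qed

lemma reroute_out_sum:
  assumes boxes: "X \<in> boxes" "X' \<in> boxes" "Y \<in> boxes" "Y' \<in> boxes"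
    and ok: "wiring_ok X X' \<alpha> \<beta>" "wiring_ok Y Y' \<gamma> \<delta>"
  shows "reroute_out (box_sum X' Y') (sum_out X X' Y' \<beta> \<delta>) (copair (lout X) (lout Y) u v) =
    copair (lout X') (lout Y') (reroute_out X' \<beta> u) (reroute_out Y' \<delta> v)"
proof (rule extensional_dsum_eqI)
  note [simp] = boxes
  show "reroute_out (box_sum X' Y') (sum_out X X' Y' \<beta> \<delta>) (copair (lout X) (lout Y) u v) \<in>
      extensional (dsum (lout X') (lout Y'))" by (simp add: reroute_out_def)
  show "reroute_out (box_sum X' Y') (sum_out X X' Y' \<beta> \<delta>) (copair (lout X) (lout Y) u v) b =
      copair (lout X') (lout Y') (reroute_out X' \<beta> u) (reroute_out Y' \<delta> v) b" if "b \<in> lout X'" for b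
    using that wiring_ok_out[OF ok(1) that] by (simp add: reroute_out_def dsumI1)
  show "reroute_out (box_sum X' Y') (sum_out X X' Y' \<beta> \<delta>) (copair (lout X) (lout Y) u v) (inr (lout X') b) =
      copair (lout X') (lout Y') (reroute_out X' \<beta> u) (reroute_out Y' \<delta> v) (inr (lout X') b)"
    if "b \<in> lout Y'" for b
    using that wiring_ok_out[OF ok(2) that] by (simp add: reroute_out_def)
qed simp

lemma G_mu_natural:
  assumes boxes: "X \<in> boxes" "X' \<in> boxes" "Y \<in> boxes" "Y' \<in> boxes"
    and hom: "\<Phi> \<in> wirings X X'" "\<Psi> \<in> wirings Y Y'" and a: "a \<in> G_ob X" and b: "b \<in> G_ob Y"
  shows "G_map (wiring_sum \<Phi> \<Psi>) (G_mu X Y (a, b)) = G_mu X' Y' (G_map \<Phi> a, G_map \<Psi> b)"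
proof -
  obtain \<alpha> \<beta> where \<Phi>: "\<Phi> = wiring_of X X' \<alpha> \<beta>" and ok: "wiring_ok X X' \<alpha> \<beta>"
    using wirings_cases[OF hom(1) boxes(1,2)] .
  obtain \<gamma> \<delta> where \<Psi>: "\<Psi> = wiring_of Y Y' \<gamma> \<delta>" and ok': "wiring_ok Y Y' \<gamma> \<delta>"
    using wirings_cases[OF hom(2) boxes(3,4)] .
  obtain S fin fout where a': "a = (S, fin, fout)" and f: "(S, fin, fout) \<in> G_ob X" using G_ob_cases[OF a] .
  obtain T gin gout where b': "b = (T, gin, gout)" and g: "(T, gin, gout) \<in> G_ob Y" using G_ob_cases[OF b] .
  note F = G_obD[OF f boxes(1)] and G = G_obD[OF g boxes(3)]
  note ok_sum = wiring_ok_sum[OF boxes ok ok']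
  have sums: "box_sum X Y \<in> boxes" "box_sum X' Y' \<in> boxes" using boxes by simp_all
  let ?fin = "\<lambda>(s, y)\<in>pts S \<times> pts (box_in X'). fin (s, reroute_in X \<alpha> (fout s) y)"
    and ?fout = "\<lambda>s\<in>pts S. reroute_out X' \<beta> (fout s)"
    and ?gin = "\<lambda>(s, y)\<in>pts T \<times> pts (box_in Y'). gin (s, reroute_in Y \<gamma> (gout s) y)"
    and ?gout = "\<lambda>s\<in>pts T. reroute_out Y' \<delta> (gout s)"
  \<comment> \<open>Membership of the rerouted systems is what allows \<open>G_mu_of\<close> to be
    used for their product.\<close>
  have f': "(S, ?fin, ?fout) \<in> G_ob X'" and g': "(T, ?gin, ?gout) \<in> G_ob Y'"
    using G_map_into[OF boxes(1,2) hom(1) a] G_map_into[OF boxes(3,4) hom(2) b]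
    unfolding \<Phi> \<Psi> a' b' G_map_of[OF boxes(1,2) ok] G_map_of[OF boxes(3,4) ok'] .
  let ?mout = "\<lambda>s. copair (lout X) (lout Y) (fout (restrict s (fst S))) (gout (rpart (fst S) (fst T) s))"
  let ?r = "\<lambda>s y. reroute_in (box_sum X Y) (sum_in X X' Y \<alpha> \<gamma>) (?mout s) y"
  \<comment> \<open>\<open>?mout\<close> is the output map of the product system, so its values are
    points because \<open>G_mu\<close> yields a system. Rerouted inputs are then points too, and the
    cut-off of the product vector field disappears.\<close>
  have "?mout s \<in> pts (tsum (box_out X) (box_out Y))" if s: "s \<in> pts (tsum S T)" for s
    using G_obD(8)[OF G_mu_into[OF boxes(1,3) f g, unfolded G_mu_of[OF boxes(1,3) f g]] sums(1) s] s by simp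
  then have r: "?r s y \<in> pts (tsum (box_in X) (box_in Y))"
    if "s \<in> pts (tsum S T)" "y \<in> pts (tsum (box_in X') (box_in Y'))" for s y
    using reroute_in_pts[OF ok_sum] that by simp
  show ?thesis
    unfolding \<Phi> \<Psi> a' b' wiring_sum_of[OF boxes ok ok'] G_map_of[OF boxes(1,2) ok] G_map_of[OF boxes(3,4) ok']
      G_mu_of[OF boxes(1,3) f g] G_mu_of[OF boxes(2,4) f' g'] G_map_of[OF sums ok_sum] box_sum_simps
    by (intro prod_eqI; simp only: fst_conv snd_conv; (rule restrict_Times_eqI | rule restrict_ext))
       (use pts_tsum[OF _ F(1), of _ T] pts_tsum[OF _ boxes_TFS(1)[OF boxes(2)], of _ "box_in Y'"] r in
         \<open>simp_all add: reroute_in_sum[OF boxes ok ok'] reroute_out_sum[OF boxes ok ok']\<close>)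
qed

section \<open>Associativity of the coherence maps\<close>

lemma dsum_Int [simp]: "dsum A B \<inter> A = A"
  by (auto intro: dsumI1)

lemma parts_assoc:
  assumes "finite A" "finite B"
  shows "rpart A B (restrict x (dsum A B)) = restrict (rpart A (dsum B C) x) B"
    "rpart (dsum A B) C x = rpart B C (rpart A (dsum B C) x)"
  using assms by (auto simp: fun_eq_iff rpart_def restrict_def dsumI1 inr_dsum)

text \<open>By strict associativity both sides are cut off at the same charts and coordinates. An
  index there lies in \<open>R\<close>, \<open>S\<close> or \<open>T\<close>, and both bracketings
  read \<open>u\<close>, \<open>v\<close> or \<open>w\<close> accordingly, in the same part of the
  chart.\<close>

lemma join_vec_assoc:
  assumes R: "R \<in> TFS" and S: "S \<in> TFS" and T: "T \<in> TFS"
  shows "join_vec (tsum R S) T x (join_vec R S (restrict x (dsum (fst R) (fst S))) u v) w =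
    join_vec R (tsum S T) x u (join_vec S T (rpart (fst R) (dsum (fst S) (fst T)) x) v w)"
proof -
  note fin [simp] = TFS_finite[OF R] TFS_finite[OF S] TFS_finite[OF T]
  let ?x = "restrict x (dsum (fst R) (fst S))" and ?x' = "rpart (fst R) (dsum (fst S) (fst T)) x"
  have assoc: "tsum (tsum R S) T = tsum R (tsum S T)" by (rule tsum_assoc[OF R S T])
  have RS: "tsum R S \<in> TFS" using R S by (rule tsum_TFS)
  have "join_vec (tsum R S) T x (join_vec R S ?x u v) w k (a, i) =
      join_vec R (tsum S T) x u (join_vec S T ?x' v w) k (a, i)"
    if k: "k \<in> charts_at (dprod (tsum R (tsum S T))) x" and ai: "(a, i) \<in> mindex (dprod (tsum R (tsum S T)))" for k a i
  proof -
    have k': "k \<in> charts_at (dprod (tsum (tsum R S) T)) x" using k by (simp add: assoc)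
    have k1: "restrict k (dsum (fst R) (fst S)) \<in> charts_at (dprod (tsum R S)) ?x"
      using charts_at_tsum(1)[OF k' RS] by simp
    have k2: "rpart (fst R) (dsum (fst S) (fst T)) k \<in> charts_at (dprod (tsum S T)) ?x'"
      using charts_at_tsum(2)[OF k R] by simp
    have a: "a \<in> dsum (fst R) (dsum (fst S) (fst T))" and i: "i \<in> mindex (snd (tsum R (tsum S T)) a)"
      using ai by (simp_all add: dprod_simps)
    have i': "i \<in> mindex (snd (tsum (tsum R S) T) a)" using i by (simp add: assoc)
    from a show ?thesis
    proof (cases rule: dsumE)
      case inl
      have "i \<in> mindex (snd (tsum R S) a)" using i inl by simp
      then show ?thesis
        using inl join_vec_apply(1)[OF k i, of u "join_vec S T ?x' v w"]
          join_vec_apply(1)[OF k' i', of "join_vec R S ?x u v" w]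
          join_vec_apply(1)[OF k1, of i a u v]
        by (simp add: dsumI1)
    next
      case (inr c)
      have ic: "i \<in> mindex (snd (tsum S T) c)" using i inr by simp
      note right = join_vec_apply(2)[OF k i fin(1), of c u "join_vec S T ?x' v w"]
      from inr(1) show ?thesis
      proof (cases rule: dsumE)
        case inl
        have "i \<in> mindex (snd (tsum R S) a)" using ic inl inr by simp
        then show ?thesis
          using inl inr right join_vec_apply(1)[OF k' i', of "join_vec R S ?x u v" w]
            join_vec_apply(2)[OF k1 _ fin(1), of i a c u v] join_vec_apply(1)[OF k2 ic, of v w]
          by (simp add: parts_assoc(1)[where C="fst T"])
      next
        case (inr d)
        have "a = inr (dsum (fst R) (fst S)) d"
          using inr \<open>a = inr (fst R) c\<close> by (simp add: inr_dsum)
        then show ?thesis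
          using inr \<open>c \<in> _\<close> \<open>a = inr (fst R) c\<close> right
            join_vec_apply(2)[OF k' i', of d "join_vec R S ?x u v" w] join_vec_apply(2)[OF k2 ic fin(2) inr, of v w]
          by (simp add: parts_assoc(2))
      qed
    qed
  qed
  then show ?thesis
    unfolding join_vec_def[of "tsum R S"] join_vec_def[of R "tsum S T"] assoc
    by (intro restrict_ext) (auto simp: fun_eq_iff restrict_def)
qed

lemma G_mu_assoc:
  assumes boxes: "X \<in> boxes" "Y \<in> boxes" "Z \<in> boxes" and a: "a \<in> G_ob X" and b: "b \<in> G_ob Y" and c: "c \<in> G_ob Z"
  shows "G_mu (box_sum X Y) Z (G_mu X Y (a, b), c) = G_mu X (box_sum Y Z) (a, G_mu Y Z (b, c))"
proof -
  note [simp] = boxes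
  obtain R fin fout where a': "a = (R, fin, fout)" and f: "(R, fin, fout) \<in> G_ob X" using G_ob_cases[OF a] .
  obtain S gin gout where b': "b = (S, gin, gout)" and g: "(S, gin, gout) \<in> G_ob Y" using G_ob_cases[OF b] .
  obtain T hin hout where c': "c = (T, hin, hout)" and h: "(T, hin, hout) \<in> G_ob Z" using G_ob_cases[OF c] .
  note F = G_obD[OF f boxes(1)] and G = G_obD[OF g boxes(2)] and H = G_obD[OF h boxes(3)]
  \<comment> \<open>Memberships in the explicit form of \<open>G_mu_of\<close>, so that this rule
    can be applied again to the outer product.\<close>
  note fg = G_mu_into[OF boxes(1,2) f g, unfolded G_mu_of[OF boxes(1,2) f g]]
  note gh = G_mu_into[OF boxes(2,3) g h, unfolded G_mu_of[OF boxes(2,3) g h]]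
  have sums: "box_sum X Y \<in> boxes" "box_sum Y Z \<in> boxes" by simp_all
  note [simp] = F(1) G(1) H(1) TFS_finite[OF F(1)] TFS_finite[OF G(1)] TFS_finite[OF H(1)]
  let ?s = "\<lambda>s. restrict s (dsum (fst R) (fst S))" and ?t = "\<lambda>s. rpart (fst R) (dsum (fst S) (fst T)) s"
  let ?u = "\<lambda>u. restrict u (dsum (lin X) (lin Y))" and ?v = "\<lambda>u. rpart (lin X) (dsum (lin Y) (lin Z)) u"
  have assoc: "tsum (tsum R S) T = tsum R (tsum S T)"
    "tsum (tsum (box_in X) (box_in Y)) (box_in Z) = tsum (box_in X) (tsum (box_in Y) (box_in Z))"
    by (simp_all add: tsum_assoc)
  have s: "?s s \<in> pts (tsum R S)" "?t s \<in> pts (tsum S T)" if s: "s \<in> pts (tsum R (tsum S T))" for s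
    using pts_tsum(1)[of s "tsum R S" T] pts_tsum(2)[OF s F(1)] s by (simp_all add: assoc tsum_TFS)
  have u: "?u u \<in> pts (tsum (box_in X) (box_in Y))" "?v u \<in> pts (tsum (box_in Y) (box_in Z))"
    if u: "u \<in> pts (tsum (box_in X) (tsum (box_in Y) (box_in Z)))" for u
    using pts_tsum(1)[of u "tsum (box_in X) (box_in Y)" "box_in Z"] pts_tsum(2)[OF u] u
    by (simp_all add: assoc tsum_TFS)
  show ?thesis
    unfolding a' b' c' G_mu_of[OF boxes(1,2) f g] G_mu_of[OF boxes(2,3) g h]
      G_mu_of[OF sums(1) boxes(3) fg h] G_mu_of[OF boxes(1) sums(2) f gh] box_sum_simps assoc tsum_simps(1)
    by (intro prod_eqI; simp only: fst_conv snd_conv; (rule restrict_Times_eqI | rule restrict_ext))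
       (simp_all add: s u parts_assoc(1)[where A="fst R" and C="fst T"]
         parts_assoc(1)[where A="lin X" and C="lin Z"] parts_assoc(2) join_vec_assoc copair_assoc)
qed

section \<open>The trivial system and the unit laws\<close>

lemma mindex_tempty [simp]: "mindex (dprod tempty) = {}"
  by (simp add: dprod_simps)

text \<open>The empty product has no coordinates, so the conditions on tangent vectors and on their
  smoothness are vacuous. What needs an argument is the base point, which moves by a
  projection.\<close>

lemma G_unit_in: "G_unit () \<in> G_ob box_unit"
proof -
  let ?fin = "\<lambda>(s, u)\<in>pts tempty \<times> pts tempty. (s, \<lambda>k\<in>charts_at (dprod tempty) s. \<lambda>i\<in>mindex (dprod tempty). 0)"
  have ch: "charted (dprod tempty)" "is_manifold (dprod tempty)"
    using charted_dprod[OF tempty_TFS] is_manifold_dprod[OF tempty_TFS] .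
  have Q: "charted (mprod (dprod tempty) (dprod tempty))" by (rule charted_mprod[OF ch(1,1)])
  have vec: "(\<lambda>k\<in>charts_at (dprod tempty) s. \<lambda>i\<in>mindex (dprod tempty). 0) \<in> tangent_space (dprod tempty) s" for s
    unfolding tangent_space_dprod[OF tempty_TFS] by (auto simp: restrict_def)
  have "smooth_map (mprod (dprod tempty) (dprod tempty)) (tangent_bundle (dprod tempty)) ?fin"
  proof (rule smooth_map_tangentI[OF Q ch(1)])
    show "smooth_map (mprod (dprod tempty) (dprod tempty)) (dprod tempty) (\<lambda>q. fst (?fin q))"
      by (rule smooth_map_dprod_cong[OF Q smooth_map_fst[OF ch(2,1)] tempty_TFS]) auto
    show "snd (?fin q) \<in> tangent_space (dprod tempty) (fst (?fin q))"
      if "q \<in> points (mprod (dprod tempty) (dprod tempty))" for q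
      using that vec by auto
  qed simp
  moreover have "smooth_map (dprod tempty) (dprod tempty) (\<lambda>s\<in>pts tempty. \<lambda>_. undefined)"
    by (rule smooth_map_dprodI) simp_all
  ultimately show ?thesis
    unfolding G_unit_def G_ob_iff[OF box_unit_boxes] fst_conv snd_conv using vec tempty_TFS by auto
qed

text \<open>A sum with \<open>tempty\<close> is strictly \<open>S\<close>, and the parts of a chart
  are the chart itself. The cut-offs in \<open>join_vec\<close> change nothing because tangent
  vectors are extensional already.\<close>

lemma join_vec_unit:
  assumes S: "S \<in> TFS" and v: "v \<in> tangent_space (dprod S) x"
  shows "join_vec tempty S x w v = v" "join_vec S tempty x v w = v"
proof -
  have ext: "v \<in> extensional (charts_at (dprod S) x)" "\<And>k. k \<in> charts_at (dprod S) x \<Longrightarrow> v k \<in> extensional (mindex (dprod S))"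
    using v unfolding tangent_space_def by (auto simp: PiE_iff)
  have k: "restrict k (fst S) = k" "rpart {} (fst S) k = k" if "k \<in> charts_at (dprod S) x" for k
    using that by (auto simp: charts_at_dprod rpart_def fun_eq_iff extensional_def)
  have mem: "a \<in> fst S" if "(a, i) \<in> mindex (dprod S)" for a i using that by (simp add: dprod_simps)
  show "join_vec tempty S x w v = v"
  proof (rule extensionalityI[OF _ ext(1)])
    show "join_vec tempty S x w v k = v k" if "k \<in> charts_at (dprod S) x" for k
      by (rule extensionalityI[OF _ ext(2)[OF that]])
         (use that k[OF that] in \<open>auto simp: join_vec_def tsum_tempty[OF S] ub_def\<close>)
  qed (simp add: join_vec_def tsum_tempty[OF S])
  show "join_vec S tempty x v w = v"
  proof (rule extensionalityI[OF _ ext(1)])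
    show "join_vec S tempty x v w k = v k" if "k \<in> charts_at (dprod S) x" for k
      by (rule extensionalityI[OF _ ext(2)[OF that]])
         (use that k[OF that] mem in \<open>auto simp: join_vec_def tsum_tempty[OF S]\<close>)
  qed (simp add: join_vec_def tsum_tempty[OF S])
qed

lemma rpart_empty: "x \<in> extensional B \<Longrightarrow> rpart {} B x = x"
  by (auto simp: rpart_def fun_eq_iff extensional_def)

lemma G_mu_unit:
  assumes X: "X \<in> boxes" and a: "a \<in> G_ob X"
  shows "G_mu box_unit X (G_unit (), a) = a" "G_mu X box_unit (a, G_unit ()) = a"
proof -
  obtain S fin fout where a': "a = (S, fin, fout)" and f: "(S, fin, fout) \<in> G_ob X" using G_ob_cases[OF a] .
  note F = G_obD[OF f X]
  obtain ein eout where e': "G_unit () = (tempty, ein, eout)" and e: "(tempty, ein, eout) \<in> G_ob box_unit"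
    using G_unit_in unfolding G_unit_def by blast
  have ext: "restrict s (fst S) = s" "rpart {} (fst S) s = s" if "s \<in> pts S" for s
    using pts_extensional[OF that] by (simp_all add: extensional_restrict rpart_empty)
  have ext': "restrict u (lin X) = u" "rpart {} (lin X) u = u" if "u \<in> pts (box_in X)" for u
    using pts_extensional[OF that] by (simp_all add: extensional_restrict rpart_empty)
  have out: "fout s \<in> extensional (lout X)" if "s \<in> pts S" for s
    using pts_extensional[OF F(8)[OF that]] .
  have eq: "(s, snd (fin (s, u))) = fin (s, u)" if "s \<in> pts S" "u \<in> pts (box_in X)" for s u
    using F(6)[OF that] by (simp add: prod_eq_iff)
  note empty = tsum_tempty[OF F(1)] tsum_tempty[OF boxes_TFS(1)[OF X]]
  have fin: "restrict fin (pts S \<times> pts (box_in X)) = fin" "restrict fout (pts S) = fout"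
    using F(2,3) by (simp_all add: extensional_restrict)
  \<comment> \<open>The contribution of the trivial system is kept abstract as \<open>w\<close>,
    since none of the coordinates of the sum belongs to it.\<close>
  have "(\<lambda>(s, u)\<in>pts S \<times> pts (box_in X). (s, join_vec tempty S s (w s u)
      (snd (fin (rpart {} (fst S) s, rpart {} (lin X) u))))) = restrict fin (pts S \<times> pts (box_in X))" for w
    by (rule restrict_Times_eqI) (simp add: ext ext' join_vec_unit(1)[OF F(1) F(7)] eq)
  moreover have "(\<lambda>s\<in>pts S. copair {} (lout X) (w s) (fout (rpart {} (fst S) s))) = restrict fout (pts S)"
    for w :: "_ \<Rightarrow> nat \<Rightarrow> real"
    by (rule restrict_ext) (simp add: ext copair_empty1[OF out])
  ultimately show "G_mu box_unit X (G_unit (), a) = a"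
    unfolding e' a' G_mu_of[OF box_unit_boxes X e f] fst_conv snd_conv tempty_fst empty fin by simp
  have "(\<lambda>(s, u)\<in>pts S \<times> pts (box_in X). (s, join_vec S tempty s
      (snd (fin (restrict s (fst S), restrict u (lin X)))) (w s u))) = restrict fin (pts S \<times> pts (box_in X))" for w
    by (rule restrict_Times_eqI) (simp add: ext ext' join_vec_unit(2)[OF F(1) F(7)] eq)
  moreover have "(\<lambda>s\<in>pts S. copair (lout X) {} (fout (restrict s (fst S))) (w s)) = restrict fout (pts S)"
    for w :: "_ \<Rightarrow> nat \<Rightarrow> real"
    by (rule restrict_ext) (simp add: ext copair_empty2[OF out])
  ultimately show "G_mu X box_unit (a, G_unit ()) = a"
    unfolding e' a' G_mu_of[OF X box_unit_boxes f e] fst_conv snd_conv tempty_fst empty fin by simp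
qed

theorem proposition4p5:
  shows "set_algebra WD G_ob G_map G_mu G_unit"
proof (intro set_algebra.intro symmetric_monoidal_cat_WD lax_monoidal_functor.intro monoidal_cat_WD
    lax_monoidal_functor_axioms.intro; unfold WD_simps)
  show "G_mu X Y \<in> G_ob X \<times> G_ob Y \<rightarrow> G_ob (box_sum X Y)" if "X \<in> boxes" "Y \<in> boxes" for X Y
  proof
    fix p assume "p \<in> G_ob X \<times> G_ob Y"
    then show "G_mu X Y p \<in> G_ob (box_sum X Y)" using that by (cases p) (simp add: G_mu_into)
  qed
  show "G_unit \<in> UNIV \<rightarrow> G_ob box_unit" using G_unit_in by simp
  \<comment> \<open>The associator is an identity diagram and acts as the identity, which leaves the
    strict equation \<open>G_mu_assoc\<close>.\<close>
  show "G_map (wiring_id (box_sum (box_sum X Y) Z)) (G_mu (box_sum X Y) Z (G_mu X Y (a, b), c)) =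
      G_mu X (box_sum Y Z) (a, G_mu Y Z (b, c))"
    if "X \<in> boxes" "Y \<in> boxes" "Z \<in> boxes" "a \<in> G_ob X" "b \<in> G_ob Y" "c \<in> G_ob Z" for X Y Z a b c
    using that by (simp add: G_map_id G_mu_into G_mu_assoc[symmetric])
qed (auto simp: G_map_into G_map_id G_map_cmp G_mu_natural G_mu_unit)

end
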